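(* Let $\mathbf{k}$ be an algebraically closed field of characteristic zero, $X=\mathbb{A}^n$, $\mathcal{A}=\mathbf{k}[x_1,\ldots,x_n]$, and $\mathcal{V}=\bigoplus_{i=1}^n\mathcal{A}\frac{\partial}{\partial x_i}$. Every $\mathcal{A}\mathcal{V}$ module $M$ of finite type is a gauge module; that is, there exist a finite-dimensional $\mathbf{k}$-vector space $U$ with $M\cong\mathcal{A}\otimes_{\mathbf{k}}U$ as $\mathcal{A}$-modules, an $\mathcal{A}$-linear representation $\rho$ of $\mathcal{L}_+$ on $\mathcal{A}\otimes U$, and gauge fields $B_1,\ldots,B_n$, such that under this identification the action of $\mathcal{V}$ is given by $$\left(f\frac{\partial}{\partial x_i}\right)(gu)=f\frac{\partial g}{\partial x_i}u+fg\,B_i(u)+\sum_{k\in\mathbb{Z}^n_{\geq0}\setminus\{0\}}\frac{1}{k!}\,g\,\frac{\partial^k f}{\partial x^k}\,\rho\left(x^k\frac{\partial}{\partial x_i}\right)u,\qquad f,g\in\mathcal{A},\ u\in U.$$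
   Context: An $\mathcal{A}\mathcal{V}$ module is an $\mathcal{A}$-module $M$ with a Lie algebra action of $\mathcal{V}$ satisfying $\eta(fm)=f(\eta m)+\eta(f)m$ for $\eta\in\mathcal{V}$, $f\in\mathcal{A}$, $m\in M$; it is of finite type if finitely generated over $\mathcal{A}$. $\mathcal{L}_+\subset\mathcal{V}$ is the subalgebra of vector fields vanishing at the origin (spanned by $x^k\frac{\partial}{\partial x_i}$, $k\ne0$). Multi-index notation: $x^k=x_1^{k_1}\cdots x_n^{k_n}$, $k!=k_1!\cdots k_n!$, $\frac{\partial^k}{\partial x^k}=(\partial/\partial x_1)^{k_1}\cdots(\partial/\partial x_n)^{k_n}$. An $\mathcal{A}$-linear representation of $\mathcal{L}_+$ on $\mathcal{A}\otimes U$ is a Lie algebra homomorphism $\rho:\mathcal{L}_+\to\mathrm{End}_{\mathcal{A}}(\mathcal{A}\otimes U)$; only finitely many $\rho(x^k\frac{\partial}{\partial x_i})$ are nonzero, so the sum is finite. Gauge fields are $\mathcal{A}$-linear maps $B_i:\mathcal{A}\otimes U\to\mathcal{A}\otimes U$, $i=1,\ldots,n$, such that, writing $\frac{\partial}{\partial x_i}$ for $\frac{\partial}{\partial x_i}\otimes\mathrm{id}_U$, (GF1) $\left[\frac{\partial}{\partial x_i}+B_i,\frac{\partial}{\partial x_j}+B_j\right]=0$ for all $i,j$, and (GF2) $\left[\frac{\partial}{\partial x_i}+B_i,\rho(y)\right]=0$ for all $i$ and all $y\in\mathcal{L}_+$. A gauge module is $\mathcal{A}\otimes U$ ($U$ finite-dimensional)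 with such $\rho$ and $B_i$ and with $\mathcal{V}$ acting by the displayed formula. *)

theory Defs
  imports "HOL-Library.Poly_Mapping"
begin

text \<open>Monomials are exponent vectors 'n =>0 nat; polynomials are finitely supported
  coefficient functions on monomials (Poly_Mapping gives the commutative ring structure).\<close>

type_synonym ('n, 'k) mpoly = "('n \<Rightarrow>\<^sub>0 nat) \<Rightarrow>\<^sub>0 'k"

definition alg_closed :: "'k::field itself \<Rightarrow> bool" where
  "alg_closed _ \<longleftrightarrow>
     (\<forall>(c :: nat \<Rightarrow> 'k) (m :: nat). m > 0 \<longrightarrow> c m \<noteq> 0 \<longrightarrow>
        (\<exists>x. (\<Sum>i\<le>m. c i * x ^ i) = 0))"

definition cst :: "'k::zero \<Rightarrow> ('n, 'k) mpoly" where
  "cst c = Poly_Mapping.single 0 c"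

definition xmon :: "('n \<Rightarrow>\<^sub>0 nat) \<Rightarrow> ('n, 'k::{zero,one}) mpoly" where
  "xmon k = Poly_Mapping.single k 1"

definition pd :: "'n \<Rightarrow> ('n, 'k::comm_ring_1) mpoly \<Rightarrow> ('n, 'k) mpoly" where
  "pd i p = (\<Sum>(a :: 'n \<Rightarrow>\<^sub>0 nat)\<in>Poly_Mapping.keys p.
      Poly_Mapping.single (a - Poly_Mapping.single i 1) (of_nat (Poly_Mapping.lookup a i) * Poly_Mapping.lookup p a))"

text \<open>iterated partial derivative d^k/dx^k = (d/dx_1)^(k_1) ... (d/dx_n)^(k_n), written out
  on monomials: d^k x^a = (prod_j a_j!/(a_j-k_j)!) x^(a-k) if k <= a, and 0 otherwise\<close>
definition pdk :: "('n::finite \<Rightarrow>\<^sub>0 nat) \<Rightarrow> ('n, 'k::comm_ring_1) mpoly \<Rightarrow> ('n, 'k) mpoly" where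
  "pdk k p = (\<Sum>(a :: 'n \<Rightarrow>\<^sub>0 nat)\<in>Poly_Mapping.keys p.
      (if (\<forall>j. Poly_Mapping.lookup k j \<le> Poly_Mapping.lookup a j)
       then Poly_Mapping.single (a - k)
              (of_nat (\<Prod>j\<in>UNIV. fact (Poly_Mapping.lookup a j) div fact (Poly_Mapping.lookup a j - Poly_Mapping.lookup k j)) * Poly_Mapping.lookup p a)
       else 0))"

definition mfact :: "('n::finite \<Rightarrow>\<^sub>0 nat) \<Rightarrow> nat" where
  "mfact k = (\<Prod>j\<in>UNIV. fact (Poly_Mapping.lookup k j))"

section \<open>Vector fields V = (+)_i A d/dx_i, represented by their coefficient functions\<close>

type_synonym ('n, 'k) vfield = "'n \<Rightarrow> ('n, 'k) mpoly"

definition vf_app :: "('n::finite, 'k::comm_ring_1) vfield \<Rightarrow> ('n, 'k) mpoly \<Rightarrow> ('n, 'k) mpoly" where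
  "vf_app \<eta> f = (\<Sum>i\<in>UNIV. \<eta> i * pd i f)"

definition vf_bracket :: "('n::finite, 'k::comm_ring_1) vfield \<Rightarrow> ('n, 'k) vfield \<Rightarrow> ('n, 'k) vfield" where
  "vf_bracket \<eta> \<xi> = (\<lambda>j. vf_app \<eta> (\<xi> j) - vf_app \<xi> (\<eta> j))"

definition fdx :: "('n, 'k::zero) mpoly \<Rightarrow> 'n \<Rightarrow> ('n, 'k) vfield" where
  "fdx f i = (\<lambda>j. if j = i then f else 0)"

text \<open>L_+ : vector fields vanishing at the origin = span of x^k d/dx_i, k <> 0\<close>
definition L_plus :: "('n, 'k::zero) vfield set" where
  "L_plus = {\<eta>. \<forall>i. Poly_Mapping.lookup (\<eta> i) 0 = 0}"

definition AV_module ::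
  "(('n::finite, 'k::field) mpoly \<Rightarrow> 'm::ab_group_add \<Rightarrow> 'm) \<Rightarrow> (('n, 'k) vfield \<Rightarrow> 'm \<Rightarrow> 'm) \<Rightarrow> bool" where
  "AV_module smul act \<longleftrightarrow>
     (\<forall>f g m. smul (f + g) m = smul f m + smul g m) \<and>
     (\<forall>f m m'. smul f (m + m') = smul f m + smul f m') \<and>
     (\<forall>f g m. smul (f * g) m = smul f (smul g m)) \<and>
     (\<forall>m. smul 1 m = m) \<and>
     (\<forall>\<eta> \<xi> m. act (\<lambda>i. \<eta> i + \<xi> i) m = act \<eta> m + act \<xi> m) \<and>
     (\<forall>c \<eta> m. act (\<lambda>i. cst c * \<eta> i) m = smul (cst c) (act \<eta> m)) \<and>
     (\<forall>\<eta> m m'. act \<eta> (m + m') = act \<eta> m + act \<eta> m') \<and>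
     (\<forall>\<eta> \<xi> m. act (vf_bracket \<eta> \<xi>) m = act \<eta> (act \<xi> m) - act \<xi> (act \<eta> m)) \<and>
     (\<forall>\<eta> f m. act \<eta> (smul f m) = smul f (act \<eta> m) + smul (vf_app \<eta> f) m)"

definition finite_type :: "(('n, 'k) mpoly \<Rightarrow> 'm::ab_group_add \<Rightarrow> 'm) \<Rightarrow> bool" where
  "finite_type smul \<longleftrightarrow> (\<exists>G. finite G \<and> (\<forall>m. \<exists>c. m = (\<Sum>g\<in>G. smul (c g) g)))"

section \<open>Gauge modules: A (x) U with U = k^d, i.e. A^d, vectors indexed by {..<d}\<close>

definition free_mod :: "nat \<Rightarrow> (nat \<Rightarrow> ('n, 'k::zero) mpoly) set" where
  "free_mod d = {v. \<forall>j\<ge>d. v j = 0}"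

text \<open>A-linear endomorphisms of A^d are given by d x d matrices over A\<close>
definition mat_vec :: "nat \<Rightarrow> (nat \<Rightarrow> nat \<Rightarrow> ('n, 'k::comm_ring_1) mpoly)
    \<Rightarrow> (nat \<Rightarrow> ('n, 'k) mpoly) \<Rightarrow> (nat \<Rightarrow> ('n, 'k) mpoly)" where
  "mat_vec d A v = (\<lambda>j. if j < d then (\<Sum>l<d. A j l * v l) else 0)"

definition lie_rep :: "nat \<Rightarrow> (('n::finite, 'k::field) vfield \<Rightarrow> (nat \<Rightarrow> nat \<Rightarrow> ('n, 'k) mpoly)) \<Rightarrow> bool" where
  "lie_rep d \<rho> \<longleftrightarrow>
     (\<forall>\<eta>\<in>L_plus. \<forall>\<xi>\<in>L_plus. \<forall>v\<in>free_mod d.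
        mat_vec d (\<rho> (\<lambda>i. \<eta> i + \<xi> i)) v = (\<lambda>j. mat_vec d (\<rho> \<eta>) v j + mat_vec d (\<rho> \<xi>) v j)) \<and>
     (\<forall>c. \<forall>\<eta>\<in>L_plus. \<forall>v\<in>free_mod d.
        mat_vec d (\<rho> (\<lambda>i. cst c * \<eta> i)) v = (\<lambda>j. cst c * mat_vec d (\<rho> \<eta>) v j)) \<and>
     (\<forall>\<eta>\<in>L_plus. \<forall>\<xi>\<in>L_plus. \<forall>v\<in>free_mod d.
        mat_vec d (\<rho> (vf_bracket \<eta> \<xi>)) v =
          (\<lambda>j. mat_vec d (\<rho> \<eta>) (mat_vec d (\<rho> \<xi>) v) j - mat_vec d (\<rho> \<xi>) (mat_vec d (\<rho> \<eta>) v) j))"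

definition Dop :: "nat \<Rightarrow> ('n \<Rightarrow> (nat \<Rightarrow> nat \<Rightarrow> ('n, 'k::comm_ring_1) mpoly)) \<Rightarrow> 'n
    \<Rightarrow> (nat \<Rightarrow> ('n, 'k) mpoly) \<Rightarrow> (nat \<Rightarrow> ('n, 'k) mpoly)" where
  "Dop d B i v = (\<lambda>j. pd i (v j) + mat_vec d (B i) v j)"

definition gauge_fields :: "nat \<Rightarrow> (('n::finite, 'k::field) vfield \<Rightarrow> (nat \<Rightarrow> nat \<Rightarrow> ('n, 'k) mpoly))
    \<Rightarrow> ('n \<Rightarrow> (nat \<Rightarrow> nat \<Rightarrow> ('n, 'k) mpoly)) \<Rightarrow> bool" where
  "gauge_fields d \<rho> B \<longleftrightarrow>
     (\<forall>i j. \<forall>v\<in>free_mod d. Dop d B i (Dop d B j v) = Dop d B j (Dop d B i v)) \<and>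
     (\<forall>i. \<forall>y\<in>L_plus. \<forall>v\<in>free_mod d.
        Dop d B i (mat_vec d (\<rho> y) v) = mat_vec d (\<rho> y) (Dop d B i v))"

end

theory Submission
  imports Defs "HOL-Computational_Algebra.Polynomial" "HOL-Library.Function_Algebras"
begin

text \<open>
  The vector fields \<open>\<partial>\<^sub>i\<close> act on \<open>M\<close> by a flat connection. The polynomials \<open>h\<close> whose multiplication
  on \<open>M\<close> factors through a finite free module include a nonzero one and are stable under \<open>\<partial>\<^sub>i\<close>, so
  \<open>1\<close> is among them and \<open>M\<close> is projective. Some \<open>f \<noteq> 0\<close> maps \<open>M\<close> into a free submodule;
  substituting \<open>x + t v\<close> for \<open>x\<close> makes \<open>f\<close> monic in \<open>t\<close>, the quotient by the free submodule becomes
  projective over the polynomials in \<open>x\<close>, and its characteristic sequence shows that \<open>M\<close> is stably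
  free. Suslin's theorem that unimodular columns are equivalent to unit vectors (proved with the weak
  Nullstellensatz, as \<open>k\<close> is algebraically closed) cancels the free summands, so \<open>M\<close> is free.
  Finally, writing \<open>f(y) = \<Sum>\<^sub>k (\<partial>\<^sup>k f)(x) (y - x)\<^sup>k / k!\<close> and letting \<open>x\<close> act by multiplication and \<open>f(y)\<close>
  by the vector field \<open>f \<partial>\<^sub>i\<close> gives the gauge formula, \<open>\<rho>(x\<^sup>k \<partial>\<^sub>i)\<close> being the operator of \<open>(y - x)\<^sup>k\<close>.
\<close>

text \<open>Stable freeness is obtained without induction on the number of variables:
  \<open>t\<close> is an additional variable, \<open>M\<close> is pulled back along
  \<open>p(x) -> p(x + t v)\<close>, and \<open>t = 0\<close> returns \<open>M\<close>. The quotient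
  \<open>N\<close> is only known to be projective over \<open>k[x]\<close>. But its characteristic
  sequence \<open>N[t] -> N[t] -> N\<close> contains \<open>N[t]\<close> twice, and one complement
  added to both copies makes both free, so \<open>N\<close> itself never has to be identified.
  Cancellation needs two entries of a column that generate an element \<open>c\<close> of the
  coefficient ring. Globally there need not be a useful \<open>c\<close>; near a single point a
  generic combination of entries provides one, and the Nullstellensatz glues these local choices.
  The Nullstellensatz and the gluing share one elimination lemma, a Nakayama argument in place of
  resultants. The Leibniz rule of the connection excludes torsion and gives projectivity; its
  flatness returns at the end as (GF1).\<close>

abbreviation lookup :: "('a \<Rightarrow>\<^sub>0 'b::zero) \<Rightarrow> 'a \<Rightarrow> 'b" where
  "lookup \<equiv> Poly_Mapping.lookup"

abbreviation keys :: "('a \<Rightarrow>\<^sub>0 'b::zero) \<Rightarrow> 'a set" where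
  "keys \<equiv> Poly_Mapping.keys"

abbreviation single :: "'a \<Rightarrow> 'b \<Rightarrow> 'a \<Rightarrow>\<^sub>0 'b::zero" where
  "single \<equiv> Poly_Mapping.single"

section \<open>Ring homomorphisms and the universal property of polynomial rings\<close>

locale rhom =
  fixes h :: "'a::comm_ring_1 \<Rightarrow> 'b::comm_ring_1"
  assumes h_one: "h 1 = 1"
    and h_add: "h (a + b) = h a + h b"
    and h_mult: "h (a * b) = h a * h b"
begin

lemma h_zero: "h 0 = 0"
  using h_add[of 0 0] by simp

lemma h_uminus: "h (- a) = - h a"
  using h_add[of a "- a"] by (simp add: h_zero eq_neg_iff_add_eq_0 add.commute)

lemma h_diff: "h (a - b) = h a - h b"
  using h_add[of a "- b"] by (simp add: h_uminus)

lemma h_sum: "h (sum f S) = (\<Sum>x\<in>S. h (f x))"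
  by (induction S rule: infinite_finite_induct) (auto simp: h_zero h_add)

lemma h_prod: "h (prod f S) = (\<Prod>x\<in>S. h (f x))"
  by (induction S rule: infinite_finite_induct) (auto simp: h_one h_mult)

lemma h_power: "h (a ^ n) = h a ^ n"
  by (induction n) (auto simp: h_one h_mult)

lemma h_of_nat: "h (of_nat n) = of_nat n"
  by (induction n) (auto simp: h_zero h_one h_add)

lemmas hs = h_zero h_one h_add h_mult h_uminus h_diff h_sum h_prod h_power h_of_nat

end

lemma rhom_comp: "rhom g \<Longrightarrow> rhom h \<Longrightarrow> rhom (\<lambda>x. g (h x))"
  by (simp add: rhom_def)

lemma rhom_id: "rhom (\<lambda>x. x)"
  by (simp add: rhom_def)

lemma rhom_cst: "rhom cst"
  by (simp add: rhom_def cst_def single_add mult_single)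

lemma rhom_pCons: "rhom (\<lambda>c. [:c:])"
  by (simp add: rhom_def)

lemma rhom_poly: "rhom (\<lambda>p. poly p x)"
  by (simp add: rhom_def)

lemma cst_0 [simp]: "cst 0 = 0" and cst_1 [simp]: "cst 1 = 1"
  by (auto simp: cst_def)

lemma cst_mult: "cst (a * b :: 'k::comm_ring_1) = cst a * cst b"
  by (auto intro!: rhom.hs rhom_cst)

lemma cst_uminus: "cst (- a :: 'k::comm_ring_1) = - cst a"
  by (auto intro!: rhom.hs rhom_cst)

lemma cst_eq_0_iff [simp]: "cst c = 0 \<longleftrightarrow> c = 0"
  unfolding cst_def by (metis lookup_single_eq lookup_zero single_zero)

definition var :: "'n \<Rightarrow> ('n, 'k::comm_ring_1) mpoly" where
  "var i = xmon (single i 1)"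

lemma mpoly_single_induct [case_names single add]:
  assumes "\<And>a c. P (single a c)" and "\<And>p q. P p \<Longrightarrow> P q \<Longrightarrow> P (p + q)"
  shows "P (p :: ('n, 'k::comm_monoid_add) mpoly)"
proof (induction p rule: Poly_Mapping.update_induct)
  case const
  then show ?case using assms(1)[of 0 0] by simp
next
  case (update f a b)
  have "Poly_Mapping.update a b f = single a b + f"
    using update(1) by (intro poly_mapping_eqI)
      (auto simp: lookup_update lookup_add lookup_single when_def in_keys_iff)
  then show ?case using assms update by auto
qed

lemma xmon_add: "xmon (a + b) = (xmon a * xmon b :: ('n, 'k::comm_ring_1) mpoly)"
  for a b :: "'n \<Rightarrow>\<^sub>0 nat"
  by (simp add: xmon_def mult_single)

lemma xmon_0 [simp]: "xmon 0 = 1"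
  by (simp add: xmon_def)

lemma single_eq_cst_xmon: "single a c = cst c * xmon a"
  for c :: "'k::comm_ring_1"
  by (simp add: xmon_def cst_def mult_single)

lemma exponent_induct [case_names zero step]:
  assumes "P 0" and "\<And>a i. P a \<Longrightarrow> P (a + single i (1::nat))"
  shows "P (a :: 'n::finite \<Rightarrow>\<^sub>0 nat)"
proof (induction "\<Sum>i\<in>UNIV. lookup a i" arbitrary: a)
  case 0
  then have "a = 0" by (intro poly_mapping_eqI) auto
  then show ?case using assms by simp
next
  case (Suc N)
  then obtain i where i: "lookup a i > 0"
    by (metis Suc_neq_Zero neq0_conv sum.neutral)
  define b where "b = a - single i 1"
  have ab: "a = b + single i 1"
    using i by (intro poly_mapping_eqI)
      (auto simp: b_def lookup_add lookup_minus lookup_single when_def)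
  have "(\<Sum>i\<in>UNIV. lookup a i) = (\<Sum>i\<in>UNIV. lookup b i) + 1"
    unfolding ab by (simp add: lookup_add sum.distrib lookup_single when_def)
  then have "P b" using Suc by auto
  then show ?case using ab assms by metis
qed

lemma mpoly_induct [case_names cst var add mult]:
  assumes "\<And>c. P (cst c)" "\<And>i. P (var i)" "\<And>p q. P p \<Longrightarrow> P q \<Longrightarrow> P (p + q)"
    "\<And>p q. P p \<Longrightarrow> P q \<Longrightarrow> P (p * q)"
  shows "P (p :: ('n::finite, 'k::comm_ring_1) mpoly)"
proof (induction p rule: mpoly_single_induct)
  case (single a c)
  have "P (xmon a)"
  proof (induction a rule: exponent_induct)
    case zero
    then show ?case using assms(1)[of 1] by simp
  next
    case (step a i)
    then show ?case by (auto simp: xmon_add var_def[symmetric] simp del: One_nat_def intro: assms)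
  qed
  then show ?case by (auto simp: single_eq_cst_xmon intro: assms)
next
  case (add p q)
  then show ?case by (rule assms(3))
qed

text \<open>The universal property of the polynomial ring. Points, substitutions, the Kronecker map,
  the shift along a line, the Taylor maps and the diagonal are all instances, so identities between
  their composites are checked on constants and variables by \<open>rhom_eqI\<close>.\<close>

definition evh :: "('k \<Rightarrow> 'b::comm_ring_1) \<Rightarrow> ('n \<Rightarrow> 'b) \<Rightarrow> ('n::finite, 'k::comm_ring_1) mpoly \<Rightarrow> 'b" where
  "evh \<kappa> \<sigma> p = (\<Sum>a\<in>keys p. \<kappa> (lookup p a) * (\<Prod>i\<in>UNIV. \<sigma> i ^ lookup a i))"

context
  fixes \<kappa> :: "'k::comm_ring_1 \<Rightarrow> 'b::comm_ring_1" and \<sigma> :: "'n::finite \<Rightarrow> 'b"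
  assumes \<kappa>: "rhom \<kappa>"
begin

interpretation rhom \<kappa> by (rule \<kappa>)

lemma evh_add: "evh \<kappa> \<sigma> (p + q) = evh \<kappa> \<sigma> p + evh \<kappa> \<sigma> q"
  unfolding evh_def by (rule setsum_keys_plus_distrib) (simp_all add: hs algebra_simps)

lemma evh_single: "evh \<kappa> \<sigma> (single a c) = \<kappa> c * (\<Prod>i\<in>UNIV. \<sigma> i ^ lookup a i)"
  by (simp add: evh_def hs)

lemma evh_cst: "evh \<kappa> \<sigma> (cst c) = \<kappa> c"
  by (simp add: cst_def evh_single)

lemma evh_xmon: "evh \<kappa> \<sigma> (xmon a) = (\<Prod>i\<in>UNIV. \<sigma> i ^ lookup a i)"
  by (simp add: xmon_def evh_single hs)

lemma evh_var: "evh \<kappa> \<sigma> (var j) = \<sigma> j"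
proof -
  have "(\<Prod>i\<in>UNIV. \<sigma> i ^ lookup (single j (1::nat)) i) = (\<Prod>i\<in>UNIV. if i = j then \<sigma> i else 1)"
    by (rule prod.cong) (auto simp: lookup_single when_def)
  then show ?thesis by (simp add: evh_xmon var_def)
qed

lemma rhom_evh: "rhom (evh \<kappa> \<sigma>)"
proof
  show "evh \<kappa> \<sigma> 1 = 1"
    by (metis evh_cst cst_1 h_one)
  show "evh \<kappa> \<sigma> (p * q) = evh \<kappa> \<sigma> p * evh \<kappa> \<sigma> q" for p q
  proof (induction p rule: mpoly_single_induct)
    case (single a c)
    show ?case
    proof (induction q rule: mpoly_single_induct)
      case (single b d)
      then show ?case
        by (simp add: mult_single evh_single h_mult lookup_add power_add prod.distrib algebra_simps)
    qed (simp add: evh_add algebra_simps)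
  qed (simp add: evh_add algebra_simps)
qed (rule evh_add)

end

lemma rhom_eqI:
  fixes h h' :: "('n::finite, 'k::comm_ring_1) mpoly \<Rightarrow> 'b::comm_ring_1"
  assumes h: "rhom h" and h': "rhom h'" and "\<And>c. h (cst c) = h' (cst c)" and "\<And>i. h (var i) = h' (var i)"
  shows "h p = h' p"
  by (induction p rule: mpoly_induct) (simp_all add: assms rhom.h_add[OF h] rhom.h_add[OF h'] rhom.h_mult[OF h] rhom.h_mult[OF h'])

subsection \<open>Derivations\<close>

lemma pd_add: "pd i (p + q) = pd i p + pd i q"
  unfolding pd_def by (rule setsum_keys_plus_distrib) (simp_all add: algebra_simps single_add)

lemma pd_single: "pd i (single a c)
    = single (a - single i 1) (of_nat (lookup a i) * c)"
  by (simp add: pd_def)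

lemma pd_cst [simp]: "pd i (cst c) = 0"
  by (simp add: cst_def pd_single)

lemma pd_0 [simp]: "pd i 0 = 0"
  by (simp add: pd_def)

lemma pd_1 [simp]: "pd i 1 = 0"
  using pd_cst[of i 1] by simp

lemma pd_uminus: "pd i (- p) = - pd i p"
  using pd_add[of i p "- p"] by (simp add: eq_neg_iff_add_eq_0 add.commute)

lemma pd_diff: "pd i (p - q) = pd i p - pd i q"
  using pd_add[of i p "- q"] by (simp add: pd_uminus)

lemma pd_var: "pd i (var j) = (if i = j then 1 else 0)"
  by (auto simp: var_def xmon_def pd_single lookup_single when_def)

text \<open>Subtraction of exponents is truncated. A nonzero coefficient forces the exponent of
  \<open>i\<close> in \<open>a\<close> to be positive, and then the truncation does no harm; in the
  remaining case the monomial has coefficient zero.\<close>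

lemma single_diff_add:
  fixes a b :: "'n \<Rightarrow>\<^sub>0 nat"
  assumes "of_nat (lookup a i) * c \<noteq> (0::'k::comm_ring_1)"
  shows "a - single i 1 + b = a + b - single i 1"
proof -
  have "lookup a i \<noteq> 0" using assms by (intro notI) simp
  then show ?thesis
    by (intro poly_mapping_eqI) (auto simp: lookup_add lookup_minus lookup_single when_def)
qed

lemma pd_mult: "pd i (p * q) = pd i p * q + p * pd i q"
  for p :: "('n, 'k::comm_ring_1) mpoly"
proof (induction p rule: mpoly_single_induct)
  case (single a c)
  show ?case
  proof (induction q rule: mpoly_single_induct)
    case (single b d)
    have 1: "single (a - single i 1) (of_nat (lookup a i) * c) * single b d
       = single (a + b - single i 1) (of_nat (lookup a i) * c * d)"
      by (cases "of_nat (lookup a i) * c = 0") (auto simp: mult_single single_diff_add simp del: One_nat_def)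
    have 2: "single a c * single (b - single i 1) (of_nat (lookup b i) * d)
       = single (a + b - single i 1) (of_nat (lookup b i) * c * d)"
      using single_diff_add[of b i d a]
      by (cases "of_nat (lookup b i) * d = 0") (auto simp: mult_single algebra_simps)
    have "pd i (single a c * single b d)
        = single (a + b - single i 1) (of_nat (lookup a i) * c * d)
        + single (a + b - single i 1) (of_nat (lookup b i) * c * d)"
      by (simp only: mult_single pd_single single_add[symmetric]) (simp add: lookup_add algebra_simps)
    then show ?case by (simp only: pd_single 1 2)
  qed (simp add: pd_add algebra_simps)
qed (simp add: pd_add algebra_simps)

text \<open>Both sides are derivations along \<open>h\<close> that kill constants, hence they agree
  once they agree on variables.\<close>

lemma derivation_chain:
  fixes h D :: "('n::finite, 'k::comm_ring_1) mpoly \<Rightarrow> 'b::comm_ring_1"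
  assumes h: "rhom h" and add: "\<And>p q. D (p + q) = D p + D q"
    and leib: "\<And>p q. D (p * q) = h p * D q + h q * D p" and "\<And>c. D (cst c) = 0"
  shows "D p = (\<Sum>i\<in>UNIV. h (pd i p) * D (var i))"
proof (induction p rule: mpoly_induct)
  case (cst c)
  then show ?case by (simp add: assms rhom.h_zero[OF h])
next
  case (var j)
  have "(\<Sum>i\<in>UNIV. h (pd i (var j)) * D (var i)) = (\<Sum>i\<in>UNIV. if i = j then D (var i) else 0)"
    by (rule sum.cong) (auto simp: pd_var rhom.hs[OF h])
  then show ?case by simp
next
  case (add p q)
  then show ?case by (simp add: assms(2) pd_add rhom.hs[OF h] algebra_simps sum.distrib)
next
  case (mult p q)
  then show ?case
    by (simp add: leib pd_mult rhom.hs[OF h] algebra_simps sum.distrib sum_distrib_left)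
qed

subsection \<open>Supports, evaluation points and lines\<close>

abbreviation ev :: "('n \<Rightarrow> 'k) \<Rightarrow> ('n::finite, 'k::comm_ring_1) mpoly \<Rightarrow> 'k" where
  "ev \<equiv> evh (\<lambda>c. c)"

abbreviation subst :: "('n \<Rightarrow> ('n, 'k) mpoly) \<Rightarrow> ('n::finite, 'k::comm_ring_1) mpoly \<Rightarrow> ('n, 'k) mpoly" where
  "subst \<equiv> evh cst"

lemma rhom_ev: "rhom (ev x)"
  by (intro rhom_evh rhom_id)

lemma rhom_subst: "rhom (subst \<sigma>)"
  by (intro rhom_evh rhom_cst)

lemma ev_cst [simp]: "ev x (cst c) = c" and ev_var [simp]: "ev x (var i) = x i"
  by (simp_all add: evh_cst evh_var rhom_id)

lemma subst_cst [simp]: "subst \<sigma> (cst c) = cst c" and subst_var [simp]: "subst \<sigma> (var i) = \<sigma> i"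
  by (simp_all add: evh_cst evh_var rhom_cst)

lemma subst_var_id: "subst var p = p"
  by (rule rhom_eqI[OF rhom_subst rhom_id]) auto

lemma mpoly_eq_sum: "p = (\<Sum>a\<in>keys p. single a (lookup p a))"
proof (rule poly_mapping_eqI)
  fix k
  have "(\<Sum>a\<in>keys p. lookup (single a (lookup p a)) k) = (\<Sum>a\<in>keys p. if a = k then lookup p a else 0)"
    by (rule sum.cong) (auto simp: lookup_single when_def)
  then show "lookup p k = lookup (\<Sum>a\<in>keys p. single a (lookup p a)) k"
    by (simp add: lookup_sum in_keys_iff)
qed

text \<open>The type of variables is fixed, so an induction on the number of variables has to run
  over the set of variables that actually occur.\<close>

definition vars_in :: "'n set \<Rightarrow> ('n, 'k::zero) mpoly \<Rightarrow> bool" where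
  "vars_in V p \<longleftrightarrow> (\<forall>a\<in>keys p. \<forall>j. j \<notin> V \<longrightarrow> lookup a j = 0)"

lemma vars_in_cst [simp]: "vars_in V (cst c)"
  by (simp add: vars_in_def cst_def)

lemma vars_in_0 [simp]: "vars_in V 0"
  by (simp add: vars_in_def)

lemma vars_in_var: "i \<in> V \<Longrightarrow> vars_in V (var i)"
  by (auto simp: vars_in_def var_def xmon_def lookup_single when_def)

lemma vars_in_add: "vars_in V p \<Longrightarrow> vars_in V q \<Longrightarrow> vars_in V (p + q)"
  using keys_add[of p q] by (auto simp: vars_in_def)

lemma vars_in_mult: "vars_in V p \<Longrightarrow> vars_in V q \<Longrightarrow> vars_in V (p * q)"
  using keys_mult[of p q] by (force simp: vars_in_def lookup_add)

lemma vars_in_subst: "(\<And>i. vars_in V (\<sigma> i)) \<Longrightarrow> vars_in V (subst \<sigma> p)"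
  by (induction p rule: mpoly_induct)
    (auto intro: vars_in_add vars_in_mult simp: rhom.hs[OF rhom_subst])

lemma vars_in_UNIV [simp]: "vars_in UNIV p"
  by (simp add: vars_in_def)

lemma evh_cong_vars:
  assumes "vars_in V p" and "\<And>i. i \<in> V \<Longrightarrow> \<sigma> i = \<sigma>' i"
  shows "evh \<kappa> \<sigma> p = evh \<kappa> \<sigma>' p"
  unfolding evh_def
proof (rule sum.cong[OF refl], rule arg_cong2[of _ _ _ _ "(*)"], simp, rule prod.cong[OF refl])
  fix a i assume "a \<in> keys p"
  then show "\<sigma> i ^ lookup a i = \<sigma>' i ^ lookup a i"
    using assms by (cases "i \<in> V") (auto simp: vars_in_def)
qed

lemma vars_in_empty: "vars_in {} p \<Longrightarrow> \<exists>c. p = cst c"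
proof -
  assume p: "vars_in {} p"
  have "a = 0" if "a \<in> keys p" for a
    using p that by (intro poly_mapping_eqI) (auto simp: vars_in_def)
  then have "p = cst (lookup p 0)"
    by (intro poly_mapping_eqI) (auto simp: cst_def lookup_single when_def in_keys_iff)
  then show ?thesis by blast
qed

section \<open>Kronecker substitution, zero divisors and points where a polynomial does not
  vanish\<close>

lemma digits_unique:
  fixes a b :: "nat \<Rightarrow> nat"
  assumes "\<And>j. j < m \<Longrightarrow> a j < N" "\<And>j. j < m \<Longrightarrow> b j < N"
    and "(\<Sum>j<m. a j * N ^ j) = (\<Sum>j<m. b j * N ^ j)" and "j < m"
  shows "a j = b j"
  using assms
proof (induction m arbitrary: a b j)
  case 0
  then show ?case by simp
next
  case (Suc m)
  have N: "N > 0" using Suc.prems(1)[of 0] by simp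
  have eq: "a 0 + N * (\<Sum>j<m. a (Suc j) * N ^ j) = b 0 + N * (\<Sum>j<m. b (Suc j) * N ^ j)"
    using Suc.prems(3) by (simp add: sum.lessThan_Suc_shift sum_distrib_left mult.left_commute del: sum.lessThan_Suc)
  then have "(a 0 + N * (\<Sum>j<m. a (Suc j) * N ^ j)) mod N = (b 0 + N * (\<Sum>j<m. b (Suc j) * N ^ j)) mod N"
    by simp
  then have 0: "a 0 = b 0" using Suc.prems(1)[of 0] Suc.prems(2)[of 0] by simp
  then have "(\<Sum>j<m. a (Suc j) * N ^ j) = (\<Sum>j<m. b (Suc j) * N ^ j)"
    using eq N by simp
  then show ?case
    using Suc.IH[of "\<lambda>j. a (Suc j)" "\<lambda>j. b (Suc j)" "j - 1"] Suc.prems 0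
    by (cases j) auto
qed

text \<open>Sending variable number \<open>j\<close> to \<open>x^(N^j)\<close> reads an exponent
  vector as digits in base \<open>N\<close>, so distinct monomials stay distinct and nothing
  cancels. Two polynomials are treated at once because a product argument needs one homomorphism for
  both factors.\<close>

lemma kronecker_substitution:
  fixes p q :: "('n::finite, 'k::idom) mpoly"
  assumes "p \<noteq> 0" "q \<noteq> 0"
  obtains h :: "('n, 'k) mpoly \<Rightarrow> 'k poly" where "rhom h" "h p \<noteq> 0" "h q \<noteq> 0" "\<And>c. h (cst c) = [:c:]"
proof -
  obtain e :: "'n \<Rightarrow> nat" where e: "bij_betw e UNIV {..<card (UNIV :: 'n set)}"
    using ex_bij_betw_finite_nat[of "UNIV :: 'n set"] by (auto simp: atLeast0LessThan)
  \<comment> \<open>\<open>N\<close> exceeds every exponent in \<open>p\<close> and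
    \<open>q\<close>; the inserted \<open>0\<close> keeps \<open>Max\<close> away from the empty
    set.\<close>
  define N where "N = Suc (Max (insert 0 ((\<lambda>(a, i). lookup a i) ` ((keys p \<union> keys q) \<times> UNIV))))"
  have N: "lookup a i < N" if "a \<in> keys p \<union> keys q" for a i
    unfolding N_def less_Suc_eq_le using that by (intro Max_ge) auto
  define wt where "wt a = (\<Sum>i\<in>UNIV. lookup a i * N ^ e i)" for a :: "'n \<Rightarrow>\<^sub>0 nat"
  have wt: "wt a = (\<Sum>j<card (UNIV :: 'n set). lookup a (inv_into UNIV e j) * N ^ j)" for a
    using sum.reindex_bij_betw[OF e, of "\<lambda>j. lookup a (inv_into UNIV e j) * N ^ j"] e
    by (simp add: wt_def bij_betw_def)
  have inj: "a = b" if "a \<in> keys p \<union> keys q" "b \<in> keys p \<union> keys q" "wt a = wt b" for a b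
  proof (rule poly_mapping_eqI)
    fix i
    have "lookup a (inv_into UNIV e (e i)) = lookup b (inv_into UNIV e (e i))"
      by (rule digits_unique[where m = "card (UNIV :: 'n set)" and N = N]) (use that N e in \<open>auto simp: wt bij_betw_def\<close>)
    then show "lookup a i = lookup b i" using e by (simp add: bij_betw_def)
  qed
  define h where "h = (evh (\<lambda>c. [:c:]) (\<lambda>i. monom 1 (N ^ e i)) :: ('n, 'k) mpoly \<Rightarrow> 'k poly)"
  have mm: "(\<Prod>i\<in>S. monom (1::'k) (N ^ e i) ^ lookup a i) = monom 1 (\<Sum>i\<in>S. lookup a i * N ^ e i)" for a S
    by (induction S rule: infinite_finite_induct) (auto simp: monom_power mult_monom algebra_simps)
  have h: "h r = (\<Sum>a\<in>keys r. monom (lookup r a) (wt a))" for r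
    unfolding h_def evh_def wt_def by (simp add: mm smult_monom)
  have nz: "h r \<noteq> 0" if r: "r \<noteq> 0" "r \<in> {p, q}" for r
  proof -
    obtain a where a: "a \<in> keys r" using r by (metis keys_eq_empty ex_in_conv)
    have "coeff (h r) (wt a) = (\<Sum>b\<in>keys r. if b = a then lookup r b else 0)"
      unfolding h coeff_sum
    proof (rule sum.cong[OF refl])
      fix b assume "b \<in> keys r"
      then have "wt b = wt a \<longleftrightarrow> b = a" using inj[of b a] a r(2) by auto
      then show "coeff (monom (lookup r b) (wt b)) (wt a) = (if b = a then lookup r b else 0)" by simp
    qed
    also have "\<dots> = lookup r a" using a by simp
    finally show ?thesis using a by (auto simp: in_keys_iff)
  qed
  show ?thesis
  proof (rule that)
    show "rhom h" unfolding h_def by (intro rhom_evh rhom_pCons)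
    show "h (cst c) = [:c:]" for c unfolding h_def by (simp add: evh_cst rhom_pCons)
  qed (use nz assms in auto)
qed

lemma mpoly_no_zero_divisors:
  fixes p q :: "('n::finite, 'k::idom) mpoly"
  shows "p * q = 0 \<longleftrightarrow> p = 0 \<or> q = 0"
proof -
  have "p * q \<noteq> 0" if "p \<noteq> 0" "q \<noteq> 0"
  proof -
    obtain h :: "('n, 'k) mpoly \<Rightarrow> 'k poly" where "rhom h" "h p \<noteq> 0" "h q \<noteq> 0"
      using kronecker_substitution \<open>p \<noteq> 0\<close> \<open>q \<noteq> 0\<close> by metis
    then have "h (p * q) \<noteq> 0" by (simp add: rhom.hs)
    then show ?thesis using rhom.h_zero[OF \<open>rhom h\<close>] by metis
  qed
  then show ?thesis by auto
qed

text \<open>The Kronecker image has finitely many roots and the field is infinite. Kronecker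
  substitution followed by evaluation at \<open>t\<close> is evaluation at a point.\<close>

lemma mpoly_nonroot:
  fixes p :: "('n::finite, 'k::field_char_0) mpoly"
  assumes "p \<noteq> 0"
  obtains x where "ev x p \<noteq> 0"
proof -
  obtain h :: "('n, 'k) mpoly \<Rightarrow> 'k poly" where h: "rhom h" "h p \<noteq> 0" "\<And>c. h (cst c) = [:c:]"
    using kronecker_substitution[OF assms assms] by metis
  have "finite {t. poly (h p) t = 0}" using h by (simp add: poly_roots_finite)
  then obtain t where t: "poly (h p) t \<noteq> 0"
    using ex_new_if_finite[OF infinite_UNIV_char_0] by blast
  have "poly (h p) t = ev (\<lambda>i. poly (h (var i)) t) p"
    by (rule rhom_eqI[OF rhom_comp[OF rhom_poly h(1)] rhom_ev]) (auto simp: h)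
  then show ?thesis using that t by metis
qed

section \<open>Substitution of \<open>x + t v\<close>, as a polynomial in \<open>t\<close> over the
  polynomials in \<open>x\<close>\<close>

definition lshift :: "('n \<Rightarrow> 'k) \<Rightarrow> ('n::finite, 'k::comm_ring_1) mpoly \<Rightarrow> ('n, 'k) mpoly poly" where
  "lshift v = evh (\<lambda>c. [:cst c:]) (\<lambda>i. [:var i, cst (v i):])"

lemma rhom_cst_pCons: "rhom (\<lambda>c. [:cst c:])"
  by (intro rhom_comp[OF rhom_pCons rhom_cst])

lemma rhom_lshift: "rhom (lshift v)"
  unfolding lshift_def by (intro rhom_evh rhom_cst_pCons)

lemma lshift_cst: "lshift v (cst c) = [:cst c:]" and lshift_var: "lshift v (var i) = [:var i, cst (v i):]"
  unfolding lshift_def by (simp_all add: evh_cst evh_var rhom_cst_pCons)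

lemma coeff_mult_linear:
  assumes "degree p \<le> m"
  shows "coeff (p * [:u, v:]) (Suc m) = coeff p m * v" and "degree (p * [:u, v:]) \<le> Suc m"
proof -
  have eq: "p * [:u, v:] = smult u p + pCons 0 (smult v p)"
    by (simp add: mult.commute[of p])
  show "coeff (p * [:u, v:]) (Suc m) = coeff p m * v"
    using assms by (simp add: eq coeff_eq_0 mult.commute del: mult_pCons_right)
  have "degree (p * [:u, v:]) \<le> degree p + degree [:u, v:]"
    by (rule degree_mult_le)
  also have "\<dots> \<le> Suc m" using assms by (auto intro: order.trans add_mono)
  finally show "degree (p * [:u, v:]) \<le> Suc m" .
qed

text \<open>Each factor \<open>x_i\<close> becomes \<open>x_i + t v_i\<close> and raises the degree
  in \<open>t\<close> by at most one. The degree is only bounded, since the top coefficient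
  \<open>v^a\<close> may vanish.\<close>

lemma lshift_xmon_top:
  fixes a :: "'n::finite \<Rightarrow>\<^sub>0 nat"
  defines "td \<equiv> \<lambda>a :: 'n \<Rightarrow>\<^sub>0 nat. \<Sum>i\<in>UNIV. lookup a i"
  shows "degree (lshift v (xmon a)) \<le> td a \<and> coeff (lshift v (xmon a)) (td a) = cst (ev v (xmon a))"
proof (induction a rule: exponent_induct)
  case zero
  then show ?case by (simp add: td_def rhom.hs[OF rhom_lshift] rhom.hs[OF rhom_ev])
next
  case (step a i)
  have td: "td (a + single i 1) = Suc (td a)"
    by (simp add: td_def lookup_add sum.distrib lookup_single when_def)
  have "lshift v (xmon (a + single i 1)) = lshift v (xmon a) * [:var i, cst (v i):]"
    "ev v (xmon (a + single i 1)) = ev v (xmon a) * v i"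
    by (simp_all only: xmon_add var_def[symmetric] rhom.hs[OF rhom_lshift] rhom.hs[OF rhom_ev] lshift_var ev_var)
  then show ?case using step coeff_mult_linear[of "lshift v (xmon a)" "td a" "var i" "cst (v i)"]
    by (simp only: td cst_mult)
qed

text \<open>Noether normalization: for \<open>p\<close> of total degree \<open>d\<close>, the
  coefficient of \<open>t^d\<close> in \<open>p(x + t v)\<close> is the constant obtained by
  evaluating the top homogeneous part of \<open>p\<close> at \<open>v\<close>. It suffices that this
  part does not vanish at \<open>v\<close>.\<close>

lemma lshift_unit_leading:
  fixes p :: "('n::finite, 'k::field_char_0) mpoly"
  assumes "p \<noteq> 0" and "vars_in V p" and "i \<in> V"
  obtains v c where "v i \<noteq> 0" "\<And>j. j \<notin> V \<Longrightarrow> v j = 0" "c \<noteq> 0" "lead_coeff (lshift v p) = cst c"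
proof -
  define td where "td a = (\<Sum>i\<in>UNIV. lookup a i)" for a :: "'n \<Rightarrow>\<^sub>0 nat"
  define d where "d = Max (td ` keys p)"
  have kp: "keys p \<noteq> {}" using assms by simp
  define top where "top = (\<Sum>a\<in>{a\<in>keys p. td a = d}. single a (lookup p a))"
  have lt: "lookup top b = (if b \<in> keys p \<and> td b = d then lookup p b else 0)" for b
  proof -
    have "lookup top b = (\<Sum>a\<in>{a\<in>keys p. td a = d}. if a = b then lookup p a else 0)"
      unfolding top_def lookup_sum by (rule sum.cong) (auto simp: lookup_single when_def)
    then show ?thesis by simp
  qed
  obtain a where a: "a \<in> keys p" "td a = d"
    using Max_in[of "td ` keys p"] kp unfolding d_def by fastforce
  then have "lookup top a \<noteq> 0" by (simp add: lt in_keys_iff)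
  then have "top \<noteq> 0" by auto
  \<comment> \<open>One point outside the zeros of the product serves both demands: the top part and
    the coordinate \<open>i\<close> are nonzero there.\<close>
  moreover have "var i \<noteq> (0 :: ('n, 'k) mpoly)"
    unfolding var_def xmon_def by (metis lookup_single_eq lookup_zero zero_neq_one)
  ultimately have "top * var i \<noteq> 0" by (simp add: mpoly_no_zero_divisors)
  then obtain x where "ev x (top * var i) \<noteq> 0" using mpoly_nonroot by blast
  then have x: "ev x top \<noteq> 0" "x i \<noteq> 0" by (auto simp: rhom.hs[OF rhom_ev])
  \<comment> \<open>Clearing the coordinates outside \<open>V\<close> leaves the value of
    \<open>top\<close> unchanged, because \<open>top\<close> involves only variables in
    \<open>V\<close>.\<close>
  define v where "v j = (if j \<in> V then x j else 0)" for j
  have "keys top \<subseteq> keys p"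
  proof
    fix b assume "b \<in> keys top"
    then show "b \<in> keys p" using lt[of b] by (metis in_keys_iff)
  qed
  then have "vars_in V top" using assms(2) unfolding vars_in_def by blast
  then have "ev v top = ev x top" by (rule evh_cong_vars) (simp add: v_def)
  then have vt: "ev v top \<noteq> 0" using x by simp
  have pe: "lshift v p = (\<Sum>a\<in>keys p. smult (cst (lookup p a)) (lshift v (xmon a)))"
    by (rule trans[OF arg_cong[OF mpoly_eq_sum]])
      (simp add: rhom.hs[OF rhom_lshift] single_eq_cst_xmon lshift_cst)
  have le: "td a \<le> d" if "a \<in> keys p" for a unfolding d_def using that by simp
  have top': "degree (lshift v (xmon a)) \<le> td a \<and> coeff (lshift v (xmon a)) (td a) = cst (ev v (xmon a))"
    for v :: "'n \<Rightarrow> 'k" and a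
    unfolding td_def by (rule lshift_xmon_top)
  have "coeff (lshift v p) n = 0" if "n > d" for n
    unfolding pe coeff_sum
  proof (intro sum.neutral ballI)
    fix a assume "a \<in> keys p"
    then have "degree (lshift v (xmon a)) < n" using le[of a] top'[of v a] that by simp
    then show "coeff (smult (cst (lookup p a)) (lshift v (xmon a))) n = 0" by (simp add: coeff_eq_0)
  qed
  then have dle: "degree (lshift v p) \<le> d" by (meson degree_le)
  have "coeff (lshift v p) d = (\<Sum>a\<in>keys p. if td a = d then cst (lookup p a * ev v (xmon a)) else 0)"
    unfolding pe coeff_sum
  proof (rule sum.cong[OF refl])
    fix a assume a: "a \<in> keys p"
    have "coeff (lshift v (xmon a)) d = 0" if "td a \<noteq> d"
      using le[OF a] that top'[of v a] by (intro coeff_eq_0) auto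
    then show "coeff (smult (cst (lookup p a)) (lshift v (xmon a))) d
      = (if td a = d then cst (lookup p a * ev v (xmon a)) else 0)"
      using top'[of v a] by (auto simp: cst_mult)
  qed
  also have "\<dots> = (\<Sum>a\<in>{a\<in>keys p. td a = d}. cst (lookup p a * ev v (xmon a)))"
    by (simp add: sum.If_cases Int_def conj_commute)
  also have "\<dots> = cst (ev v top)"
    by (simp add: top_def rhom.hs[OF rhom_ev] rhom.hs[OF rhom_cst] single_eq_cst_xmon)
  finally have "coeff (lshift v p) d = cst (ev v top)" .
  moreover from this have "degree (lshift v p) = d"
    using vt dle by (intro antisym le_degree) auto
  ultimately show ?thesis using that[of v "ev v top"] x vt by (auto simp: v_def assms)
qed

lemma lshift_normalized_monic:
  fixes p :: "('n::finite, 'k::field) mpoly"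
  assumes c: "c \<noteq> 0" "lead_coeff (lshift v p) = cst c"
  shows "lead_coeff (lshift v (cst (inverse c) * p)) = 1"
proof -
  have cc: "cst (inverse c) * cst c = (1 :: ('n, 'k) mpoly)" using c by (simp add: cst_mult[symmetric])
  have eq: "lshift v (cst (inverse c) * p) = smult (cst (inverse c)) (lshift v p)"
    by (simp add: rhom.hs[OF rhom_lshift] lshift_cst)
  have "degree (lshift v (cst (inverse c) * p)) = degree (lshift v p)"
    unfolding eq by (intro antisym degree_smult_le le_degree) (simp add: c(2) cc)
  then show ?thesis by (simp add: eq c(2) cc)
qed

subsection \<open>Division by monic polynomials\<close>

lemma rhom_map_poly:
  assumes "rhom h"
  shows "rhom (map_poly h)"
proof -
  interpret rhom h by fact
  show ?thesis
    by unfold_locales (auto intro!: poly_eqI simp: coeff_map_poly hs coeff_mult)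
qed

text \<open>The coefficients form only a ring, hence pseudo-division. Its multiplier is a power of
  the leading coefficient, so for monic \<open>f\<close> it is genuine division with
  remainder.\<close>

definition mdiv :: "'a::comm_ring_1 poly \<Rightarrow> 'a poly \<Rightarrow> 'a poly" where
  "mdiv f p = fst (pseudo_divmod p f)"

definition mmod :: "'a::comm_ring_1 poly \<Rightarrow> 'a poly \<Rightarrow> 'a poly" where
  "mmod f p = snd (pseudo_divmod p f)"

context
  fixes f :: "'a::comm_ring_1 poly"
  assumes monic: "lead_coeff f = 1"
begin

lemma mdivmod: "p = f * mdiv f p + mmod f p"
  using pseudo_divmod(1)[of f p "mdiv f p" "mmod f p"] monic
  by (force simp: mdiv_def mmod_def)

lemma coeff_mmod: "n \<ge> degree f \<Longrightarrow> coeff (mmod f p) n = 0"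
  using pseudo_divmod(2)[of f p "mdiv f p" "mmod f p"] monic
  by (cases "f = 0") (auto simp: mdiv_def mmod_def intro: coeff_eq_0)

lemma mdivmod_zero:
  assumes "f * q + r = 0" and "\<And>n. n \<ge> degree f \<Longrightarrow> coeff r n = 0"
  shows "q = 0" and "r = 0"
proof -
  show "q = 0"
  proof (rule ccontr)
    assume "q \<noteq> 0"
    have "coeff (f * q + r) (degree f + degree q) = lead_coeff q"
      using assms(2) monic by (simp add: coeff_mult_degree_sum)
    then show False using assms(1) \<open>q \<noteq> 0\<close> by (simp add: leading_coeff_0_iff)
  qed
  then show "r = 0" using assms by simp
qed

lemma mdivmod_unique:
  assumes "p = f * q + r" and "\<And>n. n \<ge> degree f \<Longrightarrow> coeff r n = 0"
  shows "mdiv f p = q" and "mmod f p = r"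
proof -
  have "f * (mdiv f p - q) + (mmod f p - r) = 0"
    using mdivmod[of p] assms(1) by (simp add: algebra_simps)
  from mdivmod_zero[OF this] show "mdiv f p = q" "mmod f p = r"
    using assms(2) coeff_mmod by auto
qed

lemma mdiv_add: "mdiv f (p + q) = mdiv f p + mdiv f q"
  and mmod_add: "mmod f (p + q) = mmod f p + mmod f q"
proof -
  have *: "p + q = f * (mdiv f p + mdiv f q) + (mmod f p + mmod f q)"
    using mdivmod[of p] mdivmod[of q] by (simp add: algebra_simps)
  show "mdiv f (p + q) = mdiv f p + mdiv f q" "mmod f (p + q) = mmod f p + mmod f q"
    by (intro mdivmod_unique[OF *]; simp add: coeff_mmod)+
qed

lemma mdiv_smult: "mdiv f (smult c p) = smult c (mdiv f p)"
  and mmod_smult: "mmod f (smult c p) = smult c (mmod f p)"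
proof -
  have *: "smult c p = f * smult c (mdiv f p) + smult c (mmod f p)"
    using mdivmod[of p] by (metis mult_smult_right smult_add_right)
  show "mdiv f (smult c p) = smult c (mdiv f p)" "mmod f (smult c p) = smult c (mmod f p)"
    by (intro mdivmod_unique[OF *]; simp add: coeff_mmod)+
qed

lemma mdiv_mult: "mdiv f (f * a) = a"
  by (rule mdivmod_unique[where q = a and r = 0]; simp)

text \<open>\<open>h\<close> preserves the degree of the monic \<open>f\<close>, so it maps the
  division of \<open>p\<close> to a division of zero, whose remainder is zero. This puts the matrix
  of the Nakayama argument into the kernel of \<open>h\<close>.\<close>

lemma mmod_map_zero:
  assumes h: "rhom (h :: 'a \<Rightarrow> 'b::comm_ring_1)" and "map_poly h p = 0"
  shows "map_poly h (mmod f p) = 0"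
proof -
  interpret rhom h by (rule h)
  interpret m: rhom "map_poly h" using h by (rule rhom_map_poly)
  have lc: "coeff (map_poly h f) (degree f) = 1"
    using monic by (simp add: coeff_map_poly hs)
  have dg: "degree (map_poly h f) = degree f"
    using lc by (intro antisym le_degree degree_le) (auto simp: coeff_map_poly hs coeff_eq_0)
  have "map_poly h f * map_poly h (mdiv f p) + map_poly h (mmod f p) = 0"
    using mdivmod[of p] assms(2) by (metis m.h_add m.h_mult)
  then show ?thesis
    by (rule Submission.mdivmod_zero(2)[rotated])
      (auto simp: dg lc coeff_mmod coeff_map_poly hs)
qed

end

lemma smult_sum_right: "smult c (sum f S) = (\<Sum>x\<in>S. smult c (f x))"
  by (induction S rule: infinite_finite_induct) (auto simp: smult_add_right)

text \<open>Nakayama's lemma at the prime \<open>ker h\<close>, by elimination instead of determinants.\<close>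

lemma nakayama_elimination:
  fixes h :: "'b::comm_ring_1 \<Rightarrow> 'c::idom" and J :: "'b poly \<Rightarrow> bool" and e :: nat
  assumes h: "rhom h" and J_add: "\<And>x y. J x \<Longrightarrow> J y \<Longrightarrow> J (x + y)" and J_smult: "\<And>c x. J x \<Longrightarrow> J (smult c x)"
    and "\<And>l. l < e \<Longrightarrow> J (smult (u l) (b l) - (\<Sum>j<e. smult (a l j) (b j)))"
    and "\<And>l. l < e \<Longrightarrow> h (u l) \<noteq> 0" and "\<And>l j. l < e \<Longrightarrow> j < e \<Longrightarrow> h (a l j) = 0"
  shows "\<exists>c. h c \<noteq> 0 \<and> (\<forall>l<e. J (smult c (b l)))"
  using assms(4-)
proof (induction e arbitrary: u a)
  case 0
  then show ?case using rhom.h_one[OF h] by (metis not_less_zero one_neq_zero)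
next
  case (Suc e)
  interpret rhom h by (rule h)
  have J_sum: "J (\<Sum>j<n. smult (c j) (x j))" if "J y" "\<And>j. j < n \<Longrightarrow> J (x j)" for n :: nat and x c y
    using that(2)
  proof (induction n)
    case 0
    then show ?case using J_smult[OF that(1), of 0] by simp
  qed (auto intro: J_add J_smult)
  \<comment> \<open>Moving the diagonal term to the left gives \<open>b e\<close> the coefficient
    \<open>w\<close>, which \<open>h\<close> does not kill. The remaining relations, multiplied by
    \<open>w\<close>, are then freed of \<open>b e\<close>; their coefficients
    \<open>w * u l\<close> survive \<open>h\<close> because its target is a domain.\<close>
  define w where "w = u e - a e e"
  have w: "h w \<noteq> 0" using Suc.prems by (simp add: w_def hs)
  have Je: "J (smult w (b e) - (\<Sum>j<e. smult (a e j) (b j)))"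
    using Suc.prems(1)[of e] by (simp add: w_def algebra_simps smult_diff_left)
  have "\<exists>c. h c \<noteq> 0 \<and> (\<forall>l<e. J (smult c (b l)))"
  proof (rule Suc.IH[of "\<lambda>l. w * u l" "\<lambda>l j. w * a l j + a l e * a e j"])
    fix l assume l: "l < e"
    have "J (smult w (smult (u l) (b l) - (\<Sum>j<Suc e. smult (a l j) (b j)))
      + smult (a l e) (smult w (b e) - (\<Sum>j<e. smult (a e j) (b j))))"
      using Suc.prems(1)[of l] l Je by (auto intro: J_add J_smult)
    also have "smult w (smult (u l) (b l) - (\<Sum>j<Suc e. smult (a l j) (b j)))
      + smult (a l e) (smult w (b e) - (\<Sum>j<e. smult (a e j) (b j)))
      = smult (w * u l) (b l) - (\<Sum>j<e. smult (w * a l j + a l e * a e j) (b j))"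
      by (simp add: smult_diff_right smult_add_right smult_add_left sum.distrib smult_sum_right mult.commute)
    finally show "J (smult (w * u l) (b l) - (\<Sum>j<e. smult (w * a l j + a l e * a e j) (b j)))" .
  qed (use Suc.prems w in \<open>auto simp: hs\<close>)
  then obtain c where c: "h c \<noteq> 0" "\<And>l. l < e \<Longrightarrow> J (smult c (b l))" by blast
  have "J (smult c (smult w (b e) - (\<Sum>j<e. smult (a e j) (b j))) + (\<Sum>j<e. smult (a e j) (smult c (b j))))"
    by (intro J_add J_smult J_sum[OF Je] Je c)
  then have "J (smult (c * w) (b e))"
    by (simp add: smult_diff_right smult_sum_right mult.commute)
  moreover have "J (smult (c * w) (b l))" if "l < e" for l
    using J_smult[OF c(2)[OF that], of w] by (simp add: mult.commute)
  ultimately have "\<forall>l<Suc e. J (smult (c * w) (b l))" by (auto simp: less_Suc_eq)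
  then show ?case using c w by (intro exI[of _ "c * w"]) (simp add: hs)
qed

text \<open>A substitute for the resultant of \<open>F\<close> and \<open>G\<close>. As
  \<open>F\<close> is monic, the quotient by \<open>(F, G)\<close> is generated over the
  coefficients by the powers of \<open>t\<close> below \<open>degree F\<close>; it vanishes after
  applying \<open>h\<close>, so by Nakayama some \<open>c\<close> with \<open>h c\<close> nonzero
  kills it. The section \<open>s\<close> lifts the Bezout coefficients.\<close>

lemma elimination_avoiding_point:
  fixes h :: "'b::comm_ring_1 \<Rightarrow> 'k::field" and F G :: "'b poly"
  assumes h: "rhom h" and s: "\<And>c. h (s c) = c" and monic: "lead_coeff F = 1"
    and UV: "U * map_poly h F + V * map_poly h G = 1"
  obtains c U' V' where "h c \<noteq> 0" "[:c:] = U' * F + V' * G"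
proof -
  interpret rhom h by (rule h)
  interpret m: rhom "map_poly h" using h by (rule rhom_map_poly)
  define e where "e = degree F"
  define J where "J x \<longleftrightarrow> (\<exists>U V. x = U * F + V * G)" for x
  have lift: "\<exists>U'. map_poly h U' = U" for U
  proof -
    have "\<exists>U'. map_poly h U' = U"
    proof (induction U)
      case 0
      then show ?case by (metis map_poly_0)
    next
      case (pCons c U)
      then obtain U' where "map_poly h U' = U" by blast
      then have "map_poly h (pCons (s c) U') = pCons c U" by (simp add: map_poly_pCons hs s)
      then show ?case by blast
    qed
    then show ?thesis by blast
  qed
  obtain U1 V1 where U1: "map_poly h U1 = U" and V1: "map_poly h V1 = V" using lift by metis
  \<comment> \<open>\<open>R\<close> is congruent to \<open>1\<close> modulo \<open>(F, G)\<close>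
    and reduces to zero under \<open>h\<close>. Hence each power of \<open>t\<close> is congruent to
    its product with \<open>R\<close>, and the remainder of that product modulo \<open>F\<close> has
    coefficients in the kernel of \<open>h\<close>.\<close>
  define R where "R = 1 - U1 * F - V1 * G"
  have R: "map_poly h R = 0" using UV by (simp add: R_def m.hs U1 V1 algebra_simps)
  have J_add: "J (x + y)" if xy: "J x" "J y" for x y
  proof -
    obtain U V U' V' where "x = U * F + V * G" "y = U' * F + V' * G" using xy unfolding J_def by blast
    then have "x + y = (U + U') * F + (V + V') * G" by (simp add: algebra_simps)
    then show ?thesis unfolding J_def by blast
  qed
  have J_mult: "J (q * x)" if x: "J x" for q x
  proof -
    obtain U V where "x = U * F + V * G" using x unfolding J_def by blast
    then have "q * x = (q * U) * F + (q * V) * G" by (simp add: algebra_simps)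
    then show ?thesis unfolding J_def by blast
  qed
  have J_smult: "J (smult c x)" if "J x" for c x
    using J_mult[OF that, of "[:c:]"] by simp
  define a where "a l j = coeff (mmod F (monom 1 l * R)) j" for l j
  have "\<exists>c. h c \<noteq> 0 \<and> (\<forall>l<e. J (smult c (monom 1 l)))"
  proof (rule nakayama_elimination[OF h J_add J_smult, where u = "\<lambda>_. 1" and a = a])
    fix l assume l: "l < e"
    have red: "mmod F (monom 1 l * R) = (\<Sum>j<e. smult (a l j) (monom 1 j))"
      unfolding a_def smult_monom
      by (rule poly_eqI) (auto simp: coeff_sum e_def coeff_mmod[OF monic] not_less)
    have "smult 1 (monom 1 l) - (\<Sum>j<e. smult (a l j) (monom 1 j))
       = monom 1 l * (U1 * F + V1 * G) + mdiv F (monom 1 l * R) * F"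
      unfolding red[symmetric] using mdivmod[OF monic, of "monom 1 l * R"]
      by (simp add: R_def algebra_simps)
    also have "\<dots> = (monom 1 l * U1 + mdiv F (monom 1 l * R)) * F + (monom 1 l * V1) * G"
      by (simp add: algebra_simps)
    finally show "J (smult 1 (monom 1 l) - (\<Sum>j<e. smult (a l j) (monom 1 j)))"
      unfolding J_def by blast
    fix j
    have "map_poly h (mmod F (monom 1 l * R)) = 0"
      by (rule mmod_map_zero[OF monic h]) (simp add: m.hs R)
    then have "coeff (map_poly h (mmod F (monom 1 l * R))) j = 0" by simp
    then show "h (a l j) = 0" by (simp add: coeff_map_poly hs a_def)
  qed (auto simp: hs)
  then obtain c where c: "h c \<noteq> 0" "\<And>l. l < e \<Longrightarrow> J (smult c (monom 1 l))" by blast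
  have "\<exists>c. h c \<noteq> 0 \<and> J [:c:]"
  proof (cases "e = 0")
    case True
    then have "F = 1" using monic unfolding e_def by (metis degree_0_id one_pCons)
    then have "J [:1:]" unfolding J_def by (intro exI[of _ 1] exI[of _ 0]) (simp add: one_pCons)
    then show ?thesis by (intro exI[of _ 1]) (simp add: hs)
  next
    case False
    then show ?thesis using c(1) c(2)[of 0] by (intro exI[of _ c]) (simp add: monom_0)
  qed
  then show ?thesis using that unfolding J_def by blast
qed

subsection \<open>The weak Nullstellensatz\<close>

definition is_ideal :: "'a::comm_ring_1 set \<Rightarrow> bool" where
  "is_ideal I \<longleftrightarrow> 0 \<in> I \<and> (\<forall>x\<in>I. \<forall>y\<in>I. x + y \<in> I) \<and> (\<forall>a. \<forall>x\<in>I. a * x \<in> I)"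

lemma is_idealD:
  assumes "is_ideal I"
  shows "0 \<in> I" and "x \<in> I \<Longrightarrow> y \<in> I \<Longrightarrow> x + y \<in> I" and "x \<in> I \<Longrightarrow> a * x \<in> I" and "x \<in> I \<Longrightarrow> x * a \<in> I"
    and "x \<in> I \<Longrightarrow> y \<in> I \<Longrightarrow> x - y \<in> I"
proof -
  show *: "x \<in> I \<Longrightarrow> y \<in> I \<Longrightarrow> x + y \<in> I" "x \<in> I \<Longrightarrow> a * x \<in> I" for x y a
    using assms by (auto simp: is_ideal_def)
  show "0 \<in> I" using assms by (auto simp: is_ideal_def)
  show "x \<in> I \<Longrightarrow> x * a \<in> I" using *(2)[of x a] by (simp add: mult.commute)
  show "x \<in> I \<Longrightarrow> y \<in> I \<Longrightarrow> x - y \<in> I" using *(1)[of x "- y"] *(2)[of y "-1"] by simp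
qed

lemma is_ideal_two_generators: "is_ideal {p. \<exists>u v. p = u * f + v * g}"
proof -
  have "\<exists>u v. x + y = u * f + v * g" if "x = a * f + b * g" "y = c * f + d * g" for x y a b c d
    using that by (intro exI[of _ "a + c"] exI[of _ "b + d"]) (simp add: algebra_simps)
  moreover have "\<exists>u v. z * x = u * f + v * g" if "x = a * f + b * g" for x z a b
    using that by (intro exI[of _ "z * a"] exI[of _ "z * b"]) (simp add: algebra_simps)
  moreover have "\<exists>u v. 0 = u * f + v * g"
    by (intro exI[of _ 0]) simp
  ultimately show ?thesis unfolding is_ideal_def by blast
qed

text \<open>An element of least degree divides all others. It is not constant because
  \<open>1\<close> is not in \<open>J\<close>, and any root of it serves.\<close>

lemma univariate_ideal_root:
  fixes J :: "'k::field poly set"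
  assumes ac: "alg_closed TYPE('k)" and J: "is_ideal J" and "p \<in> J" "p \<noteq> 0" and "1 \<notin> J"
  obtains t where "\<And>q. q \<in> J \<Longrightarrow> poly q t = 0"
proof -
  define P where "P n \<longleftrightarrow> (\<exists>q\<in>J. q \<noteq> 0 \<and> degree q = n)" for n
  have "P (degree p)" using assms by (auto simp: P_def)
  then have "P (Least P)" by (rule LeastI)
  then obtain d where d: "d \<in> J" "d \<noteq> 0" "degree d = Least P" unfolding P_def by blast
  have dvd: "d dvd q" if "q \<in> J" for q
  proof (rule ccontr)
    assume "\<not> d dvd q"
    then have nz: "q mod d \<noteq> 0" by (simp add: dvd_eq_mod_eq_0)
    have "q mod d = q - (q div d) * d" by (simp add: minus_div_mult_eq_mod)
    then have "q mod d \<in> J" using is_idealD[OF J] that d by metis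
    then have "P (degree (q mod d))" using nz by (auto simp: P_def)
    then have "Least P \<le> degree (q mod d)" by (rule Least_le)
    then show False using degree_mod_less[OF d(2), of q] nz d(3) by simp
  qed
  have "degree d \<noteq> 0"
  proof
    assume "degree d = 0"
    then obtain c where c: "d = [:c:]" by (metis degree_0_id)
    then have "[:inverse c:] * d = 1" using d(2) by (simp add: one_pCons)
    then show False using is_idealD(3)[OF J d(1)] assms(5) by metis
  qed
  then obtain t where "(\<Sum>i\<le>degree d. coeff d i * t ^ i) = 0"
    using ac d(2) unfolding alg_closed_def by (metis leading_coeff_0_iff neq0_conv)
  then have "poly d t = 0" by (simp add: poly_altdef)
  then show ?thesis using that dvd by (metis dvd_trans poly_eq_0_iff_dvd)
qed

lemma subst_cong_ideal:
  assumes I: "is_ideal I" and "\<And>j. \<sigma> j - var j \<in> I"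
  shows "subst \<sigma> p - p \<in> I"
proof (induction p rule: mpoly_induct)
  case (mult p q)
  have "subst \<sigma> (p * q) - p * q = subst \<sigma> p * (subst \<sigma> q - q) + q * (subst \<sigma> p - p)"
    by (simp add: rhom.hs[OF rhom_subst] algebra_simps)
  then show ?case using mult is_idealD[OF I] by metis
next
  case (add p q)
  have "subst \<sigma> (p + q) - (p + q) = (subst \<sigma> p - p) + (subst \<sigma> q - q)"
    by (simp add: rhom.hs[OF rhom_subst])
  then show ?case using add is_idealD[OF I] by metis
qed (use assms is_idealD(1)[OF I] in auto)

text \<open>Pullback along the projection parallel to \<open>v\<close> onto the hyperplane \<open>x\<^sub>i = 0\<close>.\<close>

definition proj :: "'n \<Rightarrow> ('n \<Rightarrow> 'k) \<Rightarrow> ('n::finite, 'k::field) mpoly \<Rightarrow> ('n, 'k) mpoly" where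
  "proj i v = subst (\<lambda>j. if j = i then 0 else var j - cst (v j / v i) * var i)"

lemma rhom_proj: "rhom (proj i v)"
  unfolding proj_def by (rule rhom_subst)

lemma proj_cst [simp]: "proj i v (cst c) = cst c"
  and proj_var: "proj i v (var j) = (if j = i then 0 else var j - cst (v j / v i) * var i)"
  by (simp_all add: proj_def)

text \<open>A point is its projection onto the hyperplane \<open>x_i = 0\<close> plus
  \<open>x_i / v_i\<close> times \<open>v\<close>.\<close>

lemma lshift_proj:
  assumes "v i \<noteq> 0"
  shows "poly (map_poly (proj i v) (lshift v p)) (cst (inverse (v i)) * var i) = p"
proof (rule rhom_eqI[OF _ rhom_id])
  show "rhom (\<lambda>p. poly (map_poly (proj i v) (lshift v p)) (cst (inverse (v i)) * var i))"
    by (rule rhom_comp[OF rhom_comp[OF rhom_poly rhom_map_poly[OF rhom_proj]] rhom_lshift])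
  show "poly (map_poly (proj i v) (lshift v (cst c))) (cst (inverse (v i)) * var i) = cst c" for c
    by (simp add: lshift_cst map_poly_pCons rhom.hs[OF rhom_proj])
  show "poly (map_poly (proj i v) (lshift v (var j))) (cst (inverse (v i)) * var i) = var j" for j
    using assms
    by (auto simp: lshift_var map_poly_pCons rhom.hs[OF rhom_proj] proj_var divide_inverse cst_mult[symmetric] mult_ac)
qed

definition line :: "('n \<Rightarrow> 'k) \<Rightarrow> ('n \<Rightarrow> 'k) \<Rightarrow> ('n::finite, 'k::field) mpoly \<Rightarrow> 'k poly" where
  "line x v p = map_poly (ev x) (lshift v p)"

lemma rhom_line: "rhom (line x v)"
  unfolding line_def by (intro rhom_comp[OF rhom_map_poly[OF rhom_ev] rhom_lshift])

lemma line_cst: "line x v (cst c) = [:c:]" and line_var: "line x v (var j) = [:x j, v j:]"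
  by (simp_all add: line_def lshift_cst lshift_var map_poly_pCons rhom.hs[OF rhom_ev])

lemma poly_line: "poly (line x v p) t = ev (\<lambda>j. x j + v j * t) p"
  by (rule rhom_eqI[OF rhom_comp[OF rhom_poly rhom_line] rhom_ev])
    (auto simp: line_cst line_var mult.commute)

text \<open>The function \<open>(x_i - x i) / v i\<close>, with \<open>x i\<close> the coordinate of
  the base point, restricts to the parameter \<open>t\<close> of the line. Surjectivity makes the
  restriction of an ideal to the line an ideal again.\<close>

lemma line_surj:
  assumes "v i \<noteq> 0"
  obtains p where "line x v p = q"
proof -
  define \<tau> where "\<tau> = cst (inverse (v i)) * (var i - cst (x i))"
  have \<tau>: "line x v \<tau> = [:0, 1:]"
    using assms by (simp add: \<tau>_def rhom.hs[OF rhom_line] line_cst line_var)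
  have "\<exists>p. line x v p = q"
  proof (induction q)
    case 0
    then show ?case using rhom.h_zero[OF rhom_line] by blast
  next
    case (pCons a q)
    then obtain p where "line x v p = q" by blast
    then have "line x v (cst a + \<tau> * p) = pCons a q"
      by (simp add: rhom.hs[OF rhom_line] \<tau> line_cst)
    then show ?case by blast
  qed
  then show ?thesis using that by blast
qed

text \<open>\<open>V\<close> contains the variables not known to lie in \<open>I\<close>. A nonzero
  element of \<open>I\<close> in these variables is made monic along a direction \<open>v\<close>.
  The ideal \<open>I0\<close> of functions whose pullback along the projection lies in
  \<open>I\<close> has a zero \<open>x\<close> by induction, and elimination shows that
  \<open>I\<close> stays proper on the line through \<open>x\<close> with direction
  \<open>v\<close>.\<close>

lemma nullstellensatz_aux:
  fixes I :: "('n::finite, 'k::field_char_0) mpoly set"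
  assumes ac: "alg_closed TYPE('k)" and "finite V"
    and "is_ideal I" "1 \<notin> I" "\<And>j. j \<notin> V \<Longrightarrow> var j \<in> I"
  shows "\<exists>x. \<forall>p\<in>I. ev x p = 0"
  using assms(2-)
proof (induction V arbitrary: I rule: finite_induct)
  \<comment> \<open>Modulo \<open>I\<close> every polynomial equals one in the variables of
    \<open>W\<close>. If \<open>I\<close> contains no nonzero polynomial of that kind, all its
    elements vanish at the origin.\<close>
  have zero_case: "\<exists>x. \<forall>p\<in>I. ev x p = 0"
    if I: "is_ideal I" and W: "\<And>j. j \<notin> W \<Longrightarrow> var j \<in> I"
      and none: "\<And>f. f \<in> I \<Longrightarrow> vars_in W f \<Longrightarrow> f = 0" for I :: "('n, 'k) mpoly set" and W
  proof (intro exI ballI)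
    fix p assume "p \<in> I"
    define \<sigma> :: "'n \<Rightarrow> ('n, 'k) mpoly" where "\<sigma> j = (if j \<in> W then var j else 0)" for j
    have "\<sigma> j - var j \<in> I" for j
      using W[of j] is_idealD(1)[OF I] is_idealD(5)[OF I is_idealD(1)[OF I], of "var j"] by (auto simp: \<sigma>_def)
    then have "subst \<sigma> p - p \<in> I" by (intro subst_cong_ideal I)
    then have "subst \<sigma> p \<in> I" using is_idealD(2)[OF I _ \<open>p \<in> I\<close>] by fastforce
    moreover have "vars_in W (subst \<sigma> p)"
      by (intro vars_in_subst) (auto simp: \<sigma>_def vars_in_var)
    ultimately have "subst \<sigma> p = 0" using none by blast
    moreover have "ev (\<lambda>_. 0) (subst \<sigma> p) = ev (\<lambda>_. 0) p"
      by (rule rhom_eqI[OF rhom_comp[OF rhom_ev rhom_subst] rhom_ev])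
        (auto simp: \<sigma>_def rhom.hs[OF rhom_ev])
    ultimately show "ev (\<lambda>_. 0) p = 0" by (simp add: rhom.hs[OF rhom_ev])
  qed
  {
    case empty
    have "f = 0" if f: "f \<in> I" "vars_in {} f" for f
    proof (rule ccontr)
      assume "f \<noteq> 0"
      obtain c where "f = cst c" using vars_in_empty f by blast
      then have "cst (inverse c) * f = 1" using \<open>f \<noteq> 0\<close> by (simp add: cst_mult[symmetric])
      then show False using is_idealD(3)[OF empty(1) f(1)] empty(2) by metis
    qed
    then show ?case using zero_case empty by blast
  next
    case (insert i V)
    note I = \<open>is_ideal I\<close>
    show ?case
    proof (cases "\<forall>f\<in>I. vars_in (insert i V) f \<longrightarrow> f = 0")
      case True
      then show ?thesis using zero_case[OF I, of "insert i V"] insert.prems by blast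
    next
      case False
      then obtain f where f: "f \<in> I" "vars_in (insert i V) f" "f \<noteq> 0" by blast
      obtain v c where v: "v i \<noteq> 0" "\<And>j. j \<notin> insert i V \<Longrightarrow> v j = 0" and c: "c \<noteq> 0" "lead_coeff (lshift v f) = cst c"
        using lshift_unit_leading[OF f(3,2)] by blast
      define f' where "f' = cst (inverse c) * f"
      have f'I: "f' \<in> I" unfolding f'_def by (intro is_idealD I f)
      have monic: "lead_coeff (lshift v f') = 1"
        unfolding f'_def by (rule lshift_normalized_monic[OF c])
      define I0 where "I0 = {p. proj i v p \<in> I}"
      have I0: "is_ideal I0"
        unfolding is_ideal_def I0_def using is_idealD[OF I] by (auto simp: rhom.hs[OF rhom_proj])
      have "1 \<notin> I0" using insert.prems by (simp add: I0_def rhom.hs[OF rhom_proj])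
      \<comment> \<open>The projection sends \<open>x_i\<close> to zero, and it fixes the variables
        outside \<open>insert i V\<close> because \<open>v\<close> vanishes there.\<close>
      moreover have "var j \<in> I0" if "j \<notin> V" for j
        using insert.prems v that is_idealD[OF I] by (auto simp: I0_def proj_var)
      ultimately obtain x where x: "\<And>p. p \<in> I0 \<Longrightarrow> ev x p = 0" using insert.IH[OF I0] by blast
      define J where "J = line x v ` I"
      have J: "is_ideal J"
        unfolding is_ideal_def
      proof (intro conjI ballI allI)
        show "0 \<in> J" unfolding J_def using is_idealD(1)[OF I] rhom.h_zero[OF rhom_line] by (metis imageI)
        fix a b assume "a \<in> J"
        then obtain p where p: "p \<in> I" "a = line x v p" unfolding J_def by blast
        { assume "b \<in> J"
          then obtain q where "q \<in> I" "b = line x v q" unfolding J_def by blast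
          then show "a + b \<in> J" using p is_idealD(2)[OF I] rhom.h_add[OF rhom_line] unfolding J_def by (metis imageI) }
        obtain q where "b = line x v q" using line_surj[where v = v and x = x and i = i] v(1) by metis
        then show "b * a \<in> J" using p is_idealD(3)[OF I] rhom.h_mult[OF rhom_line] unfolding J_def by (metis imageI)
      qed
      have "coeff (line x v f') (degree (lshift v f')) = 1"
        by (simp add: line_def coeff_map_poly rhom.hs[OF rhom_ev] monic)
      then have nz: "line x v f' \<noteq> 0" by auto
      have "1 \<notin> J"
      proof
        assume "1 \<in> J"
        then obtain g where g: "g \<in> I" "line x v g = 1" unfolding J_def by force
        obtain c U V where c: "ev x c \<noteq> 0" and UV: "[:c:] = U * lshift v f' + V * lshift v g"
          by (rule elimination_avoiding_point[OF rhom_ev ev_cst monic, of 0 x 1 "lshift v g"])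
            (use g in \<open>auto simp: line_def\<close>)
        \<comment> \<open>\<open>\<psi>\<close> sends \<open>lshift v p\<close> back to
          \<open>p\<close> and a constant \<open>c\<close> to its pullback
          \<open>proj i v c\<close>. The elimination identity thus puts \<open>c\<close> into
          \<open>I0\<close>, although \<open>c\<close> does not vanish at \<open>x\<close>.\<close>
        define \<psi> where "\<psi> P = poly (map_poly (proj i v) P) (cst (inverse (v i)) * var i)" for P
        have \<psi>: "rhom \<psi>"
          unfolding \<psi>_def by (rule rhom_comp[OF rhom_poly rhom_map_poly[OF rhom_proj]])
        have "proj i v c = \<psi> [:c:]" by (simp add: \<psi>_def map_poly_pCons rhom.hs[OF rhom_proj])
        also have "\<dots> = \<psi> U * f' + \<psi> V * g"
          unfolding UV rhom.hs[OF \<psi>] using lshift_proj[where v = v and i = i] v(1) by (simp add: \<psi>_def)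
        also have "\<dots> \<in> I" using is_idealD[OF I] f'I g by blast
        finally have "c \<in> I0" by (simp add: I0_def)
        then show False using x c by blast
      qed
      then obtain t where "\<And>q. q \<in> J \<Longrightarrow> poly q t = 0"
        using univariate_ideal_root[OF ac J _ nz] f'I J_def by blast
      then have "\<forall>p\<in>I. ev (\<lambda>j. x j + v j * t) p = 0"
        unfolding J_def poly_line[symmetric] by blast
      then show ?thesis by blast
    qed
  }
qed

theorem nullstellensatz:
  fixes I :: "('n::finite, 'k::field_char_0) mpoly set"
  assumes "alg_closed TYPE('k)" and "is_ideal I" "1 \<notin> I"
  obtains x where "\<And>p. p \<in> I \<Longrightarrow> ev x p = 0"
  using nullstellensatz_aux[of UNIV I] assms by auto

subsection \<open>Unimodular columns\<close>

definition scale :: "'a::comm_ring_1 \<Rightarrow> ('i \<Rightarrow> 'a) \<Rightarrow> 'i \<Rightarrow> 'a" where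
  "scale c v = (\<lambda>a. c * v a)"

text \<open>The free module on \<open>I\<close> consists of the functions supported in
  \<open>I\<close>, so a basis element can be removed without changing the type.\<close>

definition supp_in :: "'i set \<Rightarrow> ('i \<Rightarrow> 'a::zero) \<Rightarrow> bool" where
  "supp_in I v \<longleftrightarrow> (\<forall>a. a \<notin> I \<longrightarrow> v a = 0)"

definition unit_vec :: "'i \<Rightarrow> 'i \<Rightarrow> 'a::zero_neq_one" where
  "unit_vec b = (\<lambda>a. if a = b then 1 else 0)"

definition lin :: "('r \<Rightarrow> 'v::plus \<Rightarrow> 'v) \<Rightarrow> ('r \<Rightarrow> 'w::plus \<Rightarrow> 'w) \<Rightarrow> ('v \<Rightarrow> 'w) \<Rightarrow> bool" where
  "lin s s' P \<longleftrightarrow> (\<forall>x y. P (x + y) = P x + P y) \<and> (\<forall>c x. P (s c x) = s' c (P x))"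

lemma lin_comp: "lin s s' P \<Longrightarrow> lin s' s'' Q \<Longrightarrow> lin s s'' (\<lambda>x. Q (P x))"
  by (simp add: lin_def)

lemma lin_id: "lin s s (\<lambda>x. x)"
  by (simp add: lin_def)

definition automorphism_pair :: "'i set \<Rightarrow> (('i \<Rightarrow> 'a::comm_ring_1) \<Rightarrow> ('i \<Rightarrow> 'a)) \<Rightarrow> (('i \<Rightarrow> 'a) \<Rightarrow> ('i \<Rightarrow> 'a)) \<Rightarrow> bool" where
  "automorphism_pair I P R \<longleftrightarrow> lin scale scale P \<and> lin scale scale R \<and>
     (\<forall>v. P (R v) = v) \<and> (\<forall>v. R (P v) = v) \<and>
     (\<forall>v. supp_in I v \<longrightarrow> supp_in I (P v)) \<and> (\<forall>v. supp_in I v \<longrightarrow> supp_in I (R v))"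

definition col_equiv :: "'i set \<Rightarrow> ('i \<Rightarrow> 'a::comm_ring_1) \<Rightarrow> ('i \<Rightarrow> 'a) \<Rightarrow> bool" where
  "col_equiv I f g \<longleftrightarrow> (\<exists>P R. automorphism_pair I P R \<and> P f = g)"

lemma col_equiv_refl: "col_equiv I f f"
  unfolding col_equiv_def automorphism_pair_def
  by (intro exI[of _ "\<lambda>v. v"]) (simp add: lin_id)

lemma col_equiv_sym: "col_equiv I f g \<Longrightarrow> col_equiv I g f"
  unfolding col_equiv_def automorphism_pair_def by metis

lemma col_equiv_trans: "col_equiv I f g \<Longrightarrow> col_equiv I g h \<Longrightarrow> col_equiv I f h"
proof -
  assume "col_equiv I f g" "col_equiv I g h"
  then obtain P R P' R' where *: "automorphism_pair I P R" "P f = g" "automorphism_pair I P' R'" "P' g = h"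
    unfolding col_equiv_def by blast
  have "lin scale scale (\<lambda>v. P' (P v))" "lin scale scale (\<lambda>v. R (R' v))"
    using lin_comp[of scale scale P scale P'] lin_comp[of scale scale R' scale R] *
    unfolding automorphism_pair_def by blast+
  then have "automorphism_pair I (\<lambda>v. P' (P v)) (\<lambda>v. R (R' v)) \<and> P' (P f) = h"
    using * unfolding automorphism_pair_def by simp
  then show ?thesis unfolding col_equiv_def by blast
qed

text \<open>Conjugating a linear map by the coordinatewise automorphism twists scalars by
  \<open>\<beta>\<close> and then by \<open>\<alpha>\<close>, so the result is linear again.\<close>

lemma col_equiv_ring_automorphism:
  fixes \<alpha> \<beta> :: "'a::comm_ring_1 \<Rightarrow> 'a" and f g :: "'i \<Rightarrow> 'a"
  assumes \<alpha>: "rhom \<alpha>" and \<beta>: "rhom \<beta>" and inv: "\<And>x. \<alpha> (\<beta> x) = x" "\<And>x. \<beta> (\<alpha> x) = x"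
    and "col_equiv I f g"
  shows "col_equiv I (\<lambda>a. \<alpha> (f a)) (\<lambda>a. \<alpha> (g a))"
proof -
  interpret a: rhom \<alpha> by (rule \<alpha>)
  interpret b: rhom \<beta> by (rule \<beta>)
  obtain P R where PR: "automorphism_pair I P R" and g: "P f = g"
    using assms(5) unfolding col_equiv_def by blast
  define tr where "tr S v = (\<lambda>a. \<alpha> (S (\<lambda>a. \<beta> (v a)) a))" for S :: "('i \<Rightarrow> 'a) \<Rightarrow> 'i \<Rightarrow> 'a" and v
  have lin: "lin scale scale (tr S)" if "lin scale scale S" for S
  proof -
    have "tr S (x + y) = tr S x + tr S y" for x y
    proof -
      have "(\<lambda>a. \<beta> ((x + y) a)) = (\<lambda>a. \<beta> (x a)) + (\<lambda>a. \<beta> (y a))" by (auto simp: b.hs)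
      then show ?thesis using that by (auto simp: tr_def lin_def a.hs)
    qed
    moreover have "tr S (scale c x) = scale c (tr S x)" for c x
    proof -
      have "(\<lambda>a. \<beta> (scale c x a)) = scale (\<beta> c) (\<lambda>a. \<beta> (x a))" by (auto simp: b.hs scale_def)
      then have "tr S (scale c x) = (\<lambda>a. \<alpha> (scale (\<beta> c) (S (\<lambda>a. \<beta> (x a))) a))"
        using that by (simp add: tr_def lin_def)
      then show ?thesis by (simp add: scale_def tr_def a.hs inv)
    qed
    ultimately show ?thesis by (simp add: lin_def)
  qed
  have "automorphism_pair I (tr P) (tr R)"
    using PR lin[of P] lin[of R] unfolding automorphism_pair_def
    by (auto simp: tr_def inv supp_in_def a.hs b.hs)
  moreover have "tr P (\<lambda>a. \<alpha> (f a)) = (\<lambda>a. \<alpha> (g a))"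
    by (simp add: tr_def inv g)
  ultimately show ?thesis unfolding col_equiv_def by blast
qed

section \<open>Elementary moves on columns\<close>

lemma col_equivI:
  assumes "\<And>x y. P (x + y) = P x + P y" "\<And>c x. P (scale c x) = scale c (P x)"
    and "\<And>x y. R (x + y) = R x + R y" "\<And>c x. R (scale c x) = scale c (R x)"
    and "\<And>v. P (R v) = v" "\<And>v. R (P v) = v"
    and "\<And>v. supp_in I v \<Longrightarrow> supp_in I (P v)" "\<And>v. supp_in I v \<Longrightarrow> supp_in I (R v)"
    and "P f = g"
  shows "col_equiv I f g"
  unfolding col_equiv_def automorphism_pair_def lin_def using assms by blast

lemma col_equiv_unit_entry:
  assumes "b \<in> I" and "f b * w = 1" and "supp_in I f"
  shows "col_equiv I f (unit_vec b)"
proof (rule col_equivI[where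
    P = "\<lambda>v a. if a = b then w * v b else if a \<in> I then v a - f a * (w * v b) else v a" and
    R = "\<lambda>v a. if a = b then f b * v b else if a \<in> I then v a + f a * v b else v a"])
  have wf: "w * (f b * x) = x" "f b * (w * x) = x" for x
    using assms(2) by (simp_all add: mult.assoc[symmetric] mult.commute)
  show "(\<lambda>a. if a = b then w * f b else if a \<in> I then f a - f a * (w * f b) else f a) = unit_vec b"
    using assms wf[of 1] by (auto simp: unit_vec_def supp_in_def mult.commute)
  show "(\<lambda>a. if a = b then w * (if b = b then f b * v b else if b \<in> I then v b + f b * v b else v b)
      else if a \<in> I then (if a = b then f b * v b else if a \<in> I then v a + f a * v b else v a)
         - f a * (w * (if b = b then f b * v b else if b \<in> I then v b + f b * v b else v b))
      else if a = b then f b * v b else if a \<in> I then v a + f a * v b else v a) = v" for v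
    by (auto simp: wf)
  show "(\<lambda>a. if a = b then f b * (if b = b then w * v b else if b \<in> I then v b - f b * (w * v b) else v b)
      else if a \<in> I then (if a = b then w * v b else if a \<in> I then v a - f a * (w * v b) else v a)
         + f a * (if b = b then w * v b else if b \<in> I then v b - f b * (w * v b) else v b)
      else if a = b then w * v b else if a \<in> I then v a - f a * (w * v b) else v a) = v" for v
    by (auto simp: wf)
qed (use assms(1) in \<open>auto simp: fun_eq_iff scale_def supp_in_def algebra_simps\<close>)

lemma col_equiv_unit_vec:
  assumes "a \<in> I" "b \<in> I"
  shows "col_equiv I (unit_vec a) (unit_vec b :: 'i \<Rightarrow> 'a::comm_ring_1)"
proof (cases "a = b")
  case False
  show ?thesis
    by (rule col_equivI[where P = "\<lambda>v. v(a := v b, b := v a)" and R = "\<lambda>v. v(a := v b, b := v a)"])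
      (use False assms in \<open>auto simp: fun_eq_iff scale_def supp_in_def unit_vec_def\<close>)
qed (simp add: col_equiv_refl)

lemma col_equiv_SL2:
  assumes ij: "i \<in> I" "j \<in> I" "i \<noteq> j" and det: "a * d - b * c = (1 :: 'a::comm_ring_1)"
  shows "col_equiv I f (f(i := a * f i + b * f j, j := c * f i + d * f j))"
proof (rule col_equivI[where P = "\<lambda>v. v(i := a * v i + b * v j, j := c * v i + d * v j)"
      and R = "\<lambda>v. v(i := d * v i - b * v j, j := - c * v i + a * v j)"])
  have e: "(a * d - b * c) * x = x" for x using det by simp
  have e1: "a * (d * x - b * y) + b * (- c * x + a * y) = x" for x y
    using e[of x] by (simp add: algebra_simps)
  have e2: "c * (d * x - b * y) + d * (- c * x + a * y) = y" for x y
    using e[of y] by (simp add: algebra_simps)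
  have e3: "d * (a * x + b * y) - b * (c * x + d * y) = x" for x y
    using e[of x] by (simp add: algebra_simps)
  have e4: "- c * (a * x + b * y) + a * (c * x + d * y) = y" for x y
    using e[of y] by (simp add: algebra_simps)
  fix v :: "'b \<Rightarrow> 'a"
  let ?P = "\<lambda>v. v(i := a * v i + b * v j, j := c * v i + d * v j)"
  let ?R = "\<lambda>v. v(i := d * v i - b * v j, j := - c * v i + a * v j)"
  show "?P (?R v) = v"
    by (rule ext) (use ij in \<open>simp add: e1 e2 del: mult_minus_left\<close>)
  show "?R (?P v) = v"
    by (rule ext) (use ij in \<open>simp add: e3 e4 del: mult_minus_left\<close>)
qed (use ij in \<open>auto simp: fun_eq_iff scale_def supp_in_def algebra_simps\<close>)

text \<open>If the combination of the entries \<open>i\<close> and \<open>j\<close> equals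
  \<open>c\<close>, every other entry can be changed by any multiple of \<open>c\<close>.\<close>

lemma col_equiv_add_multiples:
  assumes ij: "i \<in> I" "j \<in> I"
  shows "col_equiv I f (\<lambda>a. if a \<in> I - {i, j} then f a + y a * (p * f i + q * f j) else f a)"
  by (rule col_equivI[where
      P = "\<lambda>v a. if a \<in> I - {i, j} then v a + y a * (p * v i + q * v j) else v a" and
      R = "\<lambda>v a. if a \<in> I - {i, j} then v a - y a * (p * v i + q * v j) else v a"])
    (use ij in \<open>auto simp: fun_eq_iff scale_def supp_in_def algebra_simps\<close>)

lemma col_equiv_combination:
  assumes "finite S" "S \<subseteq> I" "i \<in> S" and w: "\<kappa> i * w = 1"
  shows "col_equiv I f (f(i := (\<Sum>a\<in>S. \<kappa> a * f a)))"
proof (rule col_equivI[where P = "\<lambda>v. v(i := (\<Sum>a\<in>S. \<kappa> a * v a))"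
      and R = "\<lambda>v. v(i := w * (v i - (\<Sum>a\<in>S - {i}. \<kappa> a * v a)))"])
  have S: "(\<Sum>a\<in>S. g a) = g i + (\<Sum>a\<in>S - {i}. g a)" for g :: "'a \<Rightarrow> 'b"
    using assms by (simp add: sum.remove)
  have off: "(\<Sum>a\<in>S - {i}. \<kappa> a * (v(i := z)) a) = (\<Sum>a\<in>S - {i}. \<kappa> a * v a)" for v z
    by (rule sum.cong) auto
  have wk: "w * (\<kappa> i * x) = x" "\<kappa> i * (w * x) = x" for x
    using w by (simp_all add: mult.assoc[symmetric] mult.commute)
  show "(v(i := w * (v i - (\<Sum>a\<in>S - {i}. \<kappa> a * v a))))(i := \<Sum>a\<in>S. \<kappa> a * (v(i := w * (v i - (\<Sum>a\<in>S - {i}. \<kappa> a * v a)))) a) = v" for v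
    unfolding S off by (rule ext) (simp add: wk)
  show "(v(i := \<Sum>a\<in>S. \<kappa> a * v a))(i := w * ((v(i := \<Sum>a\<in>S. \<kappa> a * v a)) i - (\<Sum>a\<in>S - {i}. \<kappa> a * (v(i := \<Sum>a\<in>S. \<kappa> a * v a)) a))) = v" for v
    unfolding off by (rule ext) (simp add: S wk)
qed (use assms in \<open>auto simp: fun_eq_iff scale_def supp_in_def algebra_simps sum.distrib sum_distrib_left\<close>)

text \<open>The cofactor \<open>x\<close> makes the divisions by \<open>c\<close> in Suslin's move
  explicit.\<close>

lemma poly_diff_dvd: "\<exists>x. poly p (s + d) = poly p s + d * (x :: 'a::comm_ring_1)"
proof (induction p)
  case 0
  then show ?case by (intro exI[of _ 0]) simp
next
  case (pCons a p)
  then obtain x where "poly p (s + d) = poly p s + d * x" by blast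
  then have "poly (pCons a p) (s + d) = poly (pCons a p) s + d * (poly p s + (s + d) * x)"
    by (simp add: algebra_simps)
  then show ?case by blast
qed

text \<open>Suslin's move: with \<open>c = U F\<^sub>i + V F\<^sub>j\<close>, the matrix \<open>\<Phi> = ((F\<^sub>i, -V), (F\<^sub>j, U))\<close> has determinant \<open>c\<close>, so
  \<open>\<Phi>(s + c h) adj \<Phi>(s) / c\<close> has polynomial entries and determinant one; it moves
  \<open>(F\<^sub>i, F\<^sub>j)(s)\<close> to \<open>(F\<^sub>i, F\<^sub>j)(s + c h)\<close>.\<close>

lemma suslin_move:
  fixes F :: "'i \<Rightarrow> 'a::comm_ring_1 poly"
  assumes ij: "i \<in> I" "j \<in> I" "i \<noteq> j" and c: "[:c:] = U * F i + V * F j"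
    and cancel: "\<And>x y. c * x = c * y \<Longrightarrow> x = y" and supp: "supp_in I F"
  shows "col_equiv I (\<lambda>a. poly (F a) s) (\<lambda>a. poly (F a) (s + c * h))"
proof -
  define s' where "s' = s + c * h"
  have "\<exists>X. \<forall>p. poly p s' = poly p s + c * h * X p"
    unfolding s'_def by (intro choice allI poly_diff_dvd)
  then obtain X where X: "poly p s' = poly p s + c * h * X p" for p by blast
  have cs: "c = poly U t * poly (F i) t + poly V t * poly (F j) t" for t
    using arg_cong[OF c, of "\<lambda>p. poly p t"] by simp
  let ?f = "poly (F i) s" and ?g = "poly (F j) s" and ?u = "poly U s" and ?v = "poly V s"
  let ?f' = "poly (F i) s'" and ?g' = "poly (F j) s'" and ?u' = "poly U s'" and ?v' = "poly V s'"
  \<comment> \<open>These are the entries of \<open>\<Phi>(s') adj \<Phi>(s) / c\<close>, with the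
    quotient carried out through \<open>p(s') = p(s) + c h X(p)\<close>. The two summands
    \<open>1\<close> come from \<open>c / c\<close>, as \<open>c = U F_i + V F_j\<close> at
    \<open>s\<close>.\<close>
  define m11 where "m11 = 1 + h * (X (F i) * ?u + X V * ?g)"
  define m12 where "m12 = h * (X (F i) * ?v - X V * ?f)"
  define m21 where "m21 = h * (X (F j) * ?u - X U * ?g)"
  define m22 where "m22 = 1 + h * (X (F j) * ?v + X U * ?f)"
  have c11: "c * m11 = ?f' * ?u + ?v' * ?g"
    using cs[of s] by (simp add: m11_def X algebra_simps)
  have c12: "c * m12 = ?f' * ?v - ?v' * ?f"
    by (simp add: m12_def X algebra_simps)
  have c21: "c * m21 = ?g' * ?u - ?u' * ?g"
    by (simp add: m21_def X algebra_simps)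
  have c22: "c * m22 = ?g' * ?v + ?u' * ?f"
    using cs[of s] by (simp add: m22_def X algebra_simps)
  \<comment> \<open>The determinants of \<open>\<Phi>(s')\<close> and \<open>adj \<Phi>(s)\<close>
    are both \<open>c\<close>; cancelling \<open>c\<close> twice leaves determinant one.\<close>
  have "c * (c * (m11 * m22 - m12 * m21)) = (c * m11) * (c * m22) - (c * m12) * (c * m21)"
    by (simp add: algebra_simps)
  also have "\<dots> = (?u' * ?f' + ?v' * ?g') * (?u * ?f + ?v * ?g)"
    unfolding c11 c12 c21 c22 by (simp add: algebra_simps)
  also have "\<dots> = c * (c * 1)" using cs[of s] cs[of s'] by simp
  finally have det: "m11 * m22 - m12 * m21 = 1" by (metis cancel)
  have "c * (m11 * ?f + m12 * ?g) = (c * m11) * ?f + (c * m12) * ?g" by (simp add: algebra_simps)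
  also have "\<dots> = (?u * ?f + ?v * ?g) * ?f'" unfolding c11 c12 by (simp add: algebra_simps)
  finally have mf: "m11 * ?f + m12 * ?g = ?f'" using cs[of s] cancel by metis
  have "c * (m21 * ?f + m22 * ?g) = (c * m21) * ?f + (c * m22) * ?g" by (simp add: algebra_simps)
  also have "\<dots> = (?u * ?f + ?v * ?g) * ?g'" unfolding c21 c22 by (simp add: algebra_simps)
  finally have mg: "m21 * ?f + m22 * ?g = ?g'" using cs[of s] cancel by metis
  define f1 where "f1 = (\<lambda>a. poly (F a) s)(i := ?f', j := ?g')"
  have 1: "col_equiv I (\<lambda>a. poly (F a) s) f1"
    using col_equiv_SL2[OF ij det, of "\<lambda>a. poly (F a) s"] by (simp add: f1_def mf mg)
  \<comment> \<open>In the other rows \<open>F a\<close> changes by a multiple of \<open>c\<close>,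
    and \<open>c\<close> is available as \<open>U F_i + V F_j\<close> at \<open>s'\<close> from the
    rows just moved.\<close>
  have 2: "(\<lambda>a. if a \<in> I - {i, j} then f1 a + h * X (F a) * (?u' * f1 i + ?v' * f1 j) else f1 a)
      = (\<lambda>a. poly (F a) s')"
  proof
    fix a
    have "f1 i = ?f'" "f1 j = ?g'" using ij by (auto simp: f1_def)
    then have cc: "?u' * f1 i + ?v' * f1 j = c" using cs[of s'] by simp
    show "(if a \<in> I - {i, j} then f1 a + h * X (F a) * (?u' * f1 i + ?v' * f1 j) else f1 a) = poly (F a) s'"
      unfolding cc using supp ij X[of "F a"]
      by (cases "a \<in> I") (auto simp: f1_def supp_in_def mult_ac)
  qed
  show ?thesis
    using col_equiv_trans[OF 1 col_equiv_add_multiples[OF ij(1,2), of f1 "\<lambda>a. h * X (F a)" ?u' ?v']]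
    unfolding 2 by (simp add: s'_def)
qed

text \<open>Coefficients are chosen one at a time. The next one must avoid \<open>0\<close> and at
  most one value for each \<open>t\<close> in \<open>Z\<close>, which is possible in an infinite
  field.\<close>

lemma generic_combination:
  fixes g :: "'i \<Rightarrow> 'k::field_char_0 \<Rightarrow> 'k"
  assumes "finite S" "finite Z"
  shows "\<exists>\<kappa>. (\<forall>a\<in>S. \<kappa> a \<noteq> 0) \<and> (\<forall>t\<in>Z. (\<exists>a\<in>S. g a t \<noteq> 0) \<longrightarrow> (\<Sum>a\<in>S. \<kappa> a * g a t) \<noteq> 0)"
  using assms(1)
proof (induction S rule: finite_induct)
  case empty
  then show ?case by simp
next
  case (insert b S)
  then obtain \<kappa> where \<kappa>: "\<forall>a\<in>S. \<kappa> a \<noteq> 0" "\<forall>t\<in>Z. (\<exists>a\<in>S. g a t \<noteq> 0) \<longrightarrow> (\<Sum>a\<in>S. \<kappa> a * g a t) \<noteq> 0" by blast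
  \<comment> \<open>Where \<open>g b t = 0\<close> the quotient is \<open>0\<close>, which is
    excluded anyway, and the sum at \<open>t\<close> does not depend on \<open>c\<close>.\<close>
  define bad where "bad = insert 0 ((\<lambda>t. - (\<Sum>a\<in>S. \<kappa> a * g a t) / g b t) ` Z)"
  have "finite bad" using assms by (simp add: bad_def)
  then obtain c where c: "c \<notin> bad" using ex_new_if_finite[OF infinite_UNIV_char_0] by blast
  have sums: "(\<Sum>a\<in>insert b S. (\<kappa>(b := c)) a * g a t) = c * g b t + (\<Sum>a\<in>S. \<kappa> a * g a t)" for t
    using insert.hyps by (simp add: sum.insert cong: sum.cong) (rule sum.cong, auto)
  have "c * g b t + (\<Sum>a\<in>S. \<kappa> a * g a t) \<noteq> 0" if t: "t \<in> Z" "\<exists>a\<in>insert b S. g a t \<noteq> 0" for t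
  proof (cases "g b t = 0")
    case True
    then show ?thesis using \<kappa>(2) t by auto
  next
    case False
    have "c \<noteq> - (\<Sum>a\<in>S. \<kappa> a * g a t) / g b t" using c t(1) by (auto simp: bad_def)
    then show ?thesis using False by (simp add: field_simps eq_neg_iff_add_eq_0)
  qed
  moreover have "\<forall>a\<in>insert b S. (\<kappa>(b := c)) a \<noteq> 0" using \<kappa>(1) c by (auto simp: bad_def)
  ultimately show ?case using sums by (intro exI[of _ "\<kappa>(b := c)"]) metis
qed

text \<open>The \<open>c\<close> for which \<open>s\<close> may be shifted by every multiple of
  \<open>c\<close> form an ideal: moves compose, and factors are absorbed into \<open>h\<close>. If
  it were proper it would have a zero \<open>x\<close>. Over \<open>x\<close> the monic entry has
  finitely many roots, and unimodularity lets a generic combination \<open>G\<close> of the other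
  entries avoid them. So \<open>F i\<close> and \<open>G\<close> are coprime over \<open>x\<close>,
  and elimination plus Suslin's move put into the ideal a \<open>c\<close> that does not vanish at
  \<open>x\<close>.\<close>

lemma monic_column_constant:
  fixes F :: "'i \<Rightarrow> ('n::finite, 'k::field_char_0) mpoly poly"
  assumes ac: "alg_closed TYPE('k)" and I: "finite I" "i \<in> I" "j \<in> I" "i \<noteq> j" and supp: "supp_in I F"
    and unimod: "(\<Sum>a\<in>I. U a * F a) = 1" and monic: "lead_coeff (F i) = 1"
  shows "col_equiv I (\<lambda>a. poly (F a) s) (\<lambda>a. poly (F a) s')"
proof -
  define J where "J = {c. \<forall>s h. col_equiv I (\<lambda>a. poly (F a) s) (\<lambda>a. poly (F a) (s + c * h))}"
  have J: "is_ideal J"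
    unfolding is_ideal_def
  proof (intro conjI ballI allI)
    show "0 \<in> J" by (simp add: J_def col_equiv_refl)
    fix x y assume xy: "x \<in> J" "y \<in> J"
    have "col_equiv I (\<lambda>a. poly (F a) s) (\<lambda>a. poly (F a) (s + x * h + y * h))" for s h
      using xy unfolding J_def by (blast intro: col_equiv_trans)
    then show "x + y \<in> J" by (simp add: J_def algebra_simps)
  next
    fix x b assume "x \<in> J"
    then have "col_equiv I (\<lambda>a. poly (F a) s) (\<lambda>a. poly (F a) (s + x * (b * h)))" for s h
      unfolding J_def by blast
    then show "b * x \<in> J" by (simp add: J_def mult_ac)
  qed
  have "1 \<in> J"
  proof (rule ccontr)
    assume "1 \<notin> J"
    then obtain x where x: "\<And>c. c \<in> J \<Longrightarrow> ev x c = 0" using nullstellensatz[OF ac J] by blast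
    interpret m: rhom "map_poly (ev x)" by (rule rhom_map_poly[OF rhom_ev])
    let ?m = "map_poly (ev x)"
    have "coeff (?m (F i)) (degree (F i)) = 1"
      using monic by (simp add: coeff_map_poly rhom.hs[OF rhom_ev])
    then have nz: "?m (F i) \<noteq> 0" by auto
    define Z where "Z = {t. poly (?m (F i)) t = 0}"
    have Z: "finite Z" unfolding Z_def using nz by (simp add: poly_roots_finite)
    define S where "S = I - {i}"
    have S: "finite S" "S \<subseteq> I" "j \<in> S" using I by (auto simp: S_def)
    obtain \<kappa> where \<kappa>: "\<forall>a\<in>S. \<kappa> a \<noteq> 0"
      "\<forall>t\<in>Z. (\<exists>a\<in>S. poly (?m (F a)) t \<noteq> 0) \<longrightarrow> (\<Sum>a\<in>S. \<kappa> a * poly (?m (F a)) t) \<noteq> 0"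
      using generic_combination[OF S(1) Z, of "\<lambda>a. poly (?m (F a))"] by blast
    define G where "G = (\<Sum>a\<in>S. [:cst (\<kappa> a):] * F a)"
    have mG: "?m G = (\<Sum>a\<in>S. [:\<kappa> a:] * ?m (F a))"
      by (simp add: G_def m.hs map_poly_pCons rhom.hs[OF rhom_ev] del: mult_pCons_left)
    have nonzero: "poly (?m G) t \<noteq> 0" if "poly (?m (F i)) t = 0" for t
    proof -
      have "(\<Sum>a\<in>I. poly (?m (U a)) t * poly (?m (F a)) t) = 1"
        using arg_cong[OF unimod, of "\<lambda>p. poly (?m p) t"] by (simp add: m.hs poly_sum)
      then have "(\<Sum>a\<in>S. poly (?m (U a)) t * poly (?m (F a)) t) = 1"
        using I that by (simp add: S_def sum.remove[of I i])
      then have "\<exists>a\<in>S. poly (?m (F a)) t \<noteq> 0"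
        by (metis (no_types, lifting) mult_zero_right sum.neutral zero_neq_one)
      then show ?thesis using \<kappa>(2) that by (simp add: mG poly_sum Z_def del: mult_pCons_left)
    qed
    define J' where "J' = {p. \<exists>u v. p = u * ?m (F i) + v * ?m G}"
    have J': "is_ideal J'" unfolding J'_def by (rule is_ideal_two_generators)
    have FJ: "?m (F i) \<in> J'" unfolding J'_def by (intro CollectI exI[of _ 1] exI[of _ 0]) simp
    have GJ: "?m G \<in> J'" unfolding J'_def by (intro CollectI exI[of _ 0] exI[of _ 1]) simp
    have "1 \<in> J'" using univariate_ideal_root[OF ac J' FJ nz] FJ GJ nonzero by metis
    then obtain u v where uv: "u * ?m (F i) + v * ?m G = 1" unfolding J'_def by force
    obtain c U' V' where c: "ev x c \<noteq> 0" "[:c:] = U' * F i + V' * G"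
      using elimination_avoiding_point[OF rhom_ev ev_cst monic uv] by blast
    \<comment> \<open>\<open>G\<close> replaces the entry \<open>j\<close> by an invertible move,
      because the coefficient of \<open>F j\<close> in \<open>G\<close> is a nonzero
      constant.\<close>
    define H where "H = F(j := G)"
    have cnz: "c \<noteq> 0" using c rhom.h_zero[OF rhom_ev] by metis
    have suppH: "supp_in I H" using supp I by (auto simp: H_def supp_in_def)
    have HF: "col_equiv I (\<lambda>a. poly (F a) t) (\<lambda>a. poly (H a) t)" for t
    proof -
      have "cst (\<kappa> j) * cst (inverse (\<kappa> j)) = (1 :: ('n, 'k) mpoly)"
        using \<kappa>(1) S(3) by (simp add: cst_mult[symmetric])
      from col_equiv_combination[OF S, where \<kappa> = "\<lambda>a. cst (\<kappa> a)", OF this, of "\<lambda>a. poly (F a) t"]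
      show ?thesis
        by (rule back_subst[of "col_equiv I _"]) (auto simp: H_def G_def poly_sum)
    qed
    have "col_equiv I (\<lambda>a. poly (H a) s) (\<lambda>a. poly (H a) (s + c * h))" for s h
    proof (rule suslin_move[OF I(2-4) _ _ suppH])
      show "[:c:] = U' * H i + V' * H j" using c(2) I(4) by (simp add: H_def)
      fix x y assume "c * x = c * y"
      then have "c * (x - y) = 0" by (simp add: algebra_simps)
      then show "x = y" using cnz by (simp add: mpoly_no_zero_divisors)
    qed
    then have "c \<in> J" unfolding J_def using HF col_equiv_trans col_equiv_sym by blast
    then show False using x c(1) by blast
  qed
  then have "col_equiv I (\<lambda>a. poly (F a) s) (\<lambda>a. poly (F a) (s + 1 * (s' - s)))"
    unfolding J_def by blast
  then show ?thesis by simp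
qed

text \<open>Along a suitable direction the column becomes a column of polynomials in
  \<open>t\<close> with a monic entry, so all its values are equivalent. The value at
  \<open>t = 0\<close> is the given column up to scaling one entry; another value is its projection
  along \<open>v\<close> onto \<open>x_i = 0\<close>, which has one variable fewer up to an
  automorphism. Suslin's move acts on two rows, hence the second index.\<close>

lemma suslin_aux:
  fixes f :: "'i \<Rightarrow> ('n::finite, 'k::field_char_0) mpoly"
  assumes ac: "alg_closed TYPE('k)" and I: "finite I" "i0 \<in> I" "\<And>b. b \<in> I \<Longrightarrow> \<exists>j\<in>I. j \<noteq> b"
    and "finite V" "supp_in I f" "(\<Sum>a\<in>I. u a * f a) = 1" "\<And>a. vars_in V (f a)"
  shows "col_equiv I f (unit_vec i0)"
  using assms(5-)
proof (induction V arbitrary: f u rule: finite_induct)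
  case empty
  have "\<exists>b\<in>I. f b \<noteq> 0" using empty(2) by (metis (no_types, lifting) mult_zero_right sum.neutral zero_neq_one)
  then obtain b where b: "b \<in> I" "f b \<noteq> 0" by blast
  obtain c where c: "f b = cst c" using vars_in_empty empty(3) by blast
  then have "f b * cst (inverse c) = 1" using b by (simp add: cst_mult[symmetric])
  then show ?case
    using col_equiv_unit_entry[OF b(1) _ empty(1)] col_equiv_unit_vec[OF b(1) I(2)] col_equiv_trans by blast
next
  case (insert i V)
  have "\<exists>b\<in>I. f b \<noteq> 0" using insert.prems(2) by (metis (no_types, lifting) mult_zero_right sum.neutral zero_neq_one)
  then obtain b where b: "b \<in> I" "f b \<noteq> 0" by blast
  obtain j where j: "j \<in> I" "b \<noteq> j" using I(3) b(1) by metis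
  obtain v c where v: "v i \<noteq> 0" "\<And>j. j \<notin> insert i V \<Longrightarrow> v j = 0" and c: "c \<noteq> 0" "lead_coeff (lshift v (f b)) = cst c"
    using lshift_unit_leading[OF b(2) insert.prems(3), of i] by blast
  have cc: "cst (inverse c) * cst c = (1 :: ('n, 'k) mpoly)" using c by (simp add: cst_mult[symmetric])
  define f' where "f' = f(b := cst (inverse c) * f b)"
  have ff': "col_equiv I f f'"
    using col_equiv_combination[of "{b}" I b "\<lambda>_. cst (inverse c)" "cst c" f] b cc by (simp add: f'_def)
  define F where "F a = lshift v (f' a)" for a
  have suppF: "supp_in I F" using insert.prems(1) b by (auto simp: supp_in_def F_def f'_def rhom.hs[OF rhom_lshift])
  have monic: "lead_coeff (F b) = 1"
    using lshift_normalized_monic[OF c] by (simp add: F_def f'_def)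
  have "(\<Sum>a\<in>I. (u(b := cst c * u b)) a * f' a) = (\<Sum>a\<in>I. u a * f a)"
  proof (rule sum.cong[OF refl])
    fix a assume "a \<in> I"
    have "cst c * u b * (cst (inverse c) * f b) = (cst (inverse c) * cst c) * (u b * f b)" by (simp add: mult_ac)
    then show "(u(b := cst c * u b)) a * f' a = u a * f a" by (auto simp: f'_def cc)
  qed
  then have um: "(\<Sum>a\<in>I. (u(b := cst c * u b)) a * f' a) = 1" using insert.prems(2) by simp
  have "(\<Sum>a\<in>I. lshift v ((u(b := cst c * u b)) a) * F a) = lshift v 1"
    unfolding um[symmetric] by (simp add: F_def rhom.hs[OF rhom_lshift] del: fun_upd_apply)
  then have unimod: "(\<Sum>a\<in>I. lshift v ((u(b := cst c * u b)) a) * F a) = 1" by (simp add: rhom.hs[OF rhom_lshift])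
  have F0: "poly (F a) 0 = f' a" for a
    unfolding F_def by (rule rhom_eqI[OF rhom_comp[OF rhom_poly rhom_lshift] rhom_id]) (auto simp: lshift_cst lshift_var)
  \<comment> \<open>At this value of \<open>t\<close> the point \<open>x + t v\<close> lies on the
    hyperplane \<open>x_i = 0\<close>.\<close>
  define s where "s = - (cst (inverse (v i)) * var i :: ('n, 'k) mpoly)"
  define r where "r = subst (\<lambda>j. if j = i then 0 else var j :: ('n, 'k) mpoly)"
  \<comment> \<open>The projected column still contains \<open>x_i\<close>. The shear
    \<open>\<alpha>\<close>, with inverse \<open>\<beta>\<close>, exhibits it as the image of
    \<open>r (f' a)\<close>, where \<open>r\<close> sets \<open>x_i\<close> to zero and the
    induction hypothesis applies.\<close>
  define \<alpha> where "\<alpha> = subst (\<lambda>j. if j = i then var i else var j - cst (v j / v i) * var i)"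
  define \<beta> where "\<beta> = subst (\<lambda>j. if j = i then var i else var j + cst (v j / v i) * var i)"
  have \<alpha>: "rhom \<alpha>" and \<beta>: "rhom \<beta>" and r: "rhom r" by (simp_all add: \<alpha>_def \<beta>_def r_def rhom_subst)
  have cstc: "\<alpha> (cst x) = cst x" "\<beta> (cst x) = cst x" "r (cst x) = cst x" for x by (simp_all add: \<alpha>_def \<beta>_def r_def)
  have \<alpha>v: "\<alpha> (var j) = (if j = i then var i else var j - cst (v j / v i) * var i)"
    and \<beta>v: "\<beta> (var j) = (if j = i then var i else var j + cst (v j / v i) * var i)"
    and rv: "r (var j) = (if j = i then 0 else var j)" for j
    by (simp_all add: \<alpha>_def \<beta>_def r_def)
  have inv1: "\<alpha> (\<beta> p) = p" for p
    by (rule rhom_eqI[OF rhom_comp[OF \<alpha> \<beta>] rhom_id]) (auto simp: cstc \<alpha>v \<beta>v rhom.hs[OF \<alpha>])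
  have inv2: "\<beta> (\<alpha> p) = p" for p
    by (rule rhom_eqI[OF rhom_comp[OF \<beta> \<alpha>] rhom_id]) (auto simp: cstc \<alpha>v \<beta>v rhom.hs[OF \<beta>])
  have sv: "var j + cst (v j) * s = (if j = i then 0 else var j - cst (v j / v i) * var i)" for j
  proof -
    have "cst (v j) * s = - (cst (v j / v i) * var i)"
      by (simp add: s_def divide_inverse cst_mult mult_ac)
    then show ?thesis using v(1) by auto
  qed
  have Fs: "poly (F a) s = \<alpha> (r (f' a))" for a
    unfolding F_def
  proof (rule rhom_eqI[OF rhom_comp[OF rhom_poly rhom_lshift] rhom_comp[OF \<alpha> r]])
    show "poly (lshift v (cst x)) s = \<alpha> (r (cst x))" for x
      by (simp add: lshift_cst cstc)
    show "poly (lshift v (var j)) s = \<alpha> (r (var j))" for j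
      using sv[of j] by (simp add: lshift_var rv \<alpha>v rhom.h_zero[OF \<alpha>] mult.commute[of s])
  qed
  have "col_equiv I (\<lambda>a. r (f' a)) (unit_vec i0)"
  proof (rule insert.IH)
    show "supp_in I (\<lambda>a. r (f' a))"
      using insert.prems(1) b by (auto simp: supp_in_def f'_def rhom.hs[OF r])
    show "(\<Sum>a\<in>I. r ((u(b := cst c * u b)) a) * r (f' a)) = 1"
      using arg_cong[OF um, of r] by (simp add: rhom.hs[OF r] del: fun_upd_apply)
    fix a
    have vf: "vars_in (insert i V) (f' a)"
      using insert.prems(3) by (auto simp: f'_def intro: vars_in_mult)
    have "r (f' a) = subst (\<lambda>j. if j \<in> V then var j else 0) (f' a)"
      unfolding r_def by (rule evh_cong_vars[OF vf]) (use insert.hyps in auto)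
    also have "vars_in V \<dots>" by (rule vars_in_subst) (auto simp: vars_in_var)
    finally show "vars_in V (r (f' a))" .
  qed
  from col_equiv_ring_automorphism[OF \<alpha> \<beta> inv1 inv2 this]
  have "col_equiv I (\<lambda>a. poly (F a) s) (\<lambda>a. \<alpha> (unit_vec i0 a))" by (simp add: Fs)
  moreover have "(\<lambda>a. \<alpha> (unit_vec i0 a)) = unit_vec i0" by (auto simp: unit_vec_def rhom.hs[OF \<alpha>])
  ultimately have "col_equiv I (\<lambda>a. poly (F a) s) (unit_vec i0)" by simp
  moreover have "col_equiv I (\<lambda>a. poly (F a) 0) (\<lambda>a. poly (F a) s)"
    by (rule monic_column_constant[OF ac I(1) b(1) j suppF unimod monic])
  ultimately have "col_equiv I (\<lambda>a. poly (F a) 0) (unit_vec i0)" using col_equiv_trans by blast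
  then show ?case unfolding F0 by (rule col_equiv_trans[OF ff'])
qed

theorem unimodular_column_equiv_unit_vec:
  fixes f :: "'i \<Rightarrow> ('n::finite, 'k::field_char_0) mpoly"
  assumes ac: "alg_closed TYPE('k)" and I: "finite I" "i0 \<in> I"
    and f: "supp_in I f" "(\<Sum>a\<in>I. u a * f a) = 1"
  shows "col_equiv I f (unit_vec i0)"
proof (cases "I = {i0}")
  case True
  then have "f i0 * u i0 = 1" using f(2) by (simp add: mult.commute)
  then show ?thesis by (rule col_equiv_unit_entry[OF I(2) _ f(1)])
next
  case False
  then obtain j where j: "j \<in> I" "j \<noteq> i0" using I(2) by auto
  have "\<exists>j\<in>I. j \<noteq> b" if "b \<in> I" for b using I(2) j by (cases "b = i0") auto
  from suslin_aux[OF ac I this finite f vars_in_UNIV] show ?thesis by simp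
qed

subsection \<open>Linear maps between function modules\<close>

lemma lin_add: "lin s s' P \<Longrightarrow> P (x + y) = P x + P y"
  and lin_scale: "lin s s' P \<Longrightarrow> P (s c x) = s' c (P x)"
  by (simp_all add: lin_def)

lemma lin_zero: "lin s s' P \<Longrightarrow> P 0 = 0"
  for P :: "'v::ab_group_add \<Rightarrow> 'w::ab_group_add"
  using lin_add[of s s' P 0 0] by simp

lemma lin_diff: "lin s s' P \<Longrightarrow> P (x - y) = P x - P y"
  for P :: "'v::ab_group_add \<Rightarrow> 'w::ab_group_add"
  using lin_add[of s s' P "x - y" y] by simp

lemma lin_uminus: "lin s s' P \<Longrightarrow> P (- y) = - P y"
  for P :: "'v::ab_group_add \<Rightarrow> 'w::ab_group_add"
  using lin_diff[of s s' P 0 y] by (simp add: lin_zero)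

lemma lin_sum: "lin s s' P \<Longrightarrow> P (sum f X) = (\<Sum>x\<in>X. P (f x))"
  for P :: "'v::ab_group_add \<Rightarrow> 'w::ab_group_add"
  by (induction X rule: infinite_finite_induct) (auto simp: lin_add lin_zero)

lemma sum_fun_apply: "(\<Sum>x\<in>X. f x) a = (\<Sum>x\<in>X. f x a)"
  for f :: "'x \<Rightarrow> 'i \<Rightarrow> 'a::comm_monoid_add"
  by (induction X rule: infinite_finite_induct) auto

lemma supp_in_sum_unit_vec:
  fixes v :: "'i \<Rightarrow> 'a::comm_ring_1"
  assumes "finite X" "supp_in X v"
  shows "v = (\<Sum>x\<in>X. scale (v x) (unit_vec x))"
proof
  fix a
  have "(\<Sum>x\<in>X. scale (v x) (unit_vec x)) a = (\<Sum>x\<in>X. if x = a then v x else 0)"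
    unfolding sum_fun_apply by (rule sum.cong) (auto simp: scale_def unit_vec_def)
  then show "v a = (\<Sum>x\<in>X. scale (v x) (unit_vec x)) a"
    using assms by (auto simp: supp_in_def)
qed

lemma lin_expand:
  fixes P :: "('i \<Rightarrow> 'a::comm_ring_1) \<Rightarrow> 'w::ab_group_add"
  assumes "lin scale s' P" "finite X" "supp_in X v"
  shows "P v = (\<Sum>x\<in>X. s' (v x) (P (unit_vec x)))"
proof -
  have "P v = P (\<Sum>x\<in>X. scale (v x) (unit_vec x))" using supp_in_sum_unit_vec[OF assms(2,3)] by simp
  also have "\<dots> = (\<Sum>x\<in>X. s' (v x) (P (unit_vec x)))"
    by (simp add: lin_sum[OF assms(1)] lin_scale[OF assms(1)])
  finally show ?thesis .
qed

lemma lin_eqI: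
  fixes P R :: "('i \<Rightarrow> 'a::comm_ring_1) \<Rightarrow> 'w::ab_group_add"
  assumes "lin scale s' P" "lin scale s' R" "finite X" "supp_in X v" "\<And>x. x \<in> X \<Longrightarrow> P (unit_vec x) = R (unit_vec x)"
  shows "P v = R v"
  using assms by (simp add: lin_expand[OF assms(1,3,4)] lin_expand[OF assms(2,3,4)])

lemma supp_in_unit_vec: "x \<in> X \<Longrightarrow> supp_in X (unit_vec x)"
  by (auto simp: supp_in_def unit_vec_def)

lemma supp_in_lins:
  "supp_in X 0" "supp_in X v \<Longrightarrow> supp_in X w \<Longrightarrow> supp_in X (v + w)"
  "supp_in X v \<Longrightarrow> supp_in X w \<Longrightarrow> supp_in X (v - w)" "supp_in X v \<Longrightarrow> supp_in X (- v)"
  "supp_in X v \<Longrightarrow> supp_in X (scale c v)"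
  for v w :: "'i \<Rightarrow> 'a::comm_ring_1"
  by (auto simp: supp_in_def scale_def)

lemma scale_simps:
  "scale c (v + w) = scale c v + scale c w" "scale (c + d) v = scale c v + scale d v"
  "scale (c * d) v = scale c (scale d v)" "scale 1 v = v" "scale 0 v = 0" "scale c 0 = 0"
  "scale c (v - w) = scale c v - scale c w" "scale c (- v) = - scale c v"
  by (auto simp: scale_def fun_eq_iff algebra_simps)

definition lincomb :: "('r \<Rightarrow> 'w \<Rightarrow> 'w::comm_monoid_add) \<Rightarrow> 'i set \<Rightarrow> ('i \<Rightarrow> 'w) \<Rightarrow> ('i \<Rightarrow> 'r) \<Rightarrow> 'w" where
  "lincomb s X y v = (\<Sum>x\<in>X. s (v x) (y x))"

lemma lin_lincomb:
  assumes "module s"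
  shows "lin scale s (lincomb s X y)"
proof -
  interpret module s by fact
  show ?thesis
    by (auto simp: lin_def lincomb_def scale_left_distrib sum.distrib scale_def scale_sum_right)
qed

lemma lincomb_unit_vec:
  assumes "module s" "finite X" "x \<in> X"
  shows "lincomb s X y (unit_vec x) = y x"
proof -
  interpret module s by fact
  have "lincomb s X y (unit_vec x) = (\<Sum>a\<in>X. if a = x then y a else 0)"
    unfolding lincomb_def by (rule sum.cong) (auto simp: unit_vec_def)
  then show ?thesis using assms by simp
qed

lemma module_scale: "module (scale :: 'a::comm_ring_1 \<Rightarrow> ('i \<Rightarrow> 'a) \<Rightarrow> _)"
  by unfold_locales (auto simp: scale_def fun_eq_iff algebra_simps)

subsection \<open>Base change of matrices\<close>

definition base_change :: "('a::comm_ring_1 \<Rightarrow> 'b::comm_ring_1) \<Rightarrow> 'x set \<Rightarrow> (('x \<Rightarrow> 'a) \<Rightarrow> ('y \<Rightarrow> 'a)) \<Rightarrow> ('x \<Rightarrow> 'b) \<Rightarrow> ('y \<Rightarrow> 'b)" where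
  "base_change h X P u = (\<lambda>y. \<Sum>x\<in>X. u x * h (P (unit_vec x) y))"

lemma lin_base_change: "lin scale scale (base_change h X P)"
  by (auto simp: lin_def base_change_def scale_def fun_eq_iff algebra_simps sum.distrib sum_distrib_left)

lemma base_change_comp:
  assumes h: "rhom h" and P: "lin scale scale P" and "finite Z" "\<And>x. supp_in Z (R (unit_vec x))"
  shows "base_change h Z P (base_change h X R u) = base_change h X (\<lambda>v. P (R v)) u"
proof
  fix y
  interpret rhom h by (rule h)
  have 1: "h (P (R (unit_vec x)) y) = (\<Sum>z\<in>Z. h (R (unit_vec x) z) * h (P (unit_vec z) y))" for x
    by (subst lin_expand[OF P assms(3,4)]) (simp add: sum_fun_apply scale_def hs)
  show "base_change h Z P (base_change h X R u) y = base_change h X (\<lambda>v. P (R v)) u y"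
    unfolding base_change_def 1 sum_distrib_left sum_distrib_right
    by (subst sum.swap) (simp add: mult.assoc)
qed

lemma base_change_scaled:
  assumes "rhom h" and "\<And>x. x \<in> X \<Longrightarrow> P (unit_vec x) = scale c (R (unit_vec x))"
  shows "base_change h X P u = scale (h c) (base_change h X R u)"
  using assms by (auto simp: base_change_def scale_def rhom.hs sum_distrib_left mult_ac)

lemma base_change_ident:
  assumes h: "rhom h" and "finite X" "supp_in X u"
  shows "base_change h X (\<lambda>v. v) u = u"
proof
  fix y
  interpret rhom h by (rule h)
  have "base_change h X (\<lambda>v. v) u y = (\<Sum>x\<in>X. if x = y then u x else 0)"
    unfolding base_change_def by (rule sum.cong) (auto simp: unit_vec_def hs)
  then show "base_change h X (\<lambda>v. v) u y = u y" using assms by (auto simp: supp_in_def)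
qed

lemma supp_in_base_change:
  assumes "rhom h" "\<And>x. supp_in Y (P (unit_vec x))"
  shows "supp_in Y (base_change h X P u)"
  using assms by (auto simp: supp_in_def base_change_def rhom.hs)

definition at0 :: "('x \<Rightarrow> 'a::comm_ring_1 poly) \<Rightarrow> 'x \<Rightarrow> 'a" where
  "at0 u = (\<lambda>x. poly (u x) 0)"

definition spec :: "(('x \<Rightarrow> 'a::comm_ring_1 poly) \<Rightarrow> ('y \<Rightarrow> 'a poly)) \<Rightarrow> ('x \<Rightarrow> 'a) \<Rightarrow> ('y \<Rightarrow> 'a)" where
  "spec P v = at0 (P (\<lambda>x. [:v x:]))"

text \<open>\<open>u - u(0)\<close> is \<open>t\<close> times a vector; a linear map keeps the
  factor \<open>t\<close>, and \<open>at0\<close> kills it.\<close>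

lemma spec_at0:
  assumes P: "lin scale scale P"
  shows "spec P (at0 u) = at0 (P u)"
proof -
  have "\<exists>w. u x = [:poly (u x) 0:] + [:0, 1:] * w" for x
    by (cases "u x") (auto intro: exI[of _ 0])
  then obtain w where w: "\<And>x. u x = [:poly (u x) 0:] + [:0, 1:] * w x" by metis
  have "u = (\<lambda>x. [:poly (u x) 0:]) + scale [:0, 1:] w"
    using w by (auto simp: scale_def fun_eq_iff)
  then have "P u = P (\<lambda>x. [:poly (u x) 0:]) + scale [:0, 1:] (P w)"
    by (metis lin_add[OF P] lin_scale[OF P])
  then show ?thesis by (simp add: spec_def at0_def scale_def fun_eq_iff)
qed

lemma at0_const: "at0 (\<lambda>x. [:v x:]) = v"
  by (simp add: at0_def)

lemma at0_simps: "at0 (u + w) = at0 u + at0 w" "at0 0 = 0"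
  by (auto simp: at0_def)

lemma lin_spec:
  fixes P :: "('x \<Rightarrow> 'a::comm_ring_1 poly) \<Rightarrow> ('y \<Rightarrow> 'a poly)"
  assumes "lin scale scale P"
  shows "lin scale scale (spec P)"
proof -
  have "(\<lambda>x. [:(v + w) x:]) = (\<lambda>x. [:v x:]) + (\<lambda>x. [:w x:])" for v w :: "'x \<Rightarrow> 'a" by auto
  moreover have "(\<lambda>x. [:scale c v x:]) = scale [:c:] (\<lambda>x. [:v x:])" for c and v :: "'x \<Rightarrow> 'a" by (auto simp: scale_def)
  ultimately show ?thesis
    unfolding lin_def spec_def
    by (simp only: lin_add[OF assms] lin_scale[OF assms]) (auto simp: at0_def scale_def)
qed

lemma supp_in_const: "supp_in X v \<Longrightarrow> supp_in X (\<lambda>x. [:v x:])"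
  and supp_in_at0: "supp_in X u \<Longrightarrow> supp_in X (at0 u)"
  by (auto simp: supp_in_def at0_def)

lemma spec_base_change:
  assumes P: "lin scale scale P" and "finite X" "supp_in X v" and h: "\<And>p. poly (h p) 0 = p"
  shows "spec (base_change h X P) v = P v"
  by (rule ext) (simp add: spec_def at0_def base_change_def poly_sum h lin_expand[OF P assms(2,3)] sum_fun_apply scale_def)

subsection \<open>Stably free modules are free\<close>

text \<open>An isomorphism \<open>M \<oplus> A\<^sup>Q \<cong> A\<^sup>I\<close>, given by its components and those of its inverse.\<close>

definition stably_free :: "('a::comm_ring_1 \<Rightarrow> 'm::ab_group_add \<Rightarrow> 'm) \<Rightarrow> 'i set \<Rightarrow> 'q set \<Rightarrow> bool" where
  "stably_free smul I Q \<longleftrightarrow> (\<exists>W L K T. lin scale smul W \<and> lin smul scale L \<and> lin scale scale K \<and> lin scale scale T \<and>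
     (\<forall>m. supp_in I (L m)) \<and> (\<forall>v. supp_in Q v \<longrightarrow> supp_in I (K v)) \<and> (\<forall>v. supp_in Q (T v)) \<and>
     (\<forall>m. W (L m) = m) \<and> (\<forall>q. supp_in Q q \<longrightarrow> W (K q) = 0) \<and> (\<forall>q. supp_in Q q \<longrightarrow> T (K q) = q) \<and>
     (\<forall>v. supp_in I v \<longrightarrow> L (W v) + K (T v) = v) \<and> (\<forall>m. T (L m) = 0))"

definition erase :: "'i \<Rightarrow> ('i \<Rightarrow> 'a::comm_ring_1) \<Rightarrow> 'i \<Rightarrow> 'a" where
  "erase a v = v(a := 0)"

lemma erase_eq: "erase a v = v - scale (v a) (unit_vec a)"
  by (auto simp: erase_def scale_def unit_vec_def fun_eq_iff)

lemma lin_erase: "lin scale scale (erase a)"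
  by (auto simp: lin_def erase_def scale_def)

lemma supp_in_erase: "supp_in (insert a X) v \<Longrightarrow> supp_in X (erase a v)"
  by (auto simp: supp_in_def erase_def)

text \<open>The image \<open>f\<close> of the basis vector \<open>b\<close> is unimodular, because a
  coordinate of \<open>T\<close> takes the value \<open>1\<close> on it. An automorphism carries
  \<open>f\<close> to a unit vector \<open>a\<close>, and dividing by \<open>f\<close> becomes
  forgetting the coordinate \<open>a\<close>.\<close>

lemma stably_free_cancel:
  fixes smul :: "('n::finite, 'k::field_char_0) mpoly \<Rightarrow> 'm::ab_group_add \<Rightarrow> 'm"
  assumes ac: "alg_closed TYPE('k)" and md: "module smul" and I: "finite I" and bQ: "b \<notin> Q"
    and sf: "stably_free smul I (insert b Q)"
  shows "\<exists>a\<in>I. stably_free smul (I - {a}) Q"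
proof -
  obtain W L K T where lins: "lin scale smul W" "lin smul scale L" "lin scale scale K" "lin scale scale T"
    and supp: "\<And>m. supp_in I (L m)" "\<And>v. supp_in (insert b Q) v \<Longrightarrow> supp_in I (K v)" "\<And>v. supp_in (insert b Q) (T v)"
    and WL: "\<And>m. W (L m) = m" and WK: "\<And>q. supp_in (insert b Q) q \<Longrightarrow> W (K q) = 0"
    and TK: "\<And>q. supp_in (insert b Q) q \<Longrightarrow> T (K q) = q"
    and LW: "\<And>v. supp_in I v \<Longrightarrow> L (W v) + K (T v) = v" and TL: "\<And>m. T (L m) = 0"
    using sf unfolding stably_free_def by blast
  interpret module smul by (rule md)
  define f where "f = K (unit_vec b)"
  have eb: "supp_in (insert b Q) (unit_vec b :: _ \<Rightarrow> ('n, 'k) mpoly)" by (simp add: supp_in_unit_vec)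
  have Wf: "W f = 0" and Tf: "T f = unit_vec b" using WK[OF eb] TK[OF eb] by (simp_all add: f_def)
  have "T f b = (\<Sum>x\<in>I. f x * T (unit_vec x) b)"
    using lin_expand[OF lins(4) I supp(2)[OF eb]] by (simp add: f_def sum_fun_apply scale_def)
  then have um: "(\<Sum>x\<in>I. T (unit_vec x) b * f x) = 1" by (simp add: Tf unit_vec_def mult.commute)
  then have "I \<noteq> {}" by auto
  then obtain a where a: "a \<in> I" by blast
  have "col_equiv I f (unit_vec a)"
    by (rule unimodular_column_equiv_unit_vec[OF ac I a _ um]) (simp add: f_def supp eb)
  then obtain P R where PR: "automorphism_pair I P R" and Pf: "P f = unit_vec a"
    unfolding col_equiv_def by blast
  have linP: "lin scale scale P" and linR: "lin scale scale R" and PRv: "\<And>v. P (R v) = v" and RPv: "\<And>v. R (P v) = v"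
    and suppP: "\<And>v. supp_in I v \<Longrightarrow> supp_in I (P v)" and suppR: "\<And>v. supp_in I v \<Longrightarrow> supp_in I (R v)"
    using PR unfolding automorphism_pair_def by blast+
  have Ra: "R (unit_vec a) = f" using RPv[of f] Pf by simp
  \<comment> \<open>In the old coordinates erasing \<open>a\<close> subtracts a multiple of
    \<open>f\<close>, which is invisible to \<open>W\<close> and, after erasing \<open>b\<close>, to
    \<open>T\<close>.\<close>
  have Re: "R (erase a v) = R v - scale (v a) f" for v
    by (simp add: erase_eq lin_diff[OF linR] lin_scale[OF linR] Ra)
  have WRe: "W (R (erase a v)) = W (R v)" for v
    by (simp add: Re lin_diff[OF lins(1)] lin_scale[OF lins(1)] Wf)
  have TRe: "erase b (T (R (erase a v))) = erase b (T (R v))" for v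
  proof -
    have "T (R (erase a v)) = T (R v) - scale (v a) (unit_vec b)"
      by (simp add: Re lin_diff[OF lins(4)] lin_scale[OF lins(4)] Tf)
    then show ?thesis by (auto simp: erase_def scale_def unit_vec_def)
  qed
  have I': "insert a (I - {a}) = I" using a by auto
  have sub: "supp_in I v" if "supp_in (I - {a}) v" for v :: "_ \<Rightarrow> ('n, 'k) mpoly"
    using that by (auto simp: supp_in_def)
  have subQ: "supp_in (insert b Q) v" if "supp_in Q v" for v :: "_ \<Rightarrow> ('n, 'k) mpoly"
    using that by (auto simp: supp_in_def)
  have "stably_free smul (I - {a}) Q"
    unfolding stably_free_def
  proof (intro exI conjI allI impI)
    show "lin scale smul (\<lambda>v. W (R v))" by (rule lin_comp[OF linR lins(1)])
    show "lin smul scale (\<lambda>m. erase a (P (L m)))"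
      by (rule lin_comp[OF lin_comp[OF lins(2) linP] lin_erase])
    show "lin scale scale (\<lambda>v. erase a (P (K (v))))"
      by (rule lin_comp[OF lin_comp[OF lins(3) linP] lin_erase])
    show "lin scale scale (\<lambda>v. erase b (T (R v)))"
      by (rule lin_comp[OF lin_comp[OF linR lins(4)] lin_erase])
    show "supp_in (I - {a}) (erase a (P (L m)))" for m
      by (rule supp_in_erase, unfold I', intro suppP supp)
    show "supp_in (I - {a}) (erase a (P (K v)))" if "supp_in Q v" for v
      by (rule supp_in_erase, unfold I', intro suppP supp subQ that)
    show "supp_in Q (erase b (T (R v)))" for v
      by (rule supp_in_erase) (rule supp)
    show "W (R (erase a (P (L m)))) = m" for m by (simp add: WRe RPv WL)
    show "W (R (erase a (P (K q)))) = 0" if "supp_in Q q" for q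
      by (simp add: WRe RPv WK subQ that)
    show "erase b (T (R (erase a (P (K q))))) = q" if q: "supp_in Q q" for q
    proof -
      have "erase b (T (R (erase a (P (K q))))) = erase b q" by (simp add: TRe RPv TK subQ q)
      then show ?thesis using q bQ by (auto simp: erase_def supp_in_def)
    qed
    show "erase b (T (R (erase a (P (L m))))) = 0" for m
      by (simp add: TRe RPv TL lin_zero[OF lin_erase])
    fix v :: "_ \<Rightarrow> ('n, 'k) mpoly" assume v: "supp_in (I - {a}) v"
    \<comment> \<open>Conversely, erasing \<open>b\<close> changes the value of \<open>K\<close> by
      a multiple of \<open>f\<close>, which \<open>P\<close> moves to the coordinate
      \<open>a\<close> where it is erased.\<close>
    have "K (erase b (T (R v))) = K (T (R v)) - scale (T (R v) b) f"
      by (simp add: erase_eq lin_diff[OF lins(3)] lin_scale[OF lins(3)] f_def)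
    then have "erase a (P (K (erase b (T (R v))))) = erase a (P (K (T (R v))))"
      by (simp add: lin_diff[OF linP] lin_scale[OF linP] Pf lin_diff[OF lin_erase] lin_scale[OF lin_erase])
        (auto simp: erase_def unit_vec_def scale_def)
    then have "erase a (P (L (W (R v)))) + erase a (P (K (erase b (T (R v))))) = erase a (P (L (W (R v)) + K (T (R v))))"
      by (simp add: lin_add[OF linP] lin_add[OF lin_erase])
    also have "\<dots> = erase a v" by (simp add: LW[OF suppR[OF sub[OF v]]] PRv)
    also have "\<dots> = v" using v by (auto simp: erase_def supp_in_def)
    finally show "erase a (P (L (W (R v)))) + erase a (P (K (erase b (T (R v))))) = v" .
  qed
  then show ?thesis using a by blast
qed

lemma stably_free_imp_free:
  fixes smul :: "('n::finite, 'k::field_char_0) mpoly \<Rightarrow> 'm::ab_group_add \<Rightarrow> 'm" and Q :: "'q set" and I :: "'i set"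
  assumes ac: "alg_closed TYPE('k)" and md: "module smul" and "finite Q" "finite I"
    and "stably_free smul I Q"
  shows "\<exists>I' W L. finite I' \<and> I' \<subseteq> I \<and> lin scale smul W \<and> lin smul scale L \<and> (\<forall>m. supp_in I' (L m)) \<and>
    (\<forall>m. W (L m) = m) \<and> (\<forall>v. supp_in I' v \<longrightarrow> L (W v) = v)"
  using assms(3-)
proof (induction Q arbitrary: I rule: finite_induct)
  case empty
  then obtain W L and K :: "('q \<Rightarrow> ('n, 'k) mpoly) \<Rightarrow> 'i \<Rightarrow> ('n, 'k) mpoly" and T :: "_ \<Rightarrow> 'q \<Rightarrow> ('n, 'k) mpoly"
    where *: "lin scale smul W" "lin smul scale L" "lin scale scale K"
    "\<forall>m. supp_in I (L m)" "\<forall>v. supp_in {} (T v)" "\<forall>m. W (L m) = m" "\<forall>v. supp_in I v \<longrightarrow> L (W v) + K (T v) = v"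
    unfolding stably_free_def by blast
  have "T v = 0" for v using *(5) by (auto simp: supp_in_def fun_eq_iff)
  then have "\<forall>v. supp_in I v \<longrightarrow> L (W v) = v" using * by (simp add: lin_zero[OF *(3)])
  then show ?case
    using * empty(1) by (intro exI[of _ I] exI[of _ W] exI[of _ L]) simp
next
  case (insert b Q)
  then obtain a where a: "a \<in> I" "stably_free smul (I - {a}) Q"
    using stably_free_cancel[OF ac md insert.prems(1) insert.hyps(2)] by blast
  have "finite (I - {a})" using insert.prems(1) by simp
  from insert.IH[OF this a(2)] show ?case
    by (elim exE conjE) (intro exI conjI; (assumption | blast))
qed

subsection \<open>Images of idempotents that are free up to a monic polynomial\<close>

text \<open>The image \<open>S\<close> of \<open>E\<close> contains a free module \<open>im C\<close> that contains \<open>F S\<close>. As \<open>F\<close> is monic, \<open>N = S / im C\<close> is a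
  finite module over the coefficient ring, projective there because \<open>S\<close> and \<open>im C\<close> are, and \<open>S\<close> is
  resolved by the characteristic sequence of multiplication by \<open>t\<close> on \<open>N\<close>. Here \<open>N\<close> is realized inside \<open>S\<close>
  as the image of the remainder map \<open>red\<close>.\<close>

locale monic_torsion_quotient =
  fixes J :: "'j set" and I0 :: "'e set" and F :: "'b::comm_ring_1 poly"
    and E :: "('j \<Rightarrow> 'b poly) \<Rightarrow> ('j \<Rightarrow> 'b poly)" and C :: "('e \<Rightarrow> 'b poly) \<Rightarrow> ('j \<Rightarrow> 'b poly)"
    and \<mu> :: "('j \<Rightarrow> 'b poly) \<Rightarrow> ('e \<Rightarrow> 'b poly)"
  assumes finJ: "finite J" and finI0: "finite I0" and monic: "lead_coeff F = 1"
    and linE: "lin scale scale E" and linC: "lin scale scale C" and lin\<mu>: "lin scale scale \<mu>"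
    and EE: "E (E v) = E v" and EC: "E (C a) = C a"
    and \<mu>C: "supp_in I0 a \<Longrightarrow> \<mu> (C a) = scale F a" and C\<mu>: "C (\<mu> v) = scale F (E v)"
    and supp\<mu>: "supp_in I0 (\<mu> v)" and suppE: "supp_in J (E v)"
begin

abbreviation e :: nat where "e \<equiv> degree F"

text \<open>Quotients and remainders modulo \<open>F\<close> are linear only over the coefficient
  ring, so scalars are restricted to constants.\<close>

abbreviation bscale :: "'b \<Rightarrow> ('x \<Rightarrow> 'b poly) \<Rightarrow> ('x \<Rightarrow> 'b poly)" where
  "bscale b \<equiv> scale [:b:]"

definition quo :: "('x \<Rightarrow> 'b poly) \<Rightarrow> ('x \<Rightarrow> 'b poly)" where
  "quo v = (\<lambda>i. mdiv F (v i))"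

lemma mdiv_0: "mdiv F 0 = 0"
  using mdivmod_unique[OF monic, of 0 0 0] by auto

lemma lin_quo: "lin bscale bscale quo"
  by (auto simp: lin_def quo_def scale_def mdiv_add[OF monic] mdiv_smult[OF monic])

lemma quo_scale: "quo (scale F a) = a"
  by (simp add: quo_def scale_def mdiv_mult[OF monic])

lemma supp_quo: "supp_in X v \<Longrightarrow> supp_in X (quo v)"
  by (simp add: supp_in_def quo_def mdiv_0)

lemma lin_const: "lin scale scale P \<Longrightarrow> lin bscale bscale P"
  by (simp add: lin_def)

text \<open>On vectors supported in \<open>I0\<close>, \<open>\<mu>\<close> after \<open>C\<close>
  is multiplication by \<open>F\<close>. Hence \<open>C\<close> after \<open>quo\<close> after
  \<open>\<mu>\<close> is a projection onto \<open>im C\<close>, linear over constants, and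
  \<open>red\<close> is the complementary one.\<close>

definition red :: "('j \<Rightarrow> 'b poly) \<Rightarrow> ('j \<Rightarrow> 'b poly)" where
  "red v = v - C (quo (\<mu> v))"

lemma lin_red: "lin bscale bscale red"
  using lin_comp[OF lin_comp[OF lin_const[OF lin\<mu>] lin_quo] lin_const[OF linC]]
  by (auto simp: lin_def red_def scale_simps)

lemma red_C: "supp_in I0 a \<Longrightarrow> red (C a) = 0"
  by (simp add: red_def \<mu>C quo_scale)

lemma E_red: "E v = v \<Longrightarrow> E (red v) = red v"
  by (simp add: red_def lin_diff[OF linE] EC)

lemma red_red: "red (red v) = red v"
proof -
  have "red (red v) = red v - red (C (quo (\<mu> v)))"
    using lin_diff[OF lin_red] by (simp add: red_def[of v])
  then show ?thesis by (simp add: red_C supp_quo supp\<mu>)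
qed

lemma red_scale: "E v = v \<Longrightarrow> red (scale F v) = 0"
  using C\<mu>[of v] red_C[OF supp\<mu>[of v]] by simp

text \<open>Multiples of \<open>F\<close> by elements of the image of \<open>E\<close> vanish under
  \<open>red\<close>, so powers of \<open>t\<close> below the degree of \<open>F\<close> suffice to
  generate \<open>N\<close> over the constants.\<close>

definition gen :: "'j \<times> nat \<Rightarrow> ('j \<Rightarrow> 'b poly)" where
  "gen = (\<lambda>(j, l). red (scale (monom 1 l) (E (unit_vec j))))"

definition Q :: "('j \<times> nat) set" where
  "Q = J \<times> {..<e}"

lemma finQ: "finite Q"
  by (simp add: Q_def finJ)

definition Y :: "('j \<times> nat \<Rightarrow> 'b poly) \<Rightarrow> ('j \<Rightarrow> 'b poly)" where
  "Y = lincomb scale Q gen"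

definition cv :: "('x \<Rightarrow> 'b) \<Rightarrow> ('x \<Rightarrow> 'b poly)" where
  "cv p = (\<lambda>x. [:p x:])"

definition coords :: "('j \<Rightarrow> 'b poly) \<Rightarrow> ('j \<times> nat \<Rightarrow> 'b)" where
  "coords v = (\<lambda>(j, l). if j \<in> J \<and> l < e then coeff (mmod F (v j)) l else 0)"

lemma lin_coords: "lin bscale scale coords"
  by (auto simp: lin_def coords_def scale_def mmod_add[OF monic] mmod_smult[OF monic] fun_eq_iff)

lemma supp_coords: "supp_in Q (coords v)"
  by (auto simp: supp_in_def coords_def Q_def)

lemma linY: "lin scale scale Y"
  unfolding Y_def by (rule lin_lincomb[OF module_scale])

lemma lin_cv: "lin scale bscale cv"
  by (auto simp: lin_def cv_def scale_def fun_eq_iff)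

lemma lin_Ycv: "lin scale bscale (\<lambda>p. Y (cv p))"
  by (rule lin_comp[OF lin_cv lin_const[OF linY]])

lemma E_gen: "E (gen q) = gen q"
  by (cases q) (auto simp: gen_def intro!: E_red simp: lin_scale[OF linE] EE)

lemma red_gen: "red (gen q) = gen q"
  by (cases q) (auto simp: gen_def red_red)

lemma E_Y: "E (Y P) = Y P"
  by (simp add: Y_def lincomb_def lin_sum[OF linE] lin_scale[OF linE] E_gen)

lemma red_Ycv: "red (Y (cv p)) = Y (cv p)"
  by (simp add: Y_def lincomb_def cv_def lin_sum[OF lin_red] lin_scale[OF lin_red] red_gen)

text \<open>Each coordinate is divided by \<open>F\<close>; \<open>red\<close> kills the quotient
  part and the remainders are the coordinates. On \<open>N\<close> this is a section of the
  generators, which is why \<open>N\<close> is projective over the constants.\<close>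

lemma Y_coords:
  assumes v: "E v = v"
  shows "Y (cv (coords v)) = red v"
proof -
  have sv: "supp_in J v" using suppE[of v] v by simp
  have dec: "scale (v j) (E (unit_vec j)) = scale F (scale (mdiv F (v j)) (E (unit_vec j)))
     + (\<Sum>l<e. bscale (coeff (mmod F (v j)) l) (scale (monom 1 l) (E (unit_vec j))))" for j
  proof -
    have "mmod F (v j) = (\<Sum>l<e. monom (coeff (mmod F (v j)) l) l)"
      by (rule poly_eqI) (auto simp: coeff_sum coeff_mmod[OF monic] not_less)
    then have "scale (mmod F (v j)) w = (\<Sum>l<e. bscale (coeff (mmod F (v j)) l) (scale (monom 1 l) w))" for w :: "'j \<Rightarrow> 'b poly"
      by (auto simp: scale_def fun_eq_iff sum_fun_apply sum_distrib_right[symmetric] smult_monom mult_smult_left[symmetric] simp del: mult_smult_left)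
    moreover have "scale (v j) w = scale F (scale (mdiv F (v j)) w) + scale (mmod F (v j)) w" for w :: "'j \<Rightarrow> 'b poly"
      using mdivmod[OF monic, of "v j"] by (metis scale_simps(2) scale_simps(3))
    ultimately show ?thesis by simp
  qed
  have r1: "red (scale F (scale c (E (unit_vec j)))) = 0" for c j
    by (rule red_scale) (simp add: lin_scale[OF linE] EE)
  have "red v = red (\<Sum>j\<in>J. scale (v j) (E (unit_vec j)))"
    using lin_expand[OF linE finJ sv] v by simp
  also have "\<dots> = (\<Sum>j\<in>J. \<Sum>l<e. bscale (coeff (mmod F (v j)) l) (gen (j, l)))"
    by (simp add: lin_sum[OF lin_red] dec lin_add[OF lin_red] r1 lin_scale[OF lin_red] gen_def)
  also have "\<dots> = (\<Sum>q\<in>Q. bscale (coords v q) (gen q))"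
    unfolding Q_def sum.cartesian_product by (rule sum.cong) (auto simp: coords_def)
  finally show ?thesis by (simp add: Y_def lincomb_def cv_def)
qed

definition tt :: "'b poly" where "tt = [:0, 1:]"

text \<open>The idempotent matrix over the constants whose image is a copy of \<open>N\<close>.
  Below, \<open>tmul\<close> is multiplication by \<open>t\<close> on \<open>N\<close>, transported
  to that copy.\<close>

definition idem :: "('j \<times> nat \<Rightarrow> 'b) \<Rightarrow> ('j \<times> nat \<Rightarrow> 'b)" where
  "idem p = coords (Y (cv p))"

definition tmul :: "('j \<times> nat \<Rightarrow> 'b) \<Rightarrow> ('j \<times> nat \<Rightarrow> 'b)" where
  "tmul p = coords (red (scale tt (Y (cv p))))"

lemma lin_scale_tt: "lin bscale bscale (scale tt)"
  by (auto simp: lin_def scale_def fun_eq_iff algebra_simps)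

lemma lin_idem: "lin scale scale idem"
  unfolding idem_def by (rule lin_comp[OF lin_Ycv lin_coords])

lemma lin_tmul: "lin scale scale tmul"
  unfolding tmul_def by (rule lin_comp[OF lin_comp[OF lin_comp[OF lin_Ycv lin_scale_tt] lin_red] lin_coords])

lemma Y_idem: "Y (cv (idem p)) = Y (cv p)"
  by (simp add: idem_def Y_coords[OF E_Y] red_Ycv)

lemma Y_tmul: "Y (cv (tmul p)) = red (scale tt (Y (cv p)))"
proof -
  have "E (red (scale tt (Y (cv p)))) = red (scale tt (Y (cv p)))"
    by (rule E_red) (simp add: lin_scale[OF linE] E_Y)
  then show ?thesis by (simp add: tmul_def Y_coords red_red)
qed

lemma idem_idem: "idem (idem p) = idem p" and tmul_idem: "tmul (idem p) = tmul p"
  by (simp_all add: idem_def[of "idem p"] tmul_def Y_idem) (simp add: idem_def)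

lemma idem_tmul: "idem (tmul p) = tmul p"
  by (simp add: idem_def Y_tmul) (simp add: tmul_def)

lemma supp_idem: "supp_in Q (idem p)" and supp_tmul: "supp_in Q (tmul p)"
  by (simp_all add: idem_def tmul_def supp_coords)

definition ext :: "(('j \<times> nat \<Rightarrow> 'b) \<Rightarrow> ('j \<times> nat \<Rightarrow> 'b)) \<Rightarrow> ('j \<times> nat \<Rightarrow> 'b poly) \<Rightarrow> ('j \<times> nat \<Rightarrow> 'b poly)" where
  "ext = base_change (\<lambda>b. [:b:]) Q"

lemma lin_ext: "lin scale scale (ext \<phi>)"
  unfolding ext_def by (rule lin_base_change)

definition co :: "nat \<Rightarrow> ('x \<Rightarrow> 'b poly) \<Rightarrow> ('x \<Rightarrow> 'b)" where
  "co n P = (\<lambda>x. coeff (P x) n)"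

lemma supp_co: "supp_in X P \<Longrightarrow> supp_in X (co n P)" and supp_cv: "supp_in X p \<Longrightarrow> supp_in X (cv p)"
  by (auto simp: supp_in_def co_def cv_def)

lemma co_ext:
  assumes "lin scale scale \<phi>" "supp_in Q P"
  shows "co n (ext \<phi> P) = \<phi> (co n P)"
  by (subst lin_expand[OF assms(1) finQ supp_co[OF assms(2)]])
    (auto simp: fun_eq_iff co_def ext_def base_change_def coeff_sum sum_fun_apply scale_def mult.commute intro!: sum.cong)

lemma co_eqI: "(\<And>n. co n P = co n P') \<Longrightarrow> P = P'"
  by (auto simp: co_def fun_eq_iff poly_eq_iff)

lemma co_cv: "co n (cv p) = (if n = 0 then p else 0)"
  by (auto simp: co_def cv_def fun_eq_iff coeff_pCons split: nat.split)

lemma ext_cv: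
  assumes "lin scale scale \<phi>" "supp_in Q p"
  shows "ext \<phi> (cv p) = cv (\<phi> p)"
  by (rule co_eqI) (simp add: co_ext[OF assms(1) supp_cv[OF assms(2)]] co_cv lin_zero[OF assms(1)])

text \<open>On \<open>N[t]\<close> this is \<open>t\<close> minus the action of \<open>t\<close> on
  \<open>N\<close>; on the complement of \<open>N[t]\<close> it is the identity. The complement
  turns the first map of the characteristic sequence into an endomorphism of a free module with the
  same cokernel \<open>N\<close>.\<close>

definition Z :: "('j \<times> nat \<Rightarrow> 'b poly) \<Rightarrow> ('j \<times> nat \<Rightarrow> 'b poly)" where
  "Z P = scale tt (ext idem P) + P - ext idem P - ext tmul P"

lemma linZ: "lin scale scale Z"
  using lin_ext[of idem] lin_ext[of tmul]
  by (auto simp: lin_def Z_def scale_simps) (auto simp: scale_def fun_eq_iff algebra_simps)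

lemma supp_ext: "(\<And>p. supp_in Q (\<phi> p)) \<Longrightarrow> supp_in Q (ext \<phi> P)"
  unfolding ext_def by (intro supp_in_base_change rhom_pCons)

lemma supp_Z: "supp_in Q P \<Longrightarrow> supp_in Q (Z P)"
  unfolding Z_def by (intro supp_in_lins supp_ext supp_idem supp_tmul)

lemma Z_cv: "supp_in Q p \<Longrightarrow> Z (cv p) = scale tt (cv (idem p)) + cv p - cv (idem p) - cv (tmul p)"
  by (simp add: Z_def ext_cv lin_idem lin_tmul)

lemma Z_cv_complement:
  assumes p: "supp_in Q p"
  shows "Z (cv (p - idem p)) = cv (p - idem p)"
proof -
  have "supp_in Q (p - idem p)" by (intro supp_in_lins p supp_idem)
  moreover have "idem (p - idem p) = 0" "tmul (p - idem p) = 0"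
    by (simp_all add: lin_diff[OF lin_idem] lin_diff[OF lin_tmul] idem_idem tmul_idem)
  ultimately show ?thesis by (simp add: Z_cv lin_zero[OF lin_cv] scale_simps)
qed

text \<open>Horner's scheme: write \<open>P = p0 + t P'\<close>, divide \<open>P'\<close>, and trade
  the factor \<open>t\<close> in front of the constant remainder for \<open>tmul\<close>.\<close>

lemma Z_division_bounded:
  assumes "supp_in Q P" "\<And>n. n \<ge> N \<Longrightarrow> co n P = 0"
  shows "\<exists>c p. supp_in Q c \<and> supp_in Q p \<and> P = Z c + cv p"
  using assms
proof (induction N arbitrary: P)
  case 0
  then have "P = 0" by (intro co_eqI) (auto simp: co_def)
  then show ?case
    by (intro exI[of _ 0] conjI supp_in_lins) (simp only: lin_zero[OF linZ] lin_zero[OF lin_cv] add_0)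
next
  case (Suc N)
  have "\<exists>p'. P x = [:coeff (P x) 0:] + tt * p'" for x
    by (cases "P x") (auto simp: tt_def intro: exI[of _ 0])
  then obtain P' where P': "\<And>x. P x = [:coeff (P x) 0:] + tt * P' x" by metis
  have P'c: "coeff (P' x) n = coeff (P x) (Suc n)" for x n
    by (subst P') (simp add: tt_def)
  have sP': "supp_in Q P'"
    using Suc.prems(1) by (auto simp: supp_in_def poly_eq_iff P'c)
  have "\<exists>c p. supp_in Q c \<and> supp_in Q p \<and> P' = Z c + cv p"
    by (rule Suc.IH[OF sP']) (use Suc.prems(2) in \<open>auto simp: co_def fun_eq_iff P'c\<close>)
  then obtain c p where cp: "supp_in Q c" "supp_in Q p" "P' = Z c + cv p" by blast
  let ?p0 = "co 0 P"
  have sp0: "supp_in Q ?p0" by (rule supp_co[OF Suc.prems(1)])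
  have Peq: "P = cv ?p0 + scale tt P'"
    using P' by (auto simp: cv_def co_def scale_def fun_eq_iff)
  \<comment> \<open>With \<open>p = idem p + (p - idem p)\<close>, the first part times
    \<open>t\<close> is rewritten by \<open>Z (cv p)\<close>, and the second part times
    \<open>t\<close> already lies in the image, since \<open>Z\<close> fixes the complement.\<close>
  have z1: "Z (scale tt c + cv p + scale tt (cv (p - idem p)))
      = scale tt (Z c) + (scale tt (cv (idem p)) + cv p - cv (idem p) - cv (tmul p)) + scale tt (cv (p - idem p))"
    by (simp only: lin_add[OF linZ] lin_scale[OF linZ] Z_cv_complement[OF cp(2)] Z_cv[OF cp(2)])
  have z2: "cv (?p0 - p + idem p + tmul p) = cv ?p0 - cv p + cv (idem p) + cv (tmul p)"
    by (simp only: lin_add[OF lin_cv] lin_diff[OF lin_cv])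
  have z3: "cv (p - idem p) = cv p - cv (idem p)"
    by (simp only: lin_diff[OF lin_cv])
  have "x + (z + y) = z + (w + y' - w' - u) + (y - w) + (x - y' + w' + u)"
    for x y z w w' u y' :: "'j \<times> nat \<Rightarrow> 'b poly"
    by (simp only: fun_eq_iff plus_fun_apply minus_apply) (simp add: algebra_simps)
  then have "cv ?p0 + scale tt P' = Z (scale tt c + cv p + scale tt (cv (p - idem p))) + cv (?p0 - p + idem p + tmul p)"
    unfolding z1 z2 unfolding z3 unfolding cp(3) scale_simps(1,7) .
  then have "P = Z (scale tt c + cv p + scale tt (cv (p - idem p))) + cv (?p0 - p + idem p + tmul p)"
    using Peq by (rule trans[rotated])
  moreover have "supp_in Q (scale tt c + cv p + scale tt (cv (p - idem p)))"
    by (intro supp_in_lins cp supp_cv supp_idem)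
  moreover have "supp_in Q (?p0 - p + idem p + tmul p)"
    by (intro supp_in_lins cp sp0 supp_idem supp_tmul)
  ultimately show ?case by blast
qed

lemma coeffs_bounded:
  assumes "supp_in Q P"
  obtains N where "\<And>n. n \<ge> N \<Longrightarrow> co n P = 0"
proof -
  define N where "N = Suc (\<Sum>q\<in>Q. degree (P q))"
  have "coeff (P q) n = 0" if "n \<ge> N" for n q
  proof (cases "q \<in> Q")
    case True
    then have "degree (P q) \<le> (\<Sum>q\<in>Q. degree (P q))"
      by (intro member_le_sum finQ) auto
    then show ?thesis using that by (intro coeff_eq_0) (simp add: N_def)
  next
    case False
    then have "P q = 0" using assms unfolding supp_in_def by blast
    then show ?thesis by simp
  qed
  then show ?thesis using that[of N] by (auto simp: co_def fun_eq_iff)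
qed

lemma Z_division:
  assumes "supp_in Q P"
  obtains c p where "supp_in Q c" "supp_in Q p" "idem p = p" "P = Z c + cv p"
proof -
  obtain N where "\<And>n. n \<ge> N \<Longrightarrow> co n P = 0" using coeffs_bounded[OF assms] by blast
  then obtain c p where cp: "supp_in Q c" "supp_in Q p" "P = Z c + cv p"
    using Z_division_bounded[OF assms] by blast
  have "cv p = Z (cv (p - idem p)) + cv (idem p)"
    unfolding Z_cv_complement[OF cp(2)] by (simp only: lin_diff[OF lin_cv] diff_add_cancel)
  then have "P = Z (c + cv (p - idem p)) + cv (idem p)"
    by (simp add: cp(3) lin_add[OF linZ])
  moreover have "supp_in Q (c + cv (p - idem p))" by (intro supp_in_lins cp supp_cv supp_idem)
  ultimately show ?thesis using that supp_idem idem_idem by blast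
qed

text \<open>Coefficients of \<open>c\<close> vanish from the top down: the equation in degree
  \<open>N + 1\<close> kills the \<open>N\<close>-part of coefficient \<open>N\<close>, and the
  equation in degree \<open>N\<close> kills the rest.\<close>

lemma Z_inj:
  assumes c: "supp_in Q c" and "Z c = 0"
  shows "c = 0"
proof -
  have coZ: "co n (Z c) = (case n of 0 \<Rightarrow> 0 | Suc m \<Rightarrow> idem (co m c)) + co n c - idem (co n c) - tmul (co n c)" for n
  proof -
    have "co n (scale tt (ext idem c)) = (case n of 0 \<Rightarrow> 0 | Suc m \<Rightarrow> co m (ext idem c))"
      by (auto simp: co_def scale_def tt_def fun_eq_iff split: nat.split)
    then have "co n (scale tt (ext idem c)) = (case n of 0 \<Rightarrow> 0 | Suc m \<Rightarrow> idem (co m c))"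
      by (simp add: co_ext[OF lin_idem c] split: nat.split)
    moreover have "co n (a + b - d - f) = co n a + co n b - co n d - co n f" for a b d f :: "'j \<times> nat \<Rightarrow> 'b poly"
      by (auto simp: co_def)
    ultimately show ?thesis
      by (simp add: Z_def co_ext[OF lin_idem c] co_ext[OF lin_tmul c])
  qed
  have eq: "(case n of 0 \<Rightarrow> 0 | Suc m \<Rightarrow> idem (co m c)) + co n c - idem (co n c) - tmul (co n c) = 0" for n
    using coZ[of n] assms(2) by (auto simp: co_def fun_eq_iff)
  have "\<forall>n. co n c = 0" if "\<forall>n\<ge>N. co n c = 0" for N
    using that
  proof (induction N)
    case (Suc N)
    have "co (Suc N) c = 0" using Suc.prems by blast
    then have z: "idem (co N c) = 0"
      using eq[of "Suc N"] by (simp only: nat.case lin_zero[OF lin_idem] lin_zero[OF lin_tmul] add_0_right diff_zero)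
    define X where "X = (case N of 0 \<Rightarrow> 0 | Suc m \<Rightarrow> idem (co m c))"
    have X: "idem X = X" by (auto simp: X_def lin_zero[OF lin_idem] idem_idem split: nat.split)
    have e1: "X + co N c - tmul (co N c) = 0" using eq[of N] z by (simp add: X_def)
    \<comment> \<open>Applying \<open>idem\<close> deletes the coefficient itself and isolates
      \<open>X = tmul (co N c)\<close>; back in the equation this leaves the coefficient
      alone.\<close>
    have "idem (X + co N c - tmul (co N c)) = X - tmul (co N c)"
      by (simp add: lin_diff[OF lin_idem] lin_add[OF lin_idem] X z idem_tmul)
    then have "X = tmul (co N c)" using e1 by (simp add: lin_zero[OF lin_idem])
    then have "co N c = 0" using e1 by simp
    then have "\<forall>n\<ge>N. co n c = 0" using Suc.prems by (metis le_antisym not_less_eq_eq)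
    then show ?case by (rule Suc.IH)
  qed simp
  then have "co n c = 0" for n using coeffs_bounded[OF c] by metis
  then show ?thesis by (intro co_eqI) (simp add: co_def fun_eq_iff)
qed

section \<open>The presentation of the image of \<open>E\<close> and its splitting\<close>

definition Ind :: "('e + 'j \<times> nat) set" where
  "Ind = I0 <+> Q"

lemma Ind_iff: "Inl i \<in> Ind \<longleftrightarrow> i \<in> I0" "Inr q \<in> Ind \<longleftrightarrow> q \<in> Q"
  by (auto simp: Ind_def)

lemma finInd: "finite Ind"
  by (simp add: Ind_def finI0 finQ)

text \<open>Multiplication by \<open>t\<close> does not preserve \<open>N\<close> as a subset of
  \<open>S\<close>. \<open>C (WW P)\<close> collects the components in \<open>im C\<close> that
  \<open>red\<close> removes from \<open>t\<close> times the generators; the sign in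
  \<open>K\<close> compensates them.\<close>

definition WW :: "('j \<times> nat \<Rightarrow> 'b poly) \<Rightarrow> ('e \<Rightarrow> 'b poly)" where
  "WW = lincomb scale Q (\<lambda>q. quo (\<mu> (scale tt (gen q))))"

definition K :: "('j \<times> nat \<Rightarrow> 'b poly) \<Rightarrow> ('e + 'j \<times> nat \<Rightarrow> 'b poly)" where
  "K P = case_sum (- WW P) (Z P)"

definition W :: "('e + 'j \<times> nat \<Rightarrow> 'b poly) \<Rightarrow> ('j \<Rightarrow> 'b poly)" where
  "W v = C (\<lambda>i. v (Inl i)) + Y (\<lambda>q. v (Inr q))"

lemma linWW: "lin scale scale WW"
  unfolding WW_def by (rule lin_lincomb[OF module_scale])

lemma linK: "lin scale scale K"
  using linWW linZ by (auto simp: lin_def K_def fun_eq_iff scale_def split: sum.split)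

lemma linW: "lin scale scale W"
proof -
  have 1: "(\<lambda>i. (v + w) (Inl i)) = (\<lambda>i. v (Inl i)) + (\<lambda>i. w (Inl i))"
    "(\<lambda>i. (v + w) (Inr i)) = (\<lambda>i. v (Inr i)) + (\<lambda>i. w (Inr i))"
    "(\<lambda>i. scale c v (Inl i)) = scale c (\<lambda>i. v (Inl i))"
    "(\<lambda>i. scale c v (Inr i)) = scale c (\<lambda>i. v (Inr i))"
    for v w :: "'e + 'j \<times> nat \<Rightarrow> 'b poly" and c
    by (auto simp: scale_def)
  show ?thesis
    unfolding lin_def W_def 1 lin_add[OF linC] lin_add[OF linY] lin_scale[OF linC] lin_scale[OF linY] scale_simps(1)
    by (simp add: add_ac)
qed

lemma W_K: "supp_in Q c \<Longrightarrow> W (K c) = 0"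
proof -
  assume "supp_in Q c"
  have "W (K (unit_vec q)) = 0" if q: "q \<in> Q" for q
  proof -
    have cu: "cv (unit_vec q) = unit_vec q" by (auto simp: cv_def unit_vec_def fun_eq_iff)
    have Yq: "Y (cv (unit_vec q)) = gen q"
      unfolding cu Y_def by (rule lincomb_unit_vec[OF module_scale finQ q])
    have "Y (Z (cv (unit_vec q))) = scale tt (gen q) - red (scale tt (gen q))"
      by (simp add: Z_cv supp_in_unit_vec q lin_add[OF linY] lin_diff[OF linY] lin_scale[OF linY] Y_idem Y_tmul Yq)
    then have "Y (Z (unit_vec q)) = C (quo (\<mu> (scale tt (gen q))))" by (simp add: cu red_def)
    moreover have "WW (unit_vec q) = quo (\<mu> (scale tt (gen q)))"
      unfolding WW_def by (rule lincomb_unit_vec[OF module_scale finQ q])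
    moreover have "(\<lambda>i. - WW (unit_vec q) i) = - WW (unit_vec q)" by auto
    ultimately show ?thesis by (simp add: W_def K_def lin_uminus[OF linC])
  qed
  moreover have "lin scale scale (\<lambda>_. 0 :: 'j \<Rightarrow> 'b poly)" by (auto simp: lin_def scale_simps)
  ultimately show ?thesis
    using lin_eqI[OF lin_comp[OF linK linW] _ finQ \<open>supp_in Q c\<close>] by blast
qed

lemma supp_K: "supp_in Q c \<Longrightarrow> supp_in Ind (K c)"
proof -
  assume "supp_in Q c"
  moreover have "supp_in I0 (WW c)"
    using supp_quo[OF supp\<mu>] by (auto simp: WW_def lincomb_def supp_in_def sum_fun_apply scale_def)
  ultimately show ?thesis
    using supp_Z[of c] by (auto simp: supp_in_def K_def Ind_def split: sum.split)
qed

lemma K_inj: "supp_in Q c \<Longrightarrow> K c = 0 \<Longrightarrow> c = 0"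
proof -
  assume c: "supp_in Q c" and K0: "K c = 0"
  have "Z c q = 0" for q using fun_cong[OF K0, of "Inr q"] by (simp add: K_def)
  then show "c = 0" using Z_inj[OF c] by (simp add: fun_eq_iff)
qed

text \<open>Subtracting a suitable \<open>K c\<close> makes the \<open>Q\<close> component a
  constant vector in the copy of \<open>N\<close>. Applying \<open>red\<close> to the remaining
  relation separates \<open>im C\<close> from \<open>N\<close>, and both parts vanish.\<close>

lemma kernel_W:
  assumes v: "supp_in Ind v" and Wv: "W v = 0"
  shows "\<exists>c. supp_in Q c \<and> v = K c"
proof -
  have "supp_in Q (\<lambda>q. v (Inr q))" using v by (auto simp: supp_in_def Ind_iff)
  from Z_division[OF this] obtain c p where c: "supp_in Q c" and p: "supp_in Q p" "idem p = p"
    and eq: "(\<lambda>q. v (Inr q)) = Z c + cv p" by metis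
  define v' where "v' = v - K c"
  have Wv': "W v' = 0" by (simp add: v'_def lin_diff[OF linW] Wv W_K c)
  have r: "(\<lambda>q. v' (Inr q)) = cv p"
    using eq by (auto simp: v'_def K_def fun_eq_iff)
  define a where "a i = v' (Inl i)" for i
  have a: "supp_in I0 a"
    using v supp_K[OF c] by (auto simp: supp_in_def a_def v'_def Ind_iff)
  have CY: "C a + Y (cv p) = 0" using Wv' by (simp add: W_def r a_def[abs_def])
  have "red (C a + Y (cv p)) = Y (cv p)" by (simp add: lin_add[OF lin_red] red_C[OF a] red_Ycv)
  then have Y0: "Y (cv p) = 0" by (simp add: CY lin_zero[OF lin_red])
  then have "idem p = 0" by (simp add: idem_def lin_zero[OF lin_coords])
  then have p0: "p = 0" using p by simp
  have "C a = 0" using CY Y0 by simp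
  then have "scale F a = 0" using \<mu>C[OF a] by (simp add: lin_zero[OF lin\<mu>])
  then have "a = 0" using quo_scale[of a] lin_zero[OF lin_quo] by metis
  have "v' x = 0" for x
    using fun_cong[OF \<open>a = 0\<close>] r p0 by (cases x) (auto simp: a_def cv_def fun_eq_iff)
  then have "v = K c" by (simp add: v'_def fun_eq_iff)
  then show ?thesis using c by blast
qed

text \<open>A preimage under \<open>W\<close> of the column \<open>j\<close> of \<open>E\<close>:
  its part in \<open>im C\<close> by \<open>quo\<close>, its part in \<open>N\<close> by the
  generator with \<open>l = 0\<close>. If \<open>F\<close> has degree \<open>0\<close> that index is
  missing, but then \<open>F = 1\<close> and \<open>red\<close> vanishes on the image of
  \<open>E\<close>.\<close>

definition Lgen :: "'j \<Rightarrow> ('e + 'j \<times> nat \<Rightarrow> 'b poly)" where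
  "Lgen j = case_sum (quo (\<mu> (E (unit_vec j)))) (\<lambda>q. if 0 < e then unit_vec (j, 0) q else 0)"

definition L :: "('j \<Rightarrow> 'b poly) \<Rightarrow> ('e + 'j \<times> nat \<Rightarrow> 'b poly)" where
  "L = lincomb scale J Lgen"

lemma linL: "lin scale scale L"
  unfolding L_def by (rule lin_lincomb[OF module_scale])

lemma supp_L: "supp_in Ind (L v)"
proof -
  have "supp_in Ind (Lgen j)" if "j \<in> J" for j
    using that supp_quo[OF supp\<mu>]
    by (auto simp: supp_in_def Lgen_def Ind_def Q_def unit_vec_def split: sum.split)
  then show ?thesis
    by (auto simp: L_def lincomb_def supp_in_def sum_fun_apply scale_def intro!: sum.neutral)
qed

lemma W_L: "supp_in J v \<Longrightarrow> W (L v) = E v"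
proof (rule lin_eqI[OF lin_comp[OF linL linW] linE finJ])
  fix j assume j: "j \<in> J"
  have "W (Lgen j) = C (quo (\<mu> (E (unit_vec j)))) + red (E (unit_vec j))"
  proof (cases "e = 0")
    case True
    then have "F = 1" using monic by (metis degree_0_id one_pCons)
    then have "red (E (unit_vec j)) = 0" using red_scale[of "E (unit_vec j)"] by (simp add: EE scale_simps)
    moreover have "Y (\<lambda>q. 0) = 0" using lin_zero[OF linY] by (simp add: zero_fun_def)
    ultimately show ?thesis using True by (simp add: W_def Lgen_def)
  next
    case False
    then have "(j, 0) \<in> Q" using j by (simp add: Q_def)
    then have "Y (unit_vec (j, 0)) = gen (j, 0)"
      unfolding Y_def by (rule lincomb_unit_vec[OF module_scale finQ])
    moreover have "gen (j, 0) = red (E (unit_vec j))" by (simp add: gen_def scale_simps)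
    ultimately show ?thesis using False by (simp add: W_def Lgen_def)
  qed
  then have "W (Lgen j) = E (unit_vec j)" by (simp add: red_def)
  moreover have "L (unit_vec j) = Lgen j"
    unfolding L_def by (rule lincomb_unit_vec[OF module_scale finJ j])
  ultimately show "W (L (unit_vec j)) = E (unit_vec j)" by simp
qed

lemma E_W: "E (W v) = W v"
  by (simp add: W_def lin_add[OF linE] EC E_Y)

text \<open>The image of \<open>E\<close> is projective and \<open>L\<close> splits
  \<open>W\<close>. What remains of a basis vector lies in the kernel of \<open>W\<close>, hence is
  \<open>K\<close> of something; \<open>T\<close> collects these preimages, and injectivity of
  \<open>K\<close> yields its identities.\<close>

lemma splitting:
  obtains T where "lin scale scale T" "\<And>v. supp_in Q (T v)" "\<And>c. supp_in Q c \<Longrightarrow> T (K c) = c"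
    "\<And>v. supp_in Ind v \<Longrightarrow> L (W v) + K (T v) = v" "\<And>v. T (L (E v)) = 0"
proof -
  have "\<exists>c. supp_in Q c \<and> unit_vec x - L (W (unit_vec x)) = K c" if x: "x \<in> Ind" for x
  proof (rule kernel_W)
    show "supp_in Ind (unit_vec x - L (W (unit_vec x)))"
      by (intro supp_in_lins supp_in_unit_vec x supp_L)
    have "supp_in J (W v)" for v using suppE[of "W v"] by (simp add: E_W)
    then show "W (unit_vec x - L (W (unit_vec x))) = 0"
      by (simp add: lin_diff[OF linW] W_L E_W)
  qed
  then obtain T0 where T0: "\<And>x. x \<in> Ind \<Longrightarrow> supp_in Q (T0 x)"
    "\<And>x. x \<in> Ind \<Longrightarrow> unit_vec x - L (W (unit_vec x)) = K (T0 x)" by metis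
  define T where "T = lincomb scale Ind T0"
  have linT: "lin scale scale T" unfolding T_def by (rule lin_lincomb[OF module_scale])
  have suppT: "supp_in Q (T v)" for v
    using T0(1) by (auto simp: T_def lincomb_def supp_in_def sum_fun_apply scale_def intro!: sum.neutral)
  have lin3: "lin scale scale (\<lambda>v. L (W v) + K (T v))"
    using lin_comp[OF linW linL] lin_comp[OF linT linK] by (simp add: lin_def scale_simps)
  have LW: "L (W v) + K (T v) = v" if "supp_in Ind v" for v
  proof (rule lin_eqI[OF lin3 lin_id finInd that])
    fix x assume x: "x \<in> Ind"
    have "T (unit_vec x) = T0 x" unfolding T_def by (rule lincomb_unit_vec[OF module_scale finInd x])
    then show "L (W (unit_vec x)) + K (T (unit_vec x)) = unit_vec x" by (simp add: T0(2)[OF x, symmetric])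
  qed
  have TK: "T (K c) = c" if c: "supp_in Q c" for c
  proof -
    have "K (T (K c) - c) = 0"
      using LW[OF supp_K[OF c]] by (simp add: W_K[OF c] lin_zero[OF linL] lin_diff[OF linK])
    then have "T (K c) - c = 0" by (intro K_inj supp_in_lins suppT c)
    then show ?thesis by simp
  qed
  have "T (L (E v)) = 0" for v
  proof -
    have "K (T (L (E v))) = 0" using LW[OF supp_L[of "E v"]] by (simp add: W_L[OF suppE] EE)
    then show ?thesis by (intro K_inj suppT)
  qed
  then show ?thesis using that linT suppT TK LW by blast
qed

end

subsection \<open>Modules with a connection are free\<close>

lemma lookup_pd: "lookup (pd i p) b = of_nat (lookup b i + 1) * lookup p (b + single i 1)"
  for p :: "('n, 'k::comm_ring_1) mpoly"
proof (induction p rule: mpoly_single_induct)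
  case (single a c)
  show ?case
  proof (cases "a = b + single i 1")
    case True
    then show ?thesis by (simp add: pd_single lookup_add)
  next
    case False
    have "a - single i 1 = b \<Longrightarrow> lookup a i = 0"
    proof (rule ccontr)
      assume b: "a - single i 1 = b" "lookup a i \<noteq> 0"
      then have "a = b + single i 1"
        by (intro poly_mapping_eqI) (auto simp: lookup_add lookup_minus lookup_single when_def b(1)[symmetric])
      then show False using False by simp
    qed
    then show ?thesis using False by (auto simp: pd_single lookup_single when_def)
  qed
qed (simp add: pd_add lookup_add algebra_simps)

text \<open>Each nonzero derivative lowers the total degree. When all derivatives vanish the
  polynomial is constant, by characteristic zero, and can be scaled to \<open>1\<close>.\<close>

lemma pd_closed_contains_one:
  fixes p :: "('n::finite, 'k::field_char_0) mpoly"
  assumes pdS: "\<And>p i. p \<in> S \<Longrightarrow> pd i p \<in> S" and scS: "\<And>p c. p \<in> S \<Longrightarrow> cst c * p \<in> S"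
    and "p \<in> S" "p \<noteq> 0"
  shows "1 \<in> S"
proof -
  define td where "td a = (\<Sum>i\<in>UNIV. lookup a i)" for a :: "'n \<Rightarrow>\<^sub>0 nat"
  have td: "td (a + single i 1) = Suc (td a)" for a i
    by (simp add: td_def lookup_add sum.distrib lookup_single when_def)
  have "1 \<in> S" if "p \<in> S" "p \<noteq> 0" "\<And>a. a \<in> keys p \<Longrightarrow> td a \<le> n" for n p
    using that
  proof (induction n arbitrary: p rule: less_induct)
    case (less n)
    show ?case
    proof (cases "\<exists>i. pd i p \<noteq> 0")
      case True
      then obtain i where i: "pd i p \<noteq> 0" by blast
      have b: "b + single i 1 \<in> keys p" if "b \<in> keys (pd i p)" for b
        using that lookup_pd[of i p b] by (metis in_keys_iff mult_zero_right)
      have le: "Suc (td b) \<le> n" if "b \<in> keys (pd i p)" for b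
        using less.prems(3)[OF b[OF that]] by (simp only: td)
      obtain b where "b \<in> keys (pd i p)" using i by (metis keys_eq_empty ex_in_conv)
      then have "n - 1 < n" using le by fastforce
      moreover have "td b \<le> n - 1" if "b \<in> keys (pd i p)" for b using le[OF that] by simp
      ultimately show ?thesis using less.IH[OF _ pdS[OF less.prems(1)] i] by blast
    next
      case False
      have "lookup p a = 0" if a: "a \<noteq> 0" for a
      proof -
        obtain i where i: "lookup a i \<noteq> 0" using a by (metis poly_mapping_eqI lookup_zero)
        define b where "b = a - single i 1"
        have "a = b + single i 1"
          using i by (intro poly_mapping_eqI) (auto simp: b_def lookup_add lookup_minus lookup_single when_def)
        then have "of_nat (lookup b i + 1) * lookup p a = 0"
          using False lookup_pd[of i p b] by simp
        then show ?thesis by (metis Suc_eq_plus1 mult_eq_0_iff of_nat_neq_0)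
      qed
      then have pc: "p = cst (lookup p 0)"
        by (intro poly_mapping_eqI) (auto simp: cst_def lookup_single when_def)
      then have "lookup p 0 \<noteq> 0" using less.prems(2) by (metis cst_0)
      then have "cst (inverse (lookup p 0)) * p = 1" by (subst pc) (simp add: cst_mult[symmetric])
      then show ?thesis using scS[OF less.prems(1)] by metis
    qed
  qed
  from this[OF assms(3,4), of "Max (td ` keys p)"] show ?thesis by simp
qed

text \<open>\<open>I0\<close> is an independent set of generators of greatest size, so each
  generator has a nonzero multiple in its span, and \<open>f\<close> is the product of these
  multipliers. \<open>\<mu> m\<close> is the coordinate vector of \<open>f m\<close>, unique by
  independence.\<close>

lemma fractional_basis:
  fixes smul :: "('n::finite, 'k::field) mpoly \<Rightarrow> 'm::ab_group_add \<Rightarrow> 'm"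
  assumes md: "module smul" and ft: "finite_type smul"
  obtains f \<mu> and I0 :: "'m set" where "f \<noteq> 0" "finite I0" "lin smul scale \<mu>" "\<And>m. supp_in I0 (\<mu> m)"
    "\<And>m. lincomb smul I0 (\<lambda>e. e) (\<mu> m) = smul f m" "\<And>e. e \<in> I0 \<Longrightarrow> \<mu> e = scale f (unit_vec e)"
proof -
  interpret module smul by (rule md)
  obtain G where G: "finite G" "\<And>m. \<exists>c. m = (\<Sum>g\<in>G. smul (c g) g)"
    using ft unfolding finite_type_def by blast
  define indep where "indep X \<longleftrightarrow> (\<forall>c. (\<Sum>e\<in>X. smul (c e) e) = 0 \<longrightarrow> (\<forall>e\<in>X. c e = 0))" for X
  have "\<exists>X. (X \<subseteq> G \<and> indep X) \<and> (\<forall>Y. Y \<subseteq> G \<and> indep Y \<longrightarrow> card Y \<le> card X)"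
  proof (rule ex_has_greatest_nat)
    show "{} \<subseteq> G \<and> indep {}" by (simp add: indep_def)
    show "\<forall>Y. Y \<subseteq> G \<and> indep Y \<longrightarrow> card Y < Suc (card G)" using card_mono[OF G(1)] by (simp add: less_Suc_eq_le)
  qed
  then obtain I0 where I0: "I0 \<subseteq> G" "indep I0" and mx: "\<And>Y. Y \<subseteq> G \<Longrightarrow> indep Y \<Longrightarrow> card Y \<le> card I0" by blast
  have fin: "finite I0" using I0(1) G(1) by (rule finite_subset)
  let ?C = "lincomb smul I0 (\<lambda>e. e)"
  have linC: "lin scale smul ?C" by (rule lin_lincomb[OF md])
  define span where "span m \<longleftrightarrow> (\<exists>c. m = ?C c)" for m
  have span_add: "span (m + m')" if "span m" "span m'" for m m'
    using that lin_add[OF linC] unfolding span_def by metis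
  have span_smul: "span (smul a m)" if "span m" for a m
    using that lin_scale[OF linC] unfolding span_def by metis
  have span_sum: "span (\<Sum>x\<in>X. h x)" if "\<And>x. x \<in> X \<Longrightarrow> span (h x)" for X :: "'m set" and h
    using that
  proof (induction X rule: infinite_finite_induct)
    case (insert x X)
    then show ?case by (simp add: span_add)
  qed (simp_all add: span_def, metis lin_zero[OF linC], metis lin_zero[OF linC])
  have "\<exists>a. a \<noteq> 0 \<and> span (smul a g)" if g: "g \<in> G" for g
  proof (cases "g \<in> I0")
    case True
    then have "?C (unit_vec g) = smul 1 g" using lincomb_unit_vec[OF md fin True] by simp
    then show ?thesis unfolding span_def by (intro exI[of _ 1]) (metis zero_neq_one)
  next
    case False
    have "\<not> indep (insert g I0)"
    proof
      assume "indep (insert g I0)"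
      then have "card (insert g I0) \<le> card I0" using mx g I0(1) by simp
      then show False using False fin by simp
    qed
    then obtain c e where c: "(\<Sum>e\<in>insert g I0. smul (c e) e) = 0" "e \<in> insert g I0" "c e \<noteq> 0"
      unfolding indep_def by blast
    have sumc: "smul (c g) g + ?C c = 0" using c(1) False fin by (simp add: lincomb_def)
    have "c g \<noteq> 0"
    proof
      assume 0: "c g = 0"
      then have "(\<Sum>e\<in>I0. smul (c e) e) = 0" using sumc by (simp add: lincomb_def)
      then have "\<forall>e\<in>I0. c e = 0" using I0(2) unfolding indep_def by blast
      then show False using c 0 by auto
    qed
    moreover have "smul (c g) g = ?C (- c)" using sumc by (simp add: lin_uminus[OF linC] eq_neg_iff_add_eq_0)
    ultimately show ?thesis unfolding span_def by blast
  qed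
  then obtain a where a: "\<And>g. g \<in> G \<Longrightarrow> a g \<noteq> 0" "\<And>g. g \<in> G \<Longrightarrow> span (smul (a g) g)" by metis
  define f where "f = (\<Prod>g\<in>G. a g)"
  have prod_nz: "(\<Prod>g\<in>X. a g) \<noteq> 0" if "X \<subseteq> G" for X
    using finite_subset[OF that G(1)] that a(1)
    by (induction X rule: finite_induct) (auto simp: mpoly_no_zero_divisors)
  then have fnz: "f \<noteq> 0" by (simp add: f_def)
  have "span (smul f m)" for m
  proof -
    obtain c where c: "m = (\<Sum>g\<in>G. smul (c g) g)" using G(2) by blast
    have "smul f (smul (c g) g) = smul (c g * (\<Prod>g\<in>G - {g}. a g)) (smul (a g) g)" if "g \<in> G" for g
      using that G(1) by (simp add: f_def prod.remove mult_ac)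
    then have "smul f m = (\<Sum>g\<in>G. smul (c g * (\<Prod>g\<in>G - {g}. a g)) (smul (a g) g))"
      by (simp add: c scale_sum_right del: scale_scale)
    moreover have "span (\<Sum>g\<in>G. smul (c g * (\<Prod>g\<in>G - {g}. a g)) (smul (a g) g))"
      by (rule span_sum, rule span_smul, rule a(2))
    ultimately show ?thesis by simp
  qed
  then have ex: "\<exists>c. supp_in I0 c \<and> ?C c = smul f m" for m
  proof -
    obtain c where c: "smul f m = ?C c" using \<open>\<And>m. span (smul f m)\<close> unfolding span_def by blast
    show ?thesis
    proof (intro exI conjI)
      show "supp_in I0 (\<lambda>e. if e \<in> I0 then c e else 0)" by (simp add: supp_in_def)
      show "?C (\<lambda>e. if e \<in> I0 then c e else 0) = smul f m"
        unfolding c lincomb_def by (rule sum.cong) auto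
    qed
  qed
  have uniq: "c = c'" if c: "supp_in I0 c" "supp_in I0 c'" "?C c = ?C c'" for c c'
  proof -
    have "?C (c - c') = 0" using c by (simp add: lin_diff[OF linC])
    then have "\<forall>e\<in>I0. (c - c') e = 0" using I0(2) unfolding indep_def lincomb_def by blast
    then have "c e = c' e" for e
      using c(1,2) by (cases "e \<in> I0") (auto simp: supp_in_def)
    then show ?thesis by (rule ext)
  qed
  obtain \<mu> where \<mu>: "\<And>m. supp_in I0 (\<mu> m)" "\<And>m. ?C (\<mu> m) = smul f m" using ex by metis
  have "lin smul scale \<mu>"
    unfolding lin_def
  proof (intro conjI allI)
    show "\<mu> (x + y) = \<mu> x + \<mu> y" for x y
      by (rule uniq) (simp_all add: \<mu> supp_in_lins lin_add[OF linC] scale_right_distrib)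
    show "\<mu> (smul c x) = scale c (\<mu> x)" for c x
      by (rule uniq) (simp_all add: \<mu> supp_in_lins lin_scale[OF linC] mult.commute)
  qed
  moreover have "\<mu> e = scale f (unit_vec e)" if "e \<in> I0" for e
    by (rule uniq) (simp_all add: \<mu> supp_in_lins supp_in_unit_vec that lin_scale[OF linC] lincomb_unit_vec[OF md fin])
  ultimately show ?thesis using that[OF fnz fin] \<mu> by blast
qed

locale connection_module = module smul
  for smul :: "('n::finite, 'k::field_char_0) mpoly \<Rightarrow> 'm::ab_group_add \<Rightarrow> 'm" +
  fixes D :: "'n \<Rightarrow> 'm \<Rightarrow> 'm"
  assumes D_add: "D i (m + m') = D i m + D i m'"
    and D_smul: "D i (smul a m) = smul a (D i m) + smul (pd i a) m"
    and fin_type: "finite_type smul"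
begin

text \<open>If \<open>h = \<Sum>\<^sub>j g\<^sub>j \<sigma>\<^sub>j\<close> on the module, then \<open>\<partial>\<^sub>i h = [D\<^sub>i, h]\<close> is again of this form, so the ideal of such \<open>h\<close>
  is stable under differentiation.\<close>

definition factors :: "('n, 'k) mpoly \<Rightarrow> bool" where
  "factors h \<longleftrightarrow> (\<exists>(N::nat) \<sigma> g. lin smul scale \<sigma> \<and> (\<forall>m. smul h m = (\<Sum>j<N. smul (\<sigma> m j) (g j))))"

lemma D_sum: "D i (sum h X) = (\<Sum>x\<in>X. D i (h x))"
proof -
  have "D i 0 = 0" using D_add[of i 0 0] by simp
  then show ?thesis by (induction X rule: infinite_finite_induct) (auto simp: D_add)
qed

lemma factors_pd:
  assumes "factors h"
  shows "factors (pd i h)"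
proof -
  obtain N :: nat and \<sigma> g where \<sigma>: "lin smul scale \<sigma>" and h: "\<And>m. smul h m = (\<Sum>j<N. smul (\<sigma> m j) (g j))"
    using assms unfolding factors_def by blast
  \<comment> \<open>Neither summand of \<open>pd i (\<sigma> m) - \<sigma> (D i m)\<close> is linear
    in \<open>m\<close>, but their Leibniz terms agree and cancel.\<close>
  define \<sigma>' where "\<sigma>' m j = (if j < N then pd i (\<sigma> m j) - \<sigma> (D i m) j else \<sigma> m (j - N))" for m j
  define g' where "g' j = (if j < N then g j else D i (g (j - N)))" for j
  have "lin smul scale \<sigma>'"
    by (auto simp: lin_def \<sigma>'_def fun_eq_iff D_add D_smul lin_add[OF \<sigma>] lin_scale[OF \<sigma>] scale_def pd_add pd_mult algebra_simps)
  moreover have "smul (pd i h) m = (\<Sum>j<N + N. smul (\<sigma>' m j) (g' j))" for m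
  proof -
    have split: "(\<Sum>j<N + N. h j) = (\<Sum>j<N. h j) + (\<Sum>j<N. h (N + j))" for h :: "nat \<Rightarrow> 'm"
      using sum.atLeastLessThan_concat[of 0 N "N + N" h] sum.shift_bounds_nat_ivl[of h 0 N N]
      by (simp add: atLeast0LessThan add.commute)
    have "smul (pd i h) m = D i (smul h m) - smul h (D i m)" by (simp add: D_smul)
    also have "\<dots> = (\<Sum>j<N. smul (pd i (\<sigma> m j) - \<sigma> (D i m) j) (g j)) + (\<Sum>j<N. smul (\<sigma> m j) (D i (g j)))"
      by (simp add: h D_sum D_smul sum.distrib scale_left_diff_distrib sum_subtractf)
    finally show ?thesis unfolding split by (simp add: \<sigma>'_def g'_def)
  qed
  ultimately show ?thesis unfolding factors_def by blast
qed

lemma factors_cst: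
  assumes "factors h"
  shows "factors (cst c * h)"
proof -
  obtain N :: nat and \<sigma> g where \<sigma>: "lin smul scale \<sigma>" and h: "\<And>m. smul h m = (\<Sum>j<N. smul (\<sigma> m j) (g j))"
    using assms unfolding factors_def by blast
  have "lin smul scale (\<lambda>m. scale (cst c) (\<sigma> m))"
    using \<sigma> by (simp add: lin_def scale_simps) (simp add: scale_def mult.left_commute)
  moreover have "smul (cst c * h) m = (\<Sum>j<N. smul (scale (cst c) (\<sigma> m) j) (g j))" for m
    by (simp add: scale_scale[symmetric] h scale_sum_right scale_def del: scale_scale)
  ultimately show ?thesis unfolding factors_def by blast
qed

lemma projective:
  obtains N :: nat and \<sigma> g where "lin smul scale \<sigma>" "\<And>m. supp_in {..<N} (\<sigma> m)" "\<And>m. lincomb smul {..<N} g (\<sigma> m) = m"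
proof -
  obtain f \<mu> and I0 :: "'m set" where f: "f \<noteq> 0" "finite I0" "lin smul scale \<mu>"
    "\<And>m. lincomb smul I0 (\<lambda>e. e) (\<mu> m) = smul f m"
    using fractional_basis[OF module_axioms fin_type] by metis
  obtain e where e: "bij_betw e {..<card I0} I0"
    using ex_bij_betw_nat_finite[OF f(2)] by (auto simp: atLeast0LessThan)
  have "factors f"
    unfolding factors_def
  proof (intro exI conjI allI)
    show "lin smul scale (\<lambda>m j. \<mu> m (e j))" using f(3) by (auto simp: lin_def scale_def)
    show "smul f m = (\<Sum>j<card I0. smul (\<mu> m (e j)) (e j))" for m
      unfolding f(4)[symmetric] lincomb_def by (rule sum.reindex_bij_betw[OF e, symmetric])
  qed
  then have "factors 1"
    using pd_closed_contains_one[of "Collect factors" f] f(1) factors_pd factors_cst by simp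
  then obtain N :: nat and \<sigma> g where \<sigma>: "lin smul scale \<sigma>" and id: "\<And>m. smul 1 m = (\<Sum>j<N. smul (\<sigma> m j) (g j))"
    unfolding factors_def by blast
  show ?thesis
  proof (rule that)
    show "lin smul scale (\<lambda>m j. if j < N then \<sigma> m j else 0)"
      using \<sigma> by (auto simp: lin_def scale_def fun_eq_iff)
    show "supp_in {..<N} (\<lambda>j. if j < N then \<sigma> m j else 0)" for m
      by (auto simp: supp_in_def)
    show "lincomb smul {..<N} g (\<lambda>j. if j < N then \<sigma> m j else 0) = m" for m
      using id[of m] by (simp add: lincomb_def)
  qed
qed

text \<open>\<open>M\<close> is the image of the idempotent \<open>E0\<close> over
  \<open>k[x]\<close>. Pulling its matrix back along \<open>x + t v\<close> makes the denominator
  \<open>f\<close> monic, so the presentation above applies over \<open>k[x][t]\<close>; all its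
  maps and identities are then specialized at \<open>t = 0\<close>.\<close>

lemma stably_free: "\<exists>(I :: ('m + nat \<times> nat) set) (Q :: (nat \<times> nat) set). finite I \<and> finite Q \<and> stably_free smul I Q"
proof -
  note md = module_axioms
  obtain N :: nat and \<sigma> g where lin\<sigma>: "lin smul scale \<sigma>" and supp\<sigma>: "\<And>m. supp_in {..<N} (\<sigma> m)"
    and G\<sigma>: "\<And>m. lincomb smul {..<N} g (\<sigma> m) = m"
    using projective by metis
  obtain f \<mu> and I0 :: "'m set" where f: "f \<noteq> 0" "finite I0" "lin smul scale \<mu>" "\<And>m. supp_in I0 (\<mu> m)"
    "\<And>m. lincomb smul I0 (\<lambda>e. e) (\<mu> m) = smul f m" "\<And>e. e \<in> I0 \<Longrightarrow> \<mu> e = scale f (unit_vec e)"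
    using fractional_basis[OF md fin_type] by metis
  obtain v c where c: "c \<noteq> 0" "lead_coeff (lshift v f) = cst c"
    using lshift_unit_leading[OF f(1) vars_in_UNIV, of undefined] by blast
  define h where "h = lshift v"
  have h: "rhom h" unfolding h_def by (rule rhom_lshift)
  define J where "J = {..<N}"
  have J: "finite J" by (simp add: J_def)
  define f' where "f' = cst (inverse c) * f"
  define F where "F = h f'"
  have monic: "lead_coeff F = 1"
    unfolding F_def h_def f'_def by (rule lshift_normalized_monic[OF c])
  define G where "G = lincomb smul J g"
  define CM where "CM = lincomb smul I0 (\<lambda>e. e)"
  define \<mu>' where "\<mu>' m = scale (cst (inverse c)) (\<mu> m)" for m
  have linG: "lin scale smul G" and linCM: "lin scale smul CM"
    unfolding G_def CM_def by (intro lin_lincomb[OF md])+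
  have lin\<mu>': "lin smul scale \<mu>'"
    using f(3) by (simp add: lin_def \<mu>'_def scale_simps) (simp add: scale_def mult.left_commute)
  have G\<sigma>': "G (\<sigma> m) = m" for m using G\<sigma> by (simp add: G_def J_def)
  have supp\<sigma>': "supp_in J (\<sigma> m)" for m using supp\<sigma> by (simp add: J_def)
  have supp\<mu>': "supp_in I0 (\<mu>' m)" for m unfolding \<mu>'_def by (intro supp_in_lins f(4))
  have CM\<mu>': "CM (\<mu>' m) = smul f' m" for m
    using f(5)[of m] by (simp add: \<mu>'_def lin_scale[OF linCM] CM_def[symmetric] f'_def)
  have CMe: "CM (unit_vec e) = e" if "e \<in> I0" for e
    unfolding CM_def by (rule lincomb_unit_vec[OF md f(2) that])
  have \<mu>'e: "\<mu>' e = scale f' (unit_vec e)" if "e \<in> I0" for e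
    using f(6)[OF that] by (simp add: \<mu>'_def f'_def scale_simps)
  define E0 where "E0 u = \<sigma> (G u)" for u
  define C0 where "C0 a = \<sigma> (CM a)" for a
  define \<mu>0 where "\<mu>0 u = \<mu>' (G u)" for u
  have linE0: "lin scale scale E0" and linC0: "lin scale scale C0" and lin\<mu>0: "lin scale scale \<mu>0"
    unfolding E0_def C0_def \<mu>0_def
    by (rule lin_comp[OF linG lin\<sigma>], rule lin_comp[OF linCM lin\<sigma>], rule lin_comp[OF linG lin\<mu>'])
  define E where "E = base_change h J E0"
  define C where "C = base_change h I0 C0"
  define \<mu>1 where "\<mu>1 = base_change h J \<mu>0"
  have sE0: "supp_in J (E0 u)" and sC0: "supp_in J (C0 a)" and s\<mu>0: "supp_in I0 (\<mu>0 u)" for u a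
    by (simp_all add: E0_def C0_def \<mu>0_def supp\<sigma>' supp\<mu>')
  interpret q: monic_torsion_quotient J I0 F E C \<mu>1
  proof
    show "finite J" "finite I0" "lead_coeff F = 1" by (fact J f(2) monic)+
    show "lin scale scale E" "lin scale scale C" "lin scale scale \<mu>1"
      unfolding E_def C_def \<mu>1_def by (rule lin_base_change)+
    show "E (E u) = E u" for u
    proof -
      have "E (E u) = base_change h J (\<lambda>v. E0 (E0 v)) u"
        unfolding E_def by (rule base_change_comp[OF h linE0 J sE0])
      moreover have "E0 (E0 v) = E0 v" for v by (simp add: E0_def G\<sigma>')
      ultimately show ?thesis by (simp add: E_def)
    qed
    show "E (C a) = C a" for a
    proof -
      have "E (C a) = base_change h I0 (\<lambda>v. E0 (C0 v)) a"
        unfolding E_def C_def by (rule base_change_comp[OF h linE0 J sC0])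
      moreover have "E0 (C0 v) = C0 v" for v by (simp add: E0_def C0_def G\<sigma>')
      ultimately show ?thesis by (simp add: C_def)
    qed
    show "\<mu>1 (C a) = scale F a" if a: "supp_in I0 a" for a
    proof -
      have "\<mu>1 (C a) = base_change h I0 (\<lambda>v. \<mu>0 (C0 v)) a"
        unfolding \<mu>1_def C_def by (rule base_change_comp[OF h lin\<mu>0 J sC0])
      also have "\<dots> = scale (h f') (base_change h I0 (\<lambda>v. v) a)"
        by (rule base_change_scaled[OF h]) (simp add: \<mu>0_def C0_def G\<sigma>' CMe \<mu>'e)
      finally show ?thesis by (simp add: base_change_ident[OF h f(2) a] F_def)
    qed
    show "C (\<mu>1 u) = scale F (E u)" for u
    proof -
      have "C (\<mu>1 u) = base_change h J (\<lambda>v. C0 (\<mu>0 v)) u"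
        unfolding \<mu>1_def C_def by (rule base_change_comp[OF h linC0 f(2) s\<mu>0])
      also have "\<dots> = scale (h f') (base_change h J E0 u)"
        by (rule base_change_scaled[OF h]) (simp add: \<mu>0_def C0_def E0_def CM\<mu>' lin_scale[OF lin\<sigma>])
      finally show ?thesis by (simp add: F_def E_def)
    qed
    show "supp_in I0 (\<mu>1 u)" "supp_in J (E u)" for u
      unfolding \<mu>1_def E_def by (intro supp_in_base_change[OF h] s\<mu>0 sE0)+
  qed
  obtain T where T: "lin scale scale T" "\<And>v. supp_in q.Q (T v)" "\<And>c. supp_in q.Q c \<Longrightarrow> T (q.K c) = c"
    "\<And>v. supp_in q.Ind v \<Longrightarrow> q.L (q.W v) + q.K (T v) = v" "\<And>v. T (q.L (E v)) = 0"
    using q.splitting by metis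
  let ?c = "\<lambda>v x. [:v x:]"
  \<comment> \<open>At \<open>t = 0\<close> the shift is the identity, so specialization undoes the
    base change and recovers \<open>E0\<close>.\<close>
  have h0: "poly (h p) 0 = p" for p
    unfolding h_def by (rule rhom_eqI[OF rhom_comp[OF rhom_poly rhom_lshift] rhom_id]) (auto simp: lshift_cst lshift_var)
  have specE: "spec E u = E0 u" if "supp_in J u" for u
    unfolding E_def by (rule spec_base_change[OF linE0 J that h0])
  have E0\<sigma>: "E0 (\<sigma> m) = \<sigma> m" for m by (simp add: E0_def G\<sigma>')
  have \<sigma>E: "\<sigma> m = at0 (E (?c (\<sigma> m)))" for m
    using specE[OF supp\<sigma>'[of m]] by (simp add: E0\<sigma> spec_def)
  have suppW: "supp_in J (q.W u)" for u using q.suppE[of "q.W u"] by (simp add: q.E_W)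
  have E0W: "E0 (at0 (q.W u)) = at0 (q.W u)" for u
    using specE[OF supp_in_at0[OF suppW[of u]]] by (simp add: spec_at0[OF q.linE] q.E_W)
  have \<sigma>GW: "\<sigma> (G (spec q.W u)) = at0 (q.W (?c u))" for u
    using E0W[of "?c u"] by (simp add: E0_def spec_def)
  have "stably_free smul q.Ind q.Q"
    unfolding stably_free_def
  proof (intro exI conjI allI impI)
    show "lin scale smul (\<lambda>v. G (spec q.W v))" by (rule lin_comp[OF lin_spec[OF q.linW] linG])
    show "lin smul scale (\<lambda>m. spec q.L (\<sigma> m))" by (rule lin_comp[OF lin\<sigma> lin_spec[OF q.linL]])
    show "lin scale scale (spec q.K)" "lin scale scale (spec T)" by (intro lin_spec q.linK T(1))+
    show "supp_in q.Ind (spec q.L (\<sigma> m))" for m unfolding spec_def by (intro supp_in_at0 q.supp_L)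
    show "supp_in q.Ind (spec q.K v)" if "supp_in q.Q v" for v
      unfolding spec_def by (intro supp_in_at0 q.supp_K supp_in_const that)
    show "supp_in q.Q (spec T v)" for v unfolding spec_def by (intro supp_in_at0 T(2))
    show "G (spec q.W (spec q.L (\<sigma> m))) = m" for m
    proof -
      have "spec q.W (spec q.L (\<sigma> m)) = at0 (q.W (q.L (?c (\<sigma> m))))"
        unfolding spec_def[of q.L] by (rule spec_at0[OF q.linW])
      also have "\<dots> = \<sigma> m" using \<sigma>E[of m] by (simp add: q.W_L[OF supp_in_const[OF supp\<sigma>']])
      finally show ?thesis by (simp add: G\<sigma>')
    qed
    show "G (spec q.W (spec q.K u)) = 0" if u: "supp_in q.Q u" for u
    proof -
      have "spec q.W (spec q.K u) = at0 (q.W (q.K (?c u)))"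
        unfolding spec_def[of q.K] by (rule spec_at0[OF q.linW])
      then show ?thesis by (simp add: q.W_K[OF supp_in_const[OF u]] at0_simps lin_zero[OF linG])
    qed
    show "spec T (spec q.K u) = u" if u: "supp_in q.Q u" for u
    proof -
      have "spec T (spec q.K u) = at0 (T (q.K (?c u)))"
        unfolding spec_def[of q.K] by (rule spec_at0[OF T(1)])
      then show ?thesis by (simp add: T(3)[OF supp_in_const[OF u]] at0_const)
    qed
    show "spec q.L (\<sigma> (G (spec q.W u))) + spec q.K (spec T u) = u" if u: "supp_in q.Ind u" for u
    proof -
      have "spec q.K (spec T u) = at0 (q.K (T (?c u)))"
        unfolding spec_def[of T] by (rule spec_at0[OF q.linK])
      moreover have "spec q.L (\<sigma> (G (spec q.W u))) = at0 (q.L (q.W (?c u)))"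
        unfolding \<sigma>GW by (rule spec_at0[OF q.linL])
      ultimately show ?thesis
        by (simp add: at0_simps(1)[symmetric] T(4)[OF supp_in_const[OF u]] at0_const)
    qed
    show "spec T (spec q.L (\<sigma> m)) = 0" for m
    proof -
      have "spec q.L (\<sigma> m) = at0 (q.L (E (?c (\<sigma> m))))"
        by (subst \<sigma>E) (rule spec_at0[OF q.linL])
      then have "spec T (spec q.L (\<sigma> m)) = at0 (T (q.L (E (?c (\<sigma> m)))))"
        by (simp add: spec_at0[OF T(1)])
      then show ?thesis by (simp add: T(5) at0_simps)
    qed
  qed
  then show ?thesis using q.finInd q.finQ by blast
qed

theorem free:
  assumes "alg_closed TYPE('k)"
  obtains d :: nat and W L where "lin scale smul W" "lin smul scale L" "\<And>m. supp_in {..<d} (L m)"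
    "\<And>m. W (L m) = m" "\<And>v. supp_in {..<d} v \<Longrightarrow> L (W v) = v"
proof -
  obtain I :: "('m + nat \<times> nat) set" and Q :: "(nat \<times> nat) set" where "finite Q" "finite I" "stably_free smul I Q"
    using stably_free by blast
  from stably_free_imp_free[OF assms module_axioms this] show ?thesis
  proof (elim exE conjE)
    fix I' :: "('m + nat \<times> nat) set" and W L
    assume I': "finite I'" and lins: "lin scale smul W" "lin smul scale L"
      and supp: "\<forall>m. supp_in I' (L m)" and WL: "\<forall>m. W (L m) = m" and LW: "\<forall>v. supp_in I' v \<longrightarrow> L (W v) = v"
    obtain e where e: "bij_betw e {..<card I'} I'"
      using ex_bij_betw_nat_finite[OF I'] by (auto simp: atLeast0LessThan)
    define e' where "e' = inv_into {..<card I'} e"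
    have e': "e' a < card I'" "e (e' a) = a" if "a \<in> I'" for a
      using e that bij_betw_inv_into_right[OF e] bij_betwE[OF bij_betw_inv_into[OF e]] by (auto simp: e'_def)
    have ee: "e' (e j) = j" "e j \<in> I'" if "j < card I'" for j
      using e that bij_betw_inv_into_left[OF e] bij_betwE[OF e] by (auto simp: e'_def)
    define up where "up u = (\<lambda>a. if a \<in> I' then u (e' a) else 0)" for u :: "nat \<Rightarrow> ('n, 'k) mpoly"
    define down where "down u = (\<lambda>j. if j < card I' then u (e j) else 0)" for u :: "_ \<Rightarrow> ('n, 'k) mpoly"
    have lup: "lin scale scale up" and ldown: "lin scale scale down"
      by (auto simp: lin_def up_def down_def scale_def fun_eq_iff)
    have ud: "up (down u) = u" if "supp_in I' u" for u
      using that e' by (auto simp: up_def down_def supp_in_def fun_eq_iff)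
    have du: "down (up u) = u" if "supp_in {..<card I'} u" for u
      using that ee by (auto simp: up_def down_def supp_in_def fun_eq_iff)
    show ?thesis
    proof (rule that[of "\<lambda>v. W (up v)" "\<lambda>m. down (L m)" "card I'"])
      show "lin scale smul (\<lambda>v. W (up v))" by (rule lin_comp[OF lup lins(1)])
      show "lin smul scale (\<lambda>m. down (L m))" by (rule lin_comp[OF lins(2) ldown])
      show "supp_in {..<card I'} (down (L m))" for m by (simp add: supp_in_def down_def)
      show "W (up (down (L m))) = m" for m by (simp add: ud supp WL)
      have "supp_in I' (up v)" for v by (simp add: supp_in_def up_def)
      then show "down (L (W (up v))) = v" if "supp_in {..<card I'} v" for v
        by (simp add: LW du that)
    qed
  qed
qed

end

subsection \<open>Taylor expansion\<close>

text \<open>Polynomials in \<open>x\<close> and \<open>y\<close> are polynomials in \<open>y\<close> with coefficients in \<open>k[x]\<close>: here \<open>cst (var i)\<close> is \<open>x\<^sub>i\<close>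
  and \<open>var i\<close> is \<open>y\<^sub>i\<close>. The following maps send \<open>f\<close> to \<open>f(y)\<close>, \<open>f(x + y)\<close> and \<open>f(y - x)\<close>.\<close>

type_synonym ('n, 'k) mpoly2 = "('n, ('n, 'k) mpoly) mpoly"

definition in_y :: "('n::finite, 'k::comm_ring_1) mpoly \<Rightarrow> ('n, 'k) mpoly2" where
  "in_y = evh (\<lambda>c. cst (cst c)) var"

definition taylor :: "('n::finite, 'k::comm_ring_1) mpoly \<Rightarrow> ('n, 'k) mpoly2" where
  "taylor = evh (\<lambda>c. cst (cst c)) (\<lambda>i. cst (var i) + var i)"

definition in_diff :: "('n::finite, 'k::comm_ring_1) mpoly \<Rightarrow> ('n, 'k) mpoly2" where
  "in_diff = evh (\<lambda>c. cst (cst c)) (\<lambda>i. var i - cst (var i))"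

lemma rhom_cst_cst: "rhom (\<lambda>c. cst (cst c))"
  by (intro rhom_comp[OF rhom_cst rhom_cst])

lemma rhom_in_y: "rhom in_y" and rhom_taylor: "rhom taylor" and rhom_in_diff: "rhom in_diff"
  unfolding in_y_def taylor_def in_diff_def by (intro rhom_evh rhom_cst_cst)+

lemma two_var_simps:
  "in_y (cst c) = cst (cst c)" "in_y (var i) = var i"
  "taylor (cst c) = cst (cst c)" "taylor (var i) = cst (var i) + var i"
  "in_diff (cst c) = cst (cst c)" "in_diff (var i) = var i - cst (var i)"
  unfolding in_y_def taylor_def in_diff_def by (simp_all add: evh_cst evh_var rhom_cst_cst)

lemma xmon_eq_prod:
  fixes a :: "'n::finite \<Rightarrow>\<^sub>0 nat"
  shows "xmon a = (\<Prod>i\<in>UNIV. var i ^ lookup a i :: ('n, 'k::comm_ring_1) mpoly)"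
proof -
  have "subst var (xmon a :: ('n, 'k) mpoly) = (\<Prod>i\<in>UNIV. var i ^ lookup a i)"
    by (rule evh_xmon[OF rhom_cst])
  then show ?thesis by (simp only: subst_var_id)
qed

lemma in_y_single: "in_y (single a c) = single a (cst c)"
  unfolding in_y_def evh_single[OF rhom_cst_cst]
  by (simp add: xmon_eq_prod[symmetric] single_eq_cst_xmon)

lemma in_y_xmon: "in_y (xmon k) = xmon k"
  by (simp add: xmon_def in_y_single)

lemma ev_zero:
  fixes p :: "('n::finite, 'k::comm_ring_1) mpoly"
  shows "ev (\<lambda>_. 0) p = lookup p 0"
proof (induction p rule: mpoly_single_induct)
  case (single a c)
  show ?case
  proof (cases "a = 0")
    case False
    then obtain i where "lookup a i \<noteq> 0" by (metis poly_mapping_eqI lookup_zero)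
    then have "(\<Prod>i\<in>UNIV. (0::'k) ^ lookup a i) = 0"
      by (intro prod_zero) (auto intro!: bexI[of _ i] simp: power_0_left)
    then show ?thesis using False by (simp add: evh_single[OF rhom_id] lookup_single)
  qed (simp add: evh_single[OF rhom_id])
qed (simp add: rhom.hs[OF rhom_ev] lookup_add)

lemma pd_taylor: "pd j (taylor f) = taylor (pd j f)"
proof -
  have "pd j (taylor f) = (\<Sum>i\<in>UNIV. taylor (pd i f) * pd j (taylor (var i)))"
    by (rule derivation_chain[OF rhom_taylor])
      (simp_all add: rhom.hs[OF rhom_taylor] pd_add pd_mult two_var_simps algebra_simps)
  also have "\<dots> = (\<Sum>i\<in>UNIV. if i = j then taylor (pd i f) else 0)"
    by (rule sum.cong) (auto simp: two_var_simps pd_add pd_var)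
  finally show ?thesis by simp
qed

lemma pd_in_diff: "pd j (in_diff f) = in_diff (pd j f)"
proof -
  have "pd j (in_diff f) = (\<Sum>i\<in>UNIV. in_diff (pd i f) * pd j (in_diff (var i)))"
    by (rule derivation_chain[OF rhom_in_diff])
      (simp_all add: rhom.hs[OF rhom_in_diff] pd_add pd_mult two_var_simps algebra_simps)
  also have "\<dots> = (\<Sum>i\<in>UNIV. if i = j then in_diff (pd i f) else 0)"
    by (rule sum.cong) (auto simp: two_var_simps pd_diff pd_var)
  finally show ?thesis by simp
qed

lemma pdk_add: "pdk k (p + q) = pdk k p + pdk k q"
  unfolding pdk_def by (rule setsum_keys_plus_distrib) (auto simp: algebra_simps single_add)

lemma pdk_single: "pdk k (single a c) =
    (if \<forall>j. lookup k j \<le> lookup a j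
     then single (a - k) (of_nat (\<Prod>j\<in>UNIV. fact (lookup a j) div fact (lookup a j - lookup k j)) * c)
     else 0)"
  by (auto simp: pdk_def)

lemma pdk_0: "pdk 0 p = p"
proof (induction p rule: mpoly_single_induct)
  case (single a c)
  then show ?case by (simp add: pdk_single)
qed (simp add: pdk_add)

text \<open>With \<open>b = a - e_j\<close>, the quotient of factorials for \<open>k + e_j\<close>
  at \<open>a\<close> is \<open>a_j\<close> times the quotient for \<open>k\<close> at
  \<open>b\<close>.\<close>

lemma pdk_step: "pdk (k + single j 1) p = pdk k (pd j p)"
  for p :: "('n::finite, 'k::comm_ring_1) mpoly"
proof (induction p rule: mpoly_single_induct)
  case (single a c)
  define e where "e = single j (1::nat)"
  define b where "b = a - e"
  have lb: "lookup b i = lookup a i - (if i = j then 1 else 0)" for i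
    by (simp add: b_def e_def lookup_minus lookup_single when_def)
  have lk: "lookup (k + e) i = lookup k i + (if i = j then 1 else 0)" for i
    by (simp add: e_def lookup_add lookup_single when_def)
  have R: "pdk k (pd j (single a c)) = (if \<forall>i. lookup k i \<le> lookup b i
     then single (b - k) (of_nat (\<Prod>i\<in>UNIV. fact (lookup b i) div fact (lookup b i - lookup k i)) * (of_nat (lookup a j) * c))
     else 0)"
    by (simp only: pd_single pdk_single b_def e_def)
  have "pdk (k + e) (single a c) = pdk k (pd j (single a c))"
  \<comment> \<open>If \<open>a_j = 0\<close> the truncated \<open>b\<close> is meaningless, and
    both sides vanish: the left one by its order condition, the right one by its
    coefficient.\<close>
  proof (cases "lookup a j = 0")
    case True
    then have "\<not> lookup (k + e) j \<le> lookup a j" by (subst lk) simp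
    then have "pdk (k + e) (single a c) = 0" by (auto simp only: pdk_single split: if_splits)
    then show ?thesis unfolding R using True by simp
  next
    case False
    have le: "(\<forall>i. lookup (k + e) i \<le> lookup a i) \<longleftrightarrow> (\<forall>i. lookup k i \<le> lookup b i)"
      unfolding lk lb using False by (intro all_cong1) auto
    show ?thesis
    proof (cases "\<forall>i. lookup k i \<le> lookup b i")
      case True
      have idx: "a - (k + e) = b - k"
        by (rule poly_mapping_eqI) (simp add: lookup_minus lb lk)
      have off: "(\<Prod>i\<in>UNIV - {j}. fact (lookup a i) div fact (lookup a i - lookup (k + e) i))
          = (\<Prod>i\<in>UNIV - {j}. fact (lookup b i) div fact (lookup b i - lookup k i) :: nat)"
        by (rule prod.cong) (auto simp: lb lk)
      have fj: "fact (lookup a j) = lookup a j * (fact (lookup b j) :: nat)"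
        using False by (simp add: lb fact_reduce)
      have dj: "lookup a j - lookup (k + e) j = lookup b j - lookup k j" by (simp add: lb lk)
      have "fact (lookup b j - lookup k j) dvd (fact (lookup b j) :: nat)" by (simp add: fact_dvd)
      then have at: "fact (lookup a j) div fact (lookup a j - lookup (k + e) j)
          = lookup a j * (fact (lookup b j) div fact (lookup b j - lookup k j) :: nat)"
        unfolding dj fj by (rule div_mult_swap[symmetric])
      have "(\<Prod>i\<in>UNIV. fact (lookup a i) div fact (lookup a i - lookup (k + e) i))
          = lookup a j * (\<Prod>i\<in>UNIV. fact (lookup b i) div fact (lookup b i - lookup k i) :: nat)"
        by (subst (1 2) prod.remove[of UNIV j]) (simp_all only: finite UNIV_I off at mult.assoc)
      then have "pdk (k + e) (single a c) = single (b - k)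
          (of_nat (lookup a j * (\<Prod>i\<in>UNIV. fact (lookup b i) div fact (lookup b i - lookup k i) :: nat)) * c)"
        using le True by (simp only: pdk_single idx if_True simp_thms)
      then show ?thesis using True by (simp only: R if_True simp_thms) (simp add: mult_ac)
    next
      case False
      then show ?thesis using le by (simp only: pdk_single R if_False simp_thms)
    qed
  qed
  then show ?case by (simp only: e_def)
qed (simp add: pdk_add pd_add)

lemma mfact_step: "mfact (k + single j 1) = (lookup k j + 1) * mfact k"
proof -
  have "(\<Prod>i\<in>UNIV - {j}. fact (lookup (k + single j 1) i)) = (\<Prod>i\<in>UNIV - {j}. fact (lookup k i) :: nat)"
    by (rule prod.cong) (auto simp: lookup_add lookup_single when_def)
  then show ?thesis
    unfolding mfact_def by (subst (1 2) prod.remove[of UNIV j]) (simp_all add: lookup_add algebra_simps)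
qed

text \<open>Differentiation in \<open>y\<close> commutes with the expansion of
  \<open>f(x + y)\<close> and brings down the factor \<open>k_j + 1\<close> by which
  \<open>k!\<close> grows.\<close>

lemma lookup_taylor_mfact: "of_nat (mfact k) * lookup (taylor f) k = pdk k f"
proof (induction k arbitrary: f rule: exponent_induct)
  case zero
  have "lookup (taylor f) 0 = f"
    unfolding ev_zero[symmetric]
    by (rule rhom_eqI[OF rhom_comp[OF rhom_ev rhom_taylor] rhom_id])
      (auto simp: two_var_simps rhom.hs[OF rhom_ev])
  then show ?case by (simp add: pdk_0 mfact_def)
next
  case (step k j)
  have "pdk (k + single j 1) f = of_nat (mfact k) * lookup (pd j (taylor f)) k"
    by (simp only: pdk_step step[symmetric] pd_taylor)
  also have "\<dots> = of_nat (mfact (k + single j 1)) * lookup (taylor f) (k + single j 1)"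
    by (simp only: lookup_pd mfact_step of_nat_mult mult_ac)
  finally show ?case by simp
qed

lemma lookup_taylor:
  fixes f :: "('n::finite, 'k::field_char_0) mpoly"
  shows "lookup (taylor f) k = cst (inverse (of_nat (mfact k))) * pdk k f"
proof -
  have "mfact k \<noteq> 0" by (simp add: mfact_def)
  then have "cst (inverse (of_nat (mfact k)) * of_nat (mfact k)) = (1 :: ('n, 'k) mpoly)" by simp
  moreover have "cst (of_nat (mfact k)) = (of_nat (mfact k) :: ('n, 'k) mpoly)"
    by (rule rhom.h_of_nat[OF rhom_cst])
  ultimately have "cst (inverse (of_nat (mfact k))) * of_nat (mfact k) = (1 :: ('n, 'k) mpoly)"
    by (simp only: cst_mult)
  then show ?thesis
    unfolding lookup_taylor_mfact[symmetric] by (simp add: mult.assoc[symmetric])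
qed

lemma taylor_shift: "evh cst (\<lambda>i. var i - cst (var i)) (taylor f) = in_y f"
  and in_diff_eq: "evh cst (\<lambda>i. var i - cst (var i)) (in_y f) = in_diff f"
  for f :: "('n::finite, 'k::comm_ring_1) mpoly"
proof -
  have r: "rhom (evh cst (\<lambda>i. var i - cst (var i) :: ('n, 'k) mpoly2))" by (rule rhom_subst)
  show "evh cst (\<lambda>i. var i - cst (var i)) (taylor f) = in_y f"
    by (rule rhom_eqI[OF rhom_comp[OF r rhom_taylor] rhom_in_y]) (auto simp: two_var_simps rhom.hs[OF r])
  show "evh cst (\<lambda>i. var i - cst (var i)) (in_y f) = in_diff f"
    by (rule rhom_eqI[OF rhom_comp[OF r rhom_in_y] rhom_in_diff]) (auto simp: two_var_simps rhom.hs[OF r])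
qed

text \<open>Taylor's formula \<open>f(y) = \<Sum>\<^sub>k (\<partial>\<^sup>k f)(x) / k! \<cdot> (y - x)\<^sup>k\<close>.\<close>

lemma in_y_expansion: "in_y f = (\<Sum>k\<in>keys (taylor f). cst (lookup (taylor f) k) * in_diff (xmon k))"
  for f :: "('n::finite, 'k::comm_ring_1) mpoly"
proof -
  let ?s = "evh cst (\<lambda>i. var i - cst (var i) :: ('n, 'k) mpoly2)"
  have r: "rhom ?s" by (rule rhom_subst)
  have x: "?s (xmon k) = in_diff (xmon k)" for k
  proof -
    show ?thesis using in_diff_eq[of "xmon k :: ('n, 'k) mpoly"] by (simp add: in_y_xmon)
  qed
  have "?s (taylor f) = ?s (\<Sum>k\<in>keys (taylor f). single k (lookup (taylor f) k))"
    by (simp add: mpoly_eq_sum[symmetric])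
  also have "\<dots> = (\<Sum>k\<in>keys (taylor f). cst (lookup (taylor f) k) * in_diff (xmon k))"
    by (simp add: rhom.hs[OF r] single_eq_cst_xmon x)
  finally show ?thesis by (simp add: taylor_shift)
qed

section \<open>The derivative in \<open>x\<close> with \<open>y\<close> held fixed, and the
  diagonal\<close>

definition pdx :: "'n \<Rightarrow> ('n::finite, 'k::comm_ring_1) mpoly2 \<Rightarrow> ('n, 'k) mpoly2" where
  "pdx j P = (\<Sum>k\<in>keys P. single k (pd j (lookup P k)))"

lemma pdx_add: "pdx j (P + Q) = pdx j P + pdx j Q"
  unfolding pdx_def by (rule setsum_keys_plus_distrib) (simp_all add: pd_add single_add)

lemma pdx_single: "pdx j (single k c) = single k (pd j c)"
  by (simp add: pdx_def)

lemma pdx_mult: "pdx j (P * Q) = pdx j P * Q + P * pdx j Q"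
proof (induction P rule: mpoly_single_induct)
  case (single k c)
  show ?case
  proof (induction Q rule: mpoly_single_induct)
    case (single l d)
    show ?case by (simp add: mult_single pdx_single pd_mult single_add)
  qed (simp add: pdx_add algebra_simps)
qed (simp add: pdx_add algebra_simps)

lemma pdx_cst: "pdx j (cst c) = cst (pd j c)"
  by (simp add: cst_def pdx_single)

lemma pdx_diff: "pdx j (P - Q) = pdx j P - pdx j Q"
  using pdx_add[of j "P - Q" Q] by simp

text \<open>A function of \<open>y - x\<close> is invariant under simultaneous translation of
  \<open>x\<close> and \<open>y\<close>.\<close>

lemma pdx_in_diff:
  fixes f :: "('n::finite, 'k::comm_ring_1) mpoly"
  shows "pdx j (in_diff f) + pd j (in_diff f) = 0"
proof -
  have v: "pdx j (in_diff (var i :: ('n, 'k) mpoly)) + pd j (in_diff (var i)) = 0" for i :: 'n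
  proof -
    have "pdx j (var i :: ('n, 'k) mpoly2) = 0"
      by (simp add: var_def xmon_def pdx_single)
    then show ?thesis by (auto simp: two_var_simps pdx_diff pd_diff pd_var pdx_cst)
  qed
  have "pdx j (in_diff f) + pd j (in_diff f)
      = (\<Sum>i\<in>UNIV. in_diff (pd i f) * (pdx j (in_diff (var i)) + pd j (in_diff (var i))))"
    by (rule derivation_chain[OF rhom_in_diff])
      (simp_all add: rhom.hs[OF rhom_in_diff] pd_add pd_mult pdx_add pdx_mult pdx_cst two_var_simps algebra_simps)
  then show ?thesis by (simp add: v)
qed

text \<open>Restriction to the diagonal \<open>y = x\<close>.\<close>

definition diag :: "('n::finite, 'k::comm_ring_1) mpoly2 \<Rightarrow> ('n, 'k) mpoly" where
  "diag = evh (\<lambda>c. c) var"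

lemma rhom_diag: "rhom diag"
  unfolding diag_def by (intro rhom_evh rhom_id)

lemma diag_single: "diag (single k c) = c * xmon k"
  by (simp add: diag_def evh_single[OF rhom_id] xmon_eq_prod)

lemma diag_in_diff:
  fixes f :: "('n::finite, 'k::comm_ring_1) mpoly"
  shows "diag (in_diff f) = cst (lookup f 0)"
  unfolding ev_zero[symmetric]
proof (rule rhom_eqI[OF rhom_comp[OF rhom_diag rhom_in_diff] rhom_comp[OF rhom_cst rhom_ev]])
  have dc: "diag (cst c) = c" for c :: "('n, 'k) mpoly"
    unfolding diag_def by (rule evh_cst[OF rhom_id])
  have dv: "diag (var i) = (var i :: ('n, 'k) mpoly)" for i :: 'n
    unfolding diag_def by (rule evh_var[OF rhom_id])
  show "diag (in_diff (cst c :: ('n, 'k) mpoly)) = cst (ev (\<lambda>_. 0) (cst c :: ('n, 'k) mpoly))" for c :: 'k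
    by (simp only: two_var_simps dc ev_cst)
  show "diag (in_diff (var i :: ('n, 'k) mpoly)) = cst (ev (\<lambda>_. 0) (var i :: ('n, 'k) mpoly))" for i :: 'n
    by (simp only: two_var_simps rhom.hs[OF rhom_diag] dc dv ev_var cst_0 diff_self)
qed

subsection \<open>Gauge modules\<close>

lemma fdx_simps:
  fixes p q :: "('n::finite, 'k::comm_ring_1) mpoly"
  shows "fdx (p + q) i = (\<lambda>j. fdx p i j + fdx q i j)" and "fdx (c * p) i = (\<lambda>j. c * fdx p i j)"
  by (auto simp: fdx_def)

lemma vf_app_fdx: "vf_app (fdx p i) f = p * pd i f"
proof -
  have "vf_app (fdx p i) f = (\<Sum>j\<in>UNIV. if j = i then p * pd j f else 0)"
    unfolding vf_app_def fdx_def by (rule sum.cong) auto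
  then show ?thesis by simp
qed

lemma vf_bracket_fdx: "vf_bracket (fdx p i) (fdx q j) = (\<lambda>l. fdx (p * pd i q) j l - fdx (q * pd j p) i l)"
  unfolding vf_bracket_def vf_app_fdx by (rule ext) (auto simp: fdx_def)

locale av_module =
  fixes smul :: "('n::finite, 'k::field_char_0) mpoly \<Rightarrow> 'm::ab_group_add \<Rightarrow> 'm"
    and act :: "('n, 'k) vfield \<Rightarrow> 'm \<Rightarrow> 'm"
  assumes av: "AV_module smul act"
begin

lemma av_simps:
  "smul (f + g) m = smul f m + smul g m" "smul f (m + m') = smul f m + smul f m'"
  "smul (f * g) m = smul f (smul g m)" "smul 1 m = m"
  "act (\<lambda>i. \<eta> i + \<xi> i) m = act \<eta> m + act \<xi> m" "act (\<lambda>i. cst c * \<eta> i) m = smul (cst c) (act \<eta> m)"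
  "act \<eta> (m + m') = act \<eta> m + act \<eta> m'"
  "act (vf_bracket \<eta> \<xi>) m = act \<eta> (act \<xi> m) - act \<xi> (act \<eta> m)"
  "act \<eta> (smul f m) = smul f (act \<eta> m) + smul (vf_app \<eta> f) m"
  using av unfolding AV_module_def by simp_all

sublocale module smul
  by unfold_locales (simp_all add: av_simps)

lemmas av_rules = av_simps(1,2,5-7,9)

definition D :: "'n \<Rightarrow> 'm \<Rightarrow> 'm" where
  "D i = act (fdx 1 i)"

lemma D_add: "D i (m + m') = D i m + D i m'"
  and D_smul: "D i (smul a m) = smul a (D i m) + smul (pd i a) m"
  by (simp_all add: D_def av_rules vf_app_fdx)

lemma act_diff: "act (\<lambda>i. \<eta> i - \<xi> i) m = act \<eta> m - act \<xi> m"
proof -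
  have "act (\<lambda>i. \<eta> i + cst (- 1) * \<xi> i) m = act \<eta> m + smul (cst (- 1)) (act \<xi> m)"
    by (simp only: av_simps(5,6))
  then show ?thesis by (simp add: cst_uminus)
qed

lemma act_zero: "act (\<lambda>i. 0) m = 0"
  using act_diff[of "\<lambda>_. 0" "\<lambda>_. 0" m] by simp

text \<open>The \<open>k[x]\<close>-linear extension of \<open>f(y) \<mapsto> act (f \<partial>\<^sub>i)\<close>.\<close>

definition act2 :: "'n \<Rightarrow> ('n, 'k) mpoly2 \<Rightarrow> 'm \<Rightarrow> 'm" where
  "act2 i P m = (\<Sum>k\<in>keys P. smul (lookup P k) (act (fdx (xmon k) i) m))"

lemma act2_add: "act2 i (P + Q) m = act2 i P m + act2 i Q m"
  unfolding act2_def by (rule setsum_keys_plus_distrib) (simp_all add: av_rules)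

lemma act2_single: "act2 i (single k c) m = smul c (act (fdx (xmon k) i) m)"
  by (simp add: act2_def)

lemma act2_zero: "act2 i 0 m = 0"
  by (simp add: act2_def)

lemma act2_diff: "act2 i (P - Q) m = act2 i P m - act2 i Q m"
  using act2_add[of i "P - Q" Q m] by simp

lemma act2_sum: "act2 i (sum h X) m = (\<Sum>x\<in>X. act2 i (h x) m)"
  by (induction X rule: infinite_finite_induct) (auto simp: act2_add act2_zero)

lemma act2_cst_mult: "act2 i (cst c * P) m = smul c (act2 i P m)"
proof (induction P rule: mpoly_single_induct)
  case (single k d)
  then show ?case by (simp add: cst_def mult_single act2_single)
qed (simp add: act2_add av_rules algebra_simps)

lemma act2_arg_add: "act2 i P (m + m') = act2 i P m + act2 i P m'"
  by (simp add: act2_def av_rules sum.distrib)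

lemma act2_arg_sum: "act2 i P (sum h X) = (\<Sum>x\<in>X. act2 i P (h x))"
proof -
  have "act2 i P 0 = 0" using act2_arg_add[of i P 0 0] by simp
  then show ?thesis by (induction X rule: infinite_finite_induct) (auto simp: act2_arg_add)
qed

lemma act2_in_y: "act2 i (in_y f) m = act (fdx f i) m"
proof (induction f rule: mpoly_single_induct)
  case (single a c)
  show ?case
    by (simp add: in_y_single act2_single) (simp add: single_eq_cst_xmon fdx_simps av_rules)
next
  case (add p q)
  then show ?case by (simp add: rhom.hs[OF rhom_in_y] act2_add fdx_simps av_rules)
qed

text \<open>The failure of linearity depends on \<open>P\<close> only through the diagonal, so
  operators of polynomials vanishing there are linear over \<open>k[x]\<close>.\<close>

lemma act2_smul: "act2 i P (smul g m) = smul g (act2 i P m) + smul (diag P * pd i g) m"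
proof (induction P rule: mpoly_single_induct)
  case (single k c)
  show ?case
    by (simp add: act2_single av_rules vf_app_fdx diag_single) (simp add: mult.commute mult.left_commute)
qed (simp add: act2_add rhom.hs[OF rhom_diag] av_rules algebra_simps)

lemma pd_xmon_in_y: "pd j (xmon k :: ('n, 'k) mpoly2) = in_y (pd j (xmon k))"
  by (simp add: xmon_def pd_single in_y_single rhom.h_of_nat[OF rhom_cst])

text \<open>The Leibniz rule differentiates the coefficients in \<open>x\<close>; the bracket of
  \<open>d/dx_j\<close> with \<open>x^k d/dx_i\<close> contributes the derivative in
  \<open>y\<close>.\<close>

lemma D_act2: "D j (act2 i P m) = act2 i P (D j m) + act2 i (pdx j P + pd j P) m"
proof (induction P rule: mpoly_single_induct)
  case (single k c)
  have "act (vf_bracket (fdx 1 j) (fdx (xmon k) i)) m = act2 i (pd j (xmon k)) m"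
    by (simp add: vf_bracket_fdx pd_xmon_in_y act2_in_y) (simp add: fdx_def)
  then have "D j (act (fdx (xmon k) i) m) = act (fdx (xmon k) i) (D j m) + act2 i (pd j (xmon k)) m"
    using av_simps(8)[of "fdx 1 j" "fdx (xmon k) i" m] by (simp add: D_def diff_eq_eq add.commute)
  moreover have "pd j (single k c) = cst c * pd j (xmon k)"
    by (simp add: single_eq_cst_xmon pd_mult)
  ultimately show ?case
    by (simp only: act2_single D_smul act2_add pdx_single act2_cst_mult av_simps(2) add_ac)
next
  case (add P Q)
  have "D j (act2 i (P + Q) m) = D j (act2 i P m) + D j (act2 i Q m)"
    by (simp only: act2_add D_add)
  also have "\<dots> = act2 i (P + Q) (D j m) + act2 i (pdx j (P + Q) + pd j (P + Q)) m"
    unfolding add.IH by (simp only: act2_add pdx_add pd_add add_ac)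
  finally show ?case .
qed

text \<open>The bracket of an action Lie algebroid: the terms with \<open>pd\<close> come from the
  bracket of vector fields in \<open>y\<close>, the terms with \<open>pdx\<close> from letting the
  diagonal value of one field differentiate the coefficients of the other.\<close>

lemma act2_commutator:
  "act2 i P (act2 j Q m) - act2 j Q (act2 i P m)
    = act2 j (cst (diag P) * pdx i Q + P * pd i Q) m - act2 i (cst (diag Q) * pdx j P + Q * pd j P) m"
proof (induction P rule: mpoly_single_induct)
  case (single k c)
  show ?case
  proof (induction Q rule: mpoly_single_induct)
    case (single l d)
    let ?X = "fdx (xmon k) i" and ?Y = "fdx (xmon l) j"
    have m1: "single k c * pd i (single l d) = cst (c * d) * in_y (xmon k * pd i (xmon l))"
      by (simp add: single_eq_cst_xmon pd_mult pd_xmon_in_y rhom.h_mult[OF rhom_in_y] in_y_xmon cst_mult mult_ac)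
    have m2: "single l d * pd j (single k c) = cst (c * d) * in_y (xmon l * pd j (xmon k))"
      by (simp add: single_eq_cst_xmon pd_mult pd_xmon_in_y rhom.h_mult[OF rhom_in_y] in_y_xmon cst_mult mult_ac)
    have br: "act (fdx (xmon k * pd i (xmon l)) j) m - act (fdx (xmon l * pd j (xmon k)) i) m
        = act ?X (act ?Y m) - act ?Y (act ?X m)"
      by (simp add: av_simps(8)[symmetric] vf_bracket_fdx act_diff)
    have l1: "act2 i (single k c) (act2 j (single l d) m)
        = smul (c * d) (act ?X (act ?Y m)) + smul (c * (xmon k * pd i d)) (act ?Y m)"
      by (simp add: act2_single av_simps(9) vf_app_fdx scale_right_distrib)
    have l2: "act2 j (single l d) (act2 i (single k c) m)
        = smul (c * d) (act ?Y (act ?X m)) + smul (d * (xmon l * pd j c)) (act ?X m)"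
      by (simp add: act2_single av_simps(9) vf_app_fdx scale_right_distrib mult.commute[of c d])
    have r1: "act2 j (cst (diag (single k c)) * pdx i (single l d)) m
        = smul (c * (xmon k * pd i d)) (act ?Y m)"
      by (simp add: diag_single pdx_single act2_cst_mult act2_single mult.assoc)
    have r2: "act2 i (cst (diag (single l d)) * pdx j (single k c)) m
        = smul (d * (xmon l * pd j c)) (act ?X m)"
      by (simp add: diag_single pdx_single act2_cst_mult act2_single mult.assoc)
    have r3: "act2 j (single k c * pd i (single l d)) m
        = smul (c * d) (act (fdx (xmon k * pd i (xmon l)) j) m)"
      unfolding m1 act2_cst_mult act2_in_y ..
    have r4: "act2 i (single l d * pd j (single k c)) m
        = smul (c * d) (act (fdx (xmon l * pd j (xmon k)) i) m)"
      unfolding m2 act2_cst_mult act2_in_y ..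
    have br': "smul (c * d) (act (fdx (xmon k * pd i (xmon l)) j) m) - smul (c * d) (act (fdx (xmon l * pd j (xmon k)) i) m)
        = smul (c * d) (act ?X (act ?Y m)) - smul (c * d) (act ?Y (act ?X m))"
      unfolding scale_right_diff_distrib[symmetric] br ..
    have ab: "(A + B) - (A' + B') = (B + C) - (B' + C')" if "C - C' = A - A'" for A A' B B' C C' :: 'm
      using that by (simp add: algebra_simps)
    show ?case
      unfolding l1 l2 act2_add r1 r2 r3 r4 using br' by (rule ab)
  next
    case (add Q Q')
    have ab: "(a + b) - (a' + b') = (c + c') - (d + d')" if "a - a' = c - d" "b - b' = c' - d'" for a a' b b' c c' d d' :: 'm
      using arg_cong2[OF that, of "(+)"] by (simp add: algebra_simps)
    have s1: "cst (diag P) * pdx i (Q + Q') + P * pd i (Q + Q')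
        = (cst (diag P) * pdx i Q + P * pd i Q) + (cst (diag P) * pdx i Q' + P * pd i Q')"
      and s2: "cst (diag (Q + Q')) * pdx j P + (Q + Q') * pd j P
        = (cst (diag Q) * pdx j P + Q * pd j P) + (cst (diag Q') * pdx j P + Q' * pd j P)" for P
      by (simp_all add: pdx_add pd_add rhom.h_add[OF rhom_diag] rhom.h_add[OF rhom_cst] algebra_simps)
    show ?case
      unfolding s1 s2 act2_add[of _ Q Q'] act2_arg_add act2_add[of _ "cst _ * _ + _" "cst _ * _ + _"]
      by (rule ab[OF add.IH])
  qed
next
  case (add P P')
  have ab: "(a + b) - (a' + b') = (c + c') - (d + d')" if "a - a' = c - d" "b - b' = c' - d'" for a a' b b' c c' d d' :: 'm
    using arg_cong2[OF that, of "(+)"] by (simp add: algebra_simps)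
  have s1: "cst (diag (P + P')) * pdx i Q + (P + P') * pd i Q
      = (cst (diag P) * pdx i Q + P * pd i Q) + (cst (diag P') * pdx i Q + P' * pd i Q)"
    and s2: "cst (diag Q) * pdx j (P + P') + Q * pd j (P + P')
      = (cst (diag Q) * pdx j P + Q * pd j P) + (cst (diag Q) * pdx j P' + Q * pd j P')"
    by (simp_all add: pdx_add pd_add rhom.h_add[OF rhom_diag] rhom.h_add[OF rhom_cst] algebra_simps)
  show ?case
    unfolding s1 s2 act2_add[of _ P P'] act2_arg_add act2_add[of _ "cst _ * _ + _" "cst _ * _ + _"]
    by (rule ab[OF add.IH])
qed

text \<open>By Taylor's formula the action of \<open>f \<partial>\<^sub>i\<close> is a combination of the operators attached to \<open>(y - x)\<^sup>k\<close>. If \<open>\<eta>\<close>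
  vanishes at the origin then \<open>\<eta>(y - x)\<close> vanishes on the diagonal, which makes its operator linear.\<close>

definition rep :: "('n, 'k) vfield \<Rightarrow> 'm \<Rightarrow> 'm" where
  "rep \<eta> m = (\<Sum>i\<in>UNIV. act2 i (in_diff (\<eta> i)) m)"

lemma rep_add: "rep (\<lambda>i. \<eta> i + \<xi> i) m = rep \<eta> m + rep \<xi> m"
  by (simp add: rep_def rhom.hs[OF rhom_in_diff] act2_add sum.distrib)

lemma rep_cst: "rep (\<lambda>i. cst c * \<eta> i) m = smul (cst c) (rep \<eta> m)"
  by (simp add: rep_def rhom.hs[OF rhom_in_diff] two_var_simps act2_cst_mult scale_sum_right)

lemma rep_arg_add: "rep \<eta> (m + m') = rep \<eta> m + rep \<eta> m'"
  by (simp add: rep_def act2_arg_add sum.distrib)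

lemma rep_smul:
  assumes "\<eta> \<in> L_plus"
  shows "rep \<eta> (smul g m) = smul g (rep \<eta> m)"
  using assms by (simp add: rep_def act2_smul diag_in_diff L_plus_def scale_sum_right)

lemma D_rep: "D j (rep \<eta> m) = rep \<eta> (D j m)"
proof -
  have D_sum: "D j (sum h X) = (\<Sum>x\<in>X. D j (h x))" for h and X :: "'n set"
  proof -
    have "D j 0 = 0" using D_add[of j 0 0] by simp
    then show ?thesis by (induction X rule: infinite_finite_induct) (auto simp: D_add)
  qed
  show ?thesis by (simp add: rep_def D_sum D_act2 pdx_in_diff act2_zero)
qed

text \<open>Both diagonal terms of the commutator vanish on \<open>L_plus\<close>, and the
  derivatives in \<open>y\<close> pass through \<open>in_diff\<close>, leaving the bracket of the
  vector fields.\<close>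

lemma rep_bracket:
  assumes "\<eta> \<in> L_plus" "\<xi> \<in> L_plus"
  shows "rep (vf_bracket \<eta> \<xi>) m = rep \<eta> (rep \<xi> m) - rep \<xi> (rep \<eta> m)"
proof -
  let ?h = "\<lambda>i. in_diff (\<eta> i)" and ?x = "\<lambda>j. in_diff (\<xi> j)"
  have "rep \<eta> (rep \<xi> m) - rep \<xi> (rep \<eta> m)
      = (\<Sum>i\<in>UNIV. \<Sum>j\<in>UNIV. act2 i (?h i) (act2 j (?x j) m) - act2 j (?x j) (act2 i (?h i) m))"
    unfolding rep_def act2_arg_sum sum_subtractf by (subst (3) sum.swap) simp
  also have "\<dots> = (\<Sum>i\<in>UNIV. \<Sum>j\<in>UNIV. act2 j (in_diff (\<eta> i * pd i (\<xi> j))) m - act2 i (in_diff (\<xi> j * pd j (\<eta> i))) m)"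
    using assms by (simp add: act2_commutator diag_in_diff L_plus_def pd_in_diff rhom.hs[OF rhom_in_diff])
  also have "\<dots> = (\<Sum>j\<in>UNIV. \<Sum>i\<in>UNIV. act2 j (in_diff (\<eta> i * pd i (\<xi> j))) m)
      - (\<Sum>i\<in>UNIV. \<Sum>j\<in>UNIV. act2 i (in_diff (\<xi> j * pd j (\<eta> i))) m)"
    unfolding sum_subtractf by (subst (1) sum.swap) simp
  also have "\<dots> = rep (vf_bracket \<eta> \<xi>) m"
    by (simp add: rep_def vf_bracket_def vf_app_def rhom.h_diff[OF rhom_in_diff] rhom.h_sum[OF rhom_in_diff]
        act2_diff act2_sum sum_subtractf)
  finally show ?thesis by simp
qed

lemma rep_fdx: "rep (fdx p i) m = act2 i (in_diff p) m"
proof -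
  have "rep (fdx p i) m = (\<Sum>j\<in>UNIV. if j = i then act2 j (in_diff p) m else 0)"
    unfolding rep_def fdx_def by (rule sum.cong) (auto simp: rhom.hs[OF rhom_in_diff] act2_zero)
  then show ?thesis by simp
qed

lemma act_expansion:
  "act (fdx f i) m = smul f (D i m) +
    (\<Sum>k\<in>{k. k \<noteq> 0 \<and> pdk k f \<noteq> 0}. smul (cst (inverse (of_nat (mfact k))) * pdk k f) (rep (fdx (xmon k) i) m))"
proof -
  let ?t = "\<lambda>k. smul (lookup (taylor f) k) (rep (fdx (xmon k) i) m)"
  have keys: "k \<in> keys (taylor f) \<longleftrightarrow> pdk k f \<noteq> 0" for k
  proof -
    have "cst (inverse (of_nat (mfact k))) \<noteq> (0 :: ('n, 'k) mpoly)" by (simp add: mfact_def)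
    then show ?thesis by (simp add: in_keys_iff lookup_taylor mpoly_no_zero_divisors)
  qed
  have "act (fdx f i) m = (\<Sum>k\<in>keys (taylor f). ?t k)"
    by (simp add: act2_in_y[symmetric] in_y_expansion act2_sum act2_cst_mult rep_fdx)
  \<comment> \<open>The exponent \<open>0\<close> is a key only if \<open>f\<close> is nonzero;
    inserting it lets the term of order zero be split off in every case.\<close>
  also have "\<dots> = (\<Sum>k\<in>insert 0 (keys (taylor f)). ?t k)"
    by (rule sum.mono_neutral_left) (auto simp: in_keys_iff)
  also have "\<dots> = ?t 0 + (\<Sum>k\<in>keys (taylor f) - {0}. ?t k)"
    by (simp add: sum.insert_remove)
  also have "keys (taylor f) - {0} = {k. k \<noteq> 0 \<and> pdk k f \<noteq> 0}" using keys by auto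
  also have "?t 0 = smul f (D i m)"
  proof -
    have "in_diff 1 = (in_y 1 :: ('n, 'k) mpoly2)" by (simp add: rhom.hs[OF rhom_in_diff] rhom.hs[OF rhom_in_y])
    moreover have "lookup (taylor f) 0 = f" by (simp add: lookup_taylor pdk_0 mfact_def)
    ultimately show ?thesis by (simp add: rep_fdx act2_in_y D_def)
  qed
  finally show ?thesis unfolding lookup_taylor .
qed

end

theorem theorem5p4:
  fixes smul :: "('n::finite, 'k::field_char_0) mpoly \<Rightarrow> 'm::ab_group_add \<Rightarrow> 'm"
    and act :: "('n, 'k) vfield \<Rightarrow> 'm \<Rightarrow> 'm"
  assumes "alg_closed TYPE('k)"
    and "AV_module smul act"
    and "finite_type smul"
  shows "\<exists>(d::nat) (\<phi> :: 'm \<Rightarrow> nat \<Rightarrow> ('n, 'k) mpoly) \<rho> B.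
           bij_betw \<phi> UNIV (free_mod d) \<and>
           (\<forall>m m'. \<phi> (m + m') = (\<lambda>j. \<phi> m j + \<phi> m' j)) \<and>
           (\<forall>f m. \<phi> (smul f m) = (\<lambda>j. f * \<phi> m j)) \<and>
           lie_rep d \<rho> \<and>
           gauge_fields d \<rho> B \<and>
           (\<forall>f g (u :: nat \<Rightarrow> 'k) i m.
              (\<forall>j\<ge>d. u j = 0) \<longrightarrow> \<phi> m = (\<lambda>l. g * cst (u l)) \<longrightarrow>
              \<phi> (act (fdx f i) m) =
                (\<lambda>l. f * pd i g * cst (u l)
                     + f * g * mat_vec d (B i) (\<lambda>j. cst (u j)) l
                     + (\<Sum>k\<in>{k. k \<noteq> 0 \<and> pdk k f \<noteq> 0}.
                          cst (inverse (of_nat (mfact k))) * g * pdk k f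
                          * mat_vec d (\<rho> (fdx (xmon k) i)) (\<lambda>j. cst (u j)) l)))"
proof -
  interpret av_module smul act by unfold_locales (fact assms(2))
  interpret connection_module smul D
    by unfold_locales (rule D_add, rule D_smul, rule assms(3))
  show ?thesis
  proof (rule free[OF assms(1)])
    fix d :: nat and W L
    assume linW: "lin scale smul W" and linL: "lin smul scale L" and supp: "\<And>m. supp_in {..<d} (L m)"
      and WL: "\<And>m. W (L m) = m" and LW: "\<And>v. supp_in {..<d} v \<Longrightarrow> L (W v) = v"
    have fm: "v \<in> free_mod d \<longleftrightarrow> supp_in {..<d} v" for v :: "nat \<Rightarrow> ('n, 'k) mpoly"
      by (auto simp: free_mod_def supp_in_def)
    \<comment> \<open>The columns are the values of \<open>F\<close> on the basis transported by
      \<open>W\<close>. They can be formed for every \<open>F\<close>, also for the non-linear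
      \<open>D i\<close>, whose columns are the entries of the gauge field.\<close>
    define mat where "mat F = (\<lambda>a b. L (F (W (unit_vec b))) a)" for F :: "'m \<Rightarrow> 'm"
    have mat_vec: "mat_vec d (mat F) (L m) = L (F m)" if F: "lin smul smul F" for F m
    proof
      fix j
      have lin: "lin scale scale (\<lambda>v. L (F (W v)))" by (rule lin_comp[OF lin_comp[OF linW F] linL])
      show "mat_vec d (mat F) (L m) j = L (F m) j"
      proof (cases "j < d")
        case True
        have "L (F (W (L m))) j = (\<Sum>l<d. L m l * L (F (W (unit_vec l))) j)"
          using lin_expand[OF lin _ supp[of m]] by (simp add: sum_fun_apply scale_def)
        then show ?thesis using True by (simp add: mat_vec_def mat_def WL mult.commute)
      next
        case False
        then show ?thesis using supp[of "F m"] by (simp add: mat_vec_def supp_in_def)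
      qed
    qed
    define \<rho> where "\<rho> \<eta> = mat (rep \<eta>)" for \<eta>
    define B where "B i = mat (D i)" for i
    have \<rho>: "mat_vec d (\<rho> \<eta>) (L m) = L (rep \<eta> m)" if "\<eta> \<in> L_plus" for \<eta> m
      unfolding \<rho>_def by (rule mat_vec) (simp add: lin_def rep_arg_add rep_smul[OF that])
    have B: "Dop d B i (L m) = L (D i m)" for i m
    proof -
      \<comment> \<open>Subtracting the trivial connection leaves a linear map with the same matrix as \<open>D i\<close>.\<close>
      define F where "F m = D i m - W (\<lambda>l. pd i (L m l))" for m
      have "F (x + y) = F x + F y" for x y
      proof -
        have "(\<lambda>l. pd i (L (x + y) l)) = (\<lambda>l. pd i (L x l)) + (\<lambda>l. pd i (L y l))"
          by (auto simp: lin_add[OF linL] pd_add)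
        then show ?thesis by (simp add: F_def D_add lin_add[OF linW])
      qed
      moreover have "F (smul a x) = smul a (F x)" for a x
      proof -
        have "(\<lambda>l. pd i (L (smul a x) l)) = scale (pd i a) (L x) + scale a (\<lambda>l. pd i (L x l))"
          by (auto simp: lin_scale[OF linL] pd_mult scale_def)
        then show ?thesis
          by (simp add: F_def D_smul lin_add[OF linW] lin_scale[OF linW] WL scale_right_diff_distrib)
      qed
      ultimately have "lin smul smul F" by (simp add: lin_def)
      then have "mat_vec d (mat F) (L m) = L (F m)" by (rule mat_vec)
      moreover have "mat_vec d (mat F) v = mat_vec d (B i) v" for v
      proof -
        have "F (W (unit_vec l)) = D i (W (unit_vec l))" if "l < d" for l
        proof -
          have "L (W (unit_vec l)) = unit_vec l" by (rule LW) (simp add: supp_in_unit_vec that)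
          \<comment> \<open>Basis vectors have constant entries, so the trivial connection kills
            them.\<close>
          then have "(\<lambda>j. pd i (L (W (unit_vec l)) j)) = 0" by (auto simp: unit_vec_def)
          then show ?thesis by (simp add: F_def lin_zero[OF linW])
        qed
        then show ?thesis by (auto simp: mat_vec_def mat_def B_def intro!: sum.cong)
      qed
      moreover have "L (F m) = L (D i m) - (\<lambda>l. pd i (L m l))"
      proof -
        have "supp_in {..<d} (\<lambda>l. pd i (L m l))" using supp[of m] by (simp add: supp_in_def)
        then show ?thesis by (simp add: F_def lin_diff[OF linL] LW)
      qed
      ultimately show ?thesis by (auto simp: Dop_def)
    qed
    have ex: "\<exists>m. v = L m" if "v \<in> free_mod d" for v using LW[of v] that fm by metis
    have Dcomm: "D i (D j m) = D j (D i m)" for i j m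
    proof -
      have "vf_bracket (fdx 1 i) (fdx 1 j) = (\<lambda>_. 0 :: ('n, 'k) mpoly)"
        by (simp add: vf_bracket_fdx) (simp add: fdx_def)
      then show ?thesis using av_simps(8)[of "fdx 1 i" "fdx 1 j" m] act_zero[of m] by (simp add: D_def diff_eq_eq add.commute)
    qed
    have Lplus: "(\<lambda>i. \<eta> i + \<xi> i) \<in> L_plus" "(\<lambda>i. cst c * \<eta> i) \<in> L_plus" "vf_bracket \<eta> \<xi> \<in> L_plus"
      if "\<eta> \<in> L_plus" "\<xi> \<in> L_plus" for \<eta> \<xi> :: "('n, 'k) vfield" and c
      using that unfolding L_plus_def vf_bracket_def vf_app_def
      by (simp_all add: ev_zero[symmetric] rhom.hs[OF rhom_ev])
    have "bij_betw L UNIV (free_mod d)"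
      by (rule bij_betw_byWitness[where f' = W]) (auto simp: fm supp WL LW)
    moreover have "\<forall>m m'. L (m + m') = (\<lambda>j. L m j + L m' j)" "\<forall>f m. L (smul f m) = (\<lambda>j. f * L m j)"
      using linL by (auto simp: lin_def scale_def)
    moreover have "lie_rep d \<rho>"
      unfolding lie_rep_def
      by (auto dest!: ex simp: \<rho> Lplus rep_add rep_cst rep_bracket lin_add[OF linL] lin_diff[OF linL] lin_scale[OF linL] scale_def)
    moreover have "gauge_fields d \<rho> B"
      unfolding gauge_fields_def by (auto dest!: ex simp: \<rho> B Dcomm D_rep)
    moreover have "L (act (fdx f i) m) =
                  (\<lambda>l. f * pd i g * cst (u l)
                       + f * g * mat_vec d (B i) (\<lambda>j. cst (u j)) l
                       + (\<Sum>k\<in>{k. k \<noteq> 0 \<and> pdk k f \<noteq> 0}.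
                            cst (inverse (of_nat (mfact k))) * g * pdk k f
                            * mat_vec d (\<rho> (fdx (xmon k) i)) (\<lambda>j. cst (u j)) l))"
      if u: "\<forall>j\<ge>d. u j = 0" and m: "L m = (\<lambda>l. g * cst (u l))" for f g and u :: "nat \<Rightarrow> 'k" and i m
    proof -
      let ?u = "\<lambda>j. cst (u j) :: ('n, 'k) mpoly"
      define m0 where "m0 = W ?u"
      have Lm0: "L m0 = ?u" unfolding m0_def by (rule LW) (use u in \<open>auto simp: supp_in_def\<close>)
      have "m = W (scale g ?u)" using WL[of m] m by (simp add: scale_def)
      then have mg: "m = smul g m0" by (simp add: lin_scale[OF linW] m0_def)
      have LD: "L (D i m0) = mat_vec d (B i) ?u"
        using B[of i m0] by (simp add: Lm0 Dop_def fun_eq_iff)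
      \<comment> \<open>For \<open>k\<close> nonzero the field \<open>x^k d/dx_i\<close> vanishes at
        the origin, so its operator is linear and represented by its matrix.\<close>
      have LR: "L (rep (fdx (xmon k) i) m0) = mat_vec d (\<rho> (fdx (xmon k) i)) ?u" if "k \<noteq> 0" for k
      proof -
        have "fdx (xmon k :: ('n, 'k) mpoly) i \<in> L_plus"
          using that by (auto simp: L_plus_def fdx_def xmon_def lookup_single when_def)
        then show ?thesis using \<rho>[of _ m0] by (simp add: Lm0)
      qed
      \<comment> \<open>The Leibniz rule in \<open>g\<close> produces the summand with the
        derivative of \<open>g\<close> and reduces the rest to the constant vector
        \<open>u\<close>.\<close>
      have "act (fdx f i) m = smul g (act (fdx f i) m0) + smul (f * pd i g) m0"
        unfolding mg by (simp only: av_simps(9) vf_app_fdx)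
      then have "L (act (fdx f i) m) = scale g (L (act (fdx f i) m0)) + scale (f * pd i g) ?u"
        by (simp only: lin_add[OF linL] lin_scale[OF linL] Lm0)
      also have "L (act (fdx f i) m0) = scale f (mat_vec d (B i) ?u) + (\<Sum>k\<in>{k. k \<noteq> 0 \<and> pdk k f \<noteq> 0}.
          scale (cst (inverse (of_nat (mfact k))) * pdk k f) (mat_vec d (\<rho> (fdx (xmon k) i)) ?u))"
        unfolding act_expansion lin_add[OF linL] lin_scale[OF linL] lin_sum[OF linL] LD
        by (intro arg_cong2[of _ _ _ _ "(+)"] refl sum.cong) (simp add: LR)
      finally show ?thesis
        by (simp add: fun_eq_iff sum_fun_apply scale_def algebra_simps sum_distrib_left)
    qed
    ultimately show ?thesis by blast
  qed
qed

end
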